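(* Let $U:\mathbb{R}^d\to\mathbb{R}$ be in $\mathcal{C}^4(\mathbb{R}^d)$ with $\int e^{-U(x)}dx<\infty$, having a global minimum at $0$ with $U(0)=0$, and such that $L:=\sup\|D^2U\|<\infty$, $L_H:=\sup\|D^3U\|<\infty$, $L_I:=\sup\|D^4U\|<\infty$. Let $\mu(dx)=Z^{-1}e^{-U(x)}dx$ with $Z=\int e^{-U(x)}dx$. Let $T>0$ and $h>0$ satisfy $T/h\in\mathbb{N}$ and $L(T^2+Th)\le 1/6$. Let $\tilde\pi$ be the transition kernel of unadjusted Hamiltonian Monte Carlo with duration $T$ and step size $h$. Suppose that there is an invariant probability measure $\tilde\mu$ of $\tilde\pi$ such that (A5) there exist constants $M_1,c\in(0,\infty)$ such that for any $m\in\mathbb{N}$ and any probability measure $\nu$ on $\mathbb{R}^d$, $W^1(\nu\tilde\pi^m,\tilde\mu)\le M_1e^{-cm}W^1(\nu,\tilde\mu)$; (A6) there exists a constant $M_2\in(0,\infty)$ such that $W^1(\mu,\tilde\mu)\le M_2h^2$. Then $$\mathrm{TV}(\mu,\tilde\mu)\ \le\ h^2\left[\tfrac32\left(T^{-2}+27\,d\,L_H^2\,T^4\right)^{1/2}M_2+C\right],$$ where $$\begin{aligned}C:=\Big[&d^3\big(4L_I^2T^4+14L_H^2L_IT^6+14L_H^4T^8\big)+d^2\big(35L_H^2T^2+8L_I^2T^4+28L_H^2L_IT^6+28L_H^4T^8\big)\\&+d\big(16L^2+4L_H^2T^2\big)+\big(2dL_H^2+L^2T^{-2}\big)\int|x|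^2\mu(dx)\\&+\big(dL_I^2+dL_H^2L_IT^2+dL_H^4T^4+L_H^2T^{-2}\big)\int|x|^4\mu(dx)\Big]^{1/2}.\end{aligned}$$
   Context: $|\cdot|$ is the Euclidean norm and $\|\cdot\|$ the operator norm of a multilinear form (supremum over unit vectors in each argument). Velocity Verlet: for $h>0$ let $\lfloor t\rfloor_h=\max\{s\in h\mathbb{Z}:s\le t\}$ and $\lceil t\rceil_h=\min\{s\in h\mathbb{Z}:s\ge t\}$. For $(x,v)\in\mathbb{R}^{2d}$, $(\tilde q_t(x,v),\tilde v_t(x,v))_{t\ge0}$ is the continuous, piecewise differentiable solution of $$\tfrac{d}{dt}\tilde q_t=\tilde v_{\lfloor t\rfloor_h}-(t-\lfloor t\rfloor_h)\nabla U(\tilde q_{\lfloor t\rfloor_h}),\qquad \tfrac{d}{dt}\tilde v_t=-\tfrac12\left(\nabla U(\tilde q_{\lfloor t\rfloor_h})+\nabla U(\tilde q_{\lceil t\rceil_h})\right)$$ with $(\tilde q_0,\tilde v_0)=(x,v)$. Equivalently, on the grid $t_k=kh$: $\tilde q_{t_{k+1}}=\tilde q_{t_k}+h\tilde v_{t_k}-\frac{h^2}{2}\nabla U(\tilde q_{t_k})$ and $\tilde v_{t_{k+1}}=\tilde v_{t_k}-\frac h2[\nabla U(\tilde q_{t_k})+\nabla U(\tilde q_{t_{k+1}})]$. The unadjusted HMC (uHMC) kernel with duration $T$ and step size $h$ is $\tilde\pi(x,A)=P[\tilde q_T(x,\xi)\in A]$ with $\xi\sim\mathcal N(0,I_d)$.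 For a probability measure $\nu$, $\nu\tilde\pi(A)=\int\nu(dx)\tilde\pi(x,A)$, and $\tilde\pi^m$ is the $m$-fold composition. $\mathrm{TV}(\nu,\eta)=\sup_A|\nu(A)-\eta(A)|$ over Borel sets $A$. $W^1(\nu,\eta)=\inf E[|X-Y|]$ over all couplings $(X,Y)$ of $\nu,\eta$. *)

theory Defs
  imports "HOL-Probability.Probability"
begin

definition fderiv ::
  "('a::real_normed_vector \<Rightarrow> 'b::real_normed_vector) \<Rightarrow> 'a \<Rightarrow> ('a \<Rightarrow>\<^sub>L 'b)" where
  "fderiv f x = (THE D. (f has_derivative blinfun_apply D) (at x))"

definition C1 :: "('a::real_normed_vector \<Rightarrow> 'b::real_normed_vector) \<Rightarrow> bool" where
  "C1 f \<longleftrightarrow> (\<forall>x. f differentiable (at x)) \<and> continuous_on UNIV (fderiv f)"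

text \<open>The norm of an iterated \<^type>\<open>blinfun\<close> is the operator norm of the corresponding
  multilinear form: by the next lemma, applied repeatedly, it is the supremum of the absolute
  values of the form over unit vectors in each argument.\<close>

lemma norm_blinfun_unit:
  fixes A :: "'a::euclidean_space \<Rightarrow>\<^sub>L 'b::real_normed_vector"
  shows "norm A = (SUP v\<in>{v. norm v = 1}. norm (blinfun_apply A v))"
proof (rule antisym)
  have bdd: "bdd_above ((\<lambda>v. norm (blinfun_apply A v)) ` {v. norm v = 1})"
    by (rule bdd_aboveI2[where M = "norm A"]) (metis (mono_tags) mem_Collect_eq mult.right_neutral norm_blinfun)
  obtain b :: 'a where b: "norm b = 1"
    using norm_Basis nonempty_Basis by blast
  show "norm A \<le> (SUP v\<in>{v. norm v = 1}. norm (blinfun_apply A v))"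
  proof (rule norm_blinfun_bound)
    show "0 \<le> (SUP v\<in>{v. norm v = 1}. norm (blinfun_apply A v))"
      by (rule order_trans[OF norm_ge_zero cSUP_upper[OF _ bdd]]) (use b in simp)
    fix x :: 'a
    show "norm (blinfun_apply A x) \<le> (SUP v\<in>{v. norm v = 1}. norm (blinfun_apply A v)) * norm x"
    proof (cases "x = 0")
      case False
      have "norm (blinfun_apply A (x /\<^sub>R norm x)) \<le> (SUP v\<in>{v. norm v = 1}. norm (blinfun_apply A v))"
        by (rule cSUP_upper[OF _ bdd]) (use False in simp)
      with False show ?thesis
        by (simp add: blinfun.scaleR_right field_simps)
    qed simp
  qed
  show "(SUP v\<in>{v. norm v = 1}. norm (blinfun_apply A v)) \<le> norm A"
  proof (rule cSUP_least)
    show "{v::'a. norm v = 1} \<noteq> {}" using b by blast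
    show "norm (blinfun_apply A v) \<le> norm A" if "v \<in> {v. norm v = 1}" for v
      using norm_blinfun[of A v] that by simp
  qed
qed

definition D2 :: "('a::real_normed_vector \<Rightarrow> real) \<Rightarrow> 'a \<Rightarrow> 'a \<Rightarrow>\<^sub>L 'a \<Rightarrow>\<^sub>L real" where
  "D2 U = fderiv (fderiv U)"

definition D3 :: "('a::real_normed_vector \<Rightarrow> real) \<Rightarrow> 'a \<Rightarrow> 'a \<Rightarrow>\<^sub>L 'a \<Rightarrow>\<^sub>L 'a \<Rightarrow>\<^sub>L real" where
  "D3 U = fderiv (D2 U)"

definition D4 :: "('a::real_normed_vector \<Rightarrow> real) \<Rightarrow> 'a \<Rightarrow> 'a \<Rightarrow>\<^sub>L 'a \<Rightarrow>\<^sub>L 'a \<Rightarrow>\<^sub>L 'a \<Rightarrow>\<^sub>L real" where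
  "D4 U = fderiv (D3 U)"

definition C4 :: "('a::real_normed_vector \<Rightarrow> real) \<Rightarrow> bool" where
  "C4 U \<longleftrightarrow> C1 U \<and> C1 (fderiv U) \<and> C1 (D2 U) \<and> C1 (D3 U)"

definition grad :: "('a::real_inner \<Rightarrow> real) \<Rightarrow> 'a \<Rightarrow> 'a" where
  "grad U x = (THE g. GDERIV U x :> g)"

definition grid_floor :: "real \<Rightarrow> real \<Rightarrow> real" where
  "grid_floor h t = h * of_int \<lfloor>t / h\<rfloor>"

definition grid_ceiling :: "real \<Rightarrow> real \<Rightarrow> real" where
  "grid_ceiling h t = h * of_int \<lceil>t / h\<rceil>"

definition verlet_solution ::
  "('a::euclidean_space \<Rightarrow> real) \<Rightarrow> real \<Rightarrow> 'a \<Rightarrow> 'a \<Rightarrow> (real \<Rightarrow> 'a) \<Rightarrow> (real \<Rightarrow> 'a) \<Rightarrow> bool" where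
  "verlet_solution U h x v q w \<longleftrightarrow>
     continuous_on {0..} q \<and> continuous_on {0..} w \<and> q 0 = x \<and> w 0 = v \<and>
     (\<forall>t>0. t / h \<notin> \<int> \<longrightarrow>
        (q has_vector_derivative
           w (grid_floor h t) - (t - grid_floor h t) *\<^sub>R grad U (q (grid_floor h t))) (at t) \<and>
        (w has_vector_derivative
           - ((1/2) *\<^sub>R (grad U (q (grid_floor h t)) + grad U (q (grid_ceiling h t))))) (at t))"

definition verlet_q :: "('a::euclidean_space \<Rightarrow> real) \<Rightarrow> real \<Rightarrow> real \<Rightarrow> 'a \<Rightarrow> 'a \<Rightarrow> 'a" where
  "verlet_q U h t x v = (THE y. \<exists>q w. verlet_solution U h x v q w \<and> y = q t)"

text \<open>For \<^term>\<open>h > 0\<close> a solution exists and is determined on the grid by the following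
  recursion (\<^verbatim>\<open>verlet_q_grid\<close> below), so the description in \<^const>\<open>verlet_q\<close> is proper there.\<close>

definition verlet_step :: "('a::euclidean_space \<Rightarrow> real) \<Rightarrow> real \<Rightarrow> 'a \<times> 'a \<Rightarrow> 'a \<times> 'a" where
  "verlet_step U h = (\<lambda>(x, v).
     let y = x + h *\<^sub>R v - (h\<^sup>2 / 2) *\<^sub>R grad U x
     in (y, v - (h / 2) *\<^sub>R (grad U x + grad U y)))"

lemma grid_cell:
  assumes "h > 0" "real k * h < t" "t < real (Suc k) * h"
  shows "grid_floor h t = real k * h" "grid_ceiling h t = real (Suc k) * h" "t / h \<notin> \<int>"
proof -
  have *: "real k < t / h" "t / h < real k + 1"
    using assms by (auto simp: field_simps)
  have f: "\<lfloor>t / h\<rfloor> = int k" using * by (intro floor_unique) auto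
  have c: "\<lceil>t / h\<rceil> = int (Suc k)" using * by (intro ceiling_unique) auto
  show "grid_floor h t = real k * h" "grid_ceiling h t = real (Suc k) * h"
    by (simp_all add: grid_floor_def grid_ceiling_def f c algebra_simps)
  show "t / h \<notin> \<int>"
  proof
    assume "t / h \<in> \<int>"
    then obtain i where i: "t / h = of_int i" by (elim Ints_cases)
    with f have "i = int k" by simp
    with * i show False by simp
  qed
qed

lemma grid_cellE:
  assumes "h > 0" "t > 0" "t / h \<notin> \<int>"
  obtains k where "real k * h < t" "t < real (Suc k) * h"
proof
  define k where "k = nat \<lfloor>t / h\<rfloor>"
  have "real k = of_int \<lfloor>t / h\<rfloor>" using assms by (simp add: k_def)
  moreover have "of_int \<lfloor>t / h\<rfloor> \<noteq> t / h" using assms(3) by (metis Ints_of_int)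
  ultimately have "real k < t / h" "t / h < real k + 1"
    by linarith+
  thus "real k * h < t" "t < real (Suc k) * h"
    using assms by (auto simp: field_simps)
qed

lemma verlet_cell_deriv:
  fixes a b g :: "'a::real_normed_vector"
  shows "((\<lambda>t. a + (t - c) *\<^sub>R b - ((t - c)\<^sup>2 / 2) *\<^sub>R g) has_vector_derivative b - (t - c) *\<^sub>R g) (at t)"
    and "((\<lambda>t. b - ((t - c) / 2) *\<^sub>R g) has_vector_derivative - ((1/2) *\<^sub>R g)) (at t)"
  by (auto intro!: derivative_eq_intros 
      simp: has_vector_derivative_def fun_eq_iff algebra_simps diff_divide_distrib)

lemma verlet_solution_grid:
  fixes U :: "'a::euclidean_space \<Rightarrow> real"
  assumes h: "h > 0" and sol: "verlet_solution U h x v q w"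
  shows "(q (real k * h), w (real k * h)) = (verlet_step U h ^^ k) (x, v)"
proof (induction k)
  case 0
  show ?case using sol by (simp add: verlet_solution_def)
next
  case (Suc k)
  define c e where "c = real k * h" and "e = real (Suc k) * h"
  have ce: "c \<le> e" "e - c = h" "0 \<le> c" using h by (auto simp: c_def e_def algebra_simps)
  have cont: "continuous_on {c..e} q" "continuous_on {c..e} w"
    using sol ce by (auto simp: verlet_solution_def elim!: continuous_on_subset)
  have der: "(q has_vector_derivative w c - (t - c) *\<^sub>R grad U (q c)) (at t)"
      "(w has_vector_derivative - ((1/2) *\<^sub>R (grad U (q c) + grad U (q e)))) (at t)"
    if "t \<in> {c<..<e}" for t
  proof -
    have t: "real k * h < t" "t < real (Suc k) * h" "t > 0"
      using that ce(3) by (auto simp: c_def e_def)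
    have "(q has_vector_derivative
           w (grid_floor h t) - (t - grid_floor h t) *\<^sub>R grad U (q (grid_floor h t))) (at t) \<and>
        (w has_vector_derivative
           - ((1/2) *\<^sub>R (grad U (q (grid_floor h t)) + grad U (q (grid_ceiling h t))))) (at t)"
      using sol grid_cell(3)[OF h t(1,2)] t(3) unfolding verlet_solution_def by blast
    thus "(q has_vector_derivative w c - (t - c) *\<^sub>R grad U (q c)) (at t)"
      "(w has_vector_derivative - ((1/2) *\<^sub>R (grad U (q c) + grad U (q e)))) (at t)"
      unfolding grid_cell(1,2)[OF h t(1,2)] c_def e_def by blast+
  qed
  have "((\<lambda>t. w c - (t - c) *\<^sub>R grad U (q c)) has_integral q e - q c) {c..e}"
    by (rule fundamental_theorem_of_calculus_interior[OF ce(1) cont(1) der(1)])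
  moreover have "((\<lambda>t. w c - (t - c) *\<^sub>R grad U (q c)) has_integral
      (q c + (e - c) *\<^sub>R w c - ((e - c)\<^sup>2 / 2) *\<^sub>R grad U (q c)) -
      (q c + (c - c) *\<^sub>R w c - ((c - c)\<^sup>2 / 2) *\<^sub>R grad U (q c))) {c..e}"
    by (rule fundamental_theorem_of_calculus[OF ce(1)])
       (rule has_vector_derivative_at_within[OF verlet_cell_deriv(1)])
  ultimately have "q e - q c =
      (q c + (e - c) *\<^sub>R w c - ((e - c)\<^sup>2 / 2) *\<^sub>R grad U (q c)) -
      (q c + (c - c) *\<^sub>R w c - ((c - c)\<^sup>2 / 2) *\<^sub>R grad U (q c))"
    by (rule has_integral_unique)
  hence qe: "q e = q c + h *\<^sub>R w c - (h\<^sup>2 / 2) *\<^sub>R grad U (q c)"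
    unfolding ce(2) by (simp add: algebra_simps)
  have "((\<lambda>t. - ((1/2) *\<^sub>R (grad U (q c) + grad U (q e)))) has_integral w e - w c) {c..e}"
    by (rule fundamental_theorem_of_calculus_interior[OF ce(1) cont(2) der(2)])
  moreover have "((\<lambda>t. - ((1/2) *\<^sub>R (grad U (q c) + grad U (q e)))) has_integral
      (w c - ((e - c) / 2) *\<^sub>R (grad U (q c) + grad U (q e))) -
      (w c - ((c - c) / 2) *\<^sub>R (grad U (q c) + grad U (q e)))) {c..e}"
    by (rule fundamental_theorem_of_calculus[OF ce(1)])
       (rule has_vector_derivative_at_within[OF verlet_cell_deriv(2)])
  ultimately have "w e - w c =
      (w c - ((e - c) / 2) *\<^sub>R (grad U (q c) + grad U (q e))) -
      (w c - ((c - c) / 2) *\<^sub>R (grad U (q c) + grad U (q e)))"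
    by (rule has_integral_unique)
  hence we: "w e = w c - (h / 2) *\<^sub>R (grad U (q c) + grad U (q e))"
    unfolding ce(2) by (simp add: algebra_simps)
  have "(q e, w e) = verlet_step U h (q c, w c)"
    using qe we by (simp add: verlet_step_def Let_def)
  thus ?case using Suc by (simp add: c_def e_def)
qed

lemma continuous_on_grid:
  fixes f :: "real \<Rightarrow> 'a::topological_space"
  assumes h: "h > 0" and f: "\<And>k. continuous_on {real k * h..real (Suc k) * h} f"
  shows "continuous_on {0..} f"
proof -
  have fin: "continuous_on {0..real k * h} f" for k
  proof (induction k)
    case (Suc k)
    have "{0..real (Suc k) * h} = {0..real k * h} \<union> {real k * h..real (Suc k) * h}"
      using h by (intro ivl_disj_un_two_touch(4)[symmetric]) (auto simp: algebra_simps)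
    thus ?case using continuous_on_closed_Un[OF _ _ Suc f] by simp
  qed simp
  show ?thesis
    unfolding continuous_on_eq_continuous_within
  proof
    fix t :: real assume t: "t \<in> {0..}"
    obtain k where k: "t / h < real k" using reals_Archimedean2 by blast
    hence tk: "t < real k * h" using h by (simp add: field_simps)
    have "continuous (at t within {0..real k * h}) f"
      using fin[of k] t tk by (simp add: continuous_on_eq_continuous_within)
    moreover have "at t within {0..real k * h} = at t within {0..}"
      by (rule at_within_nhd[of _ "{..<real k * h}"]) (use tk in auto)
    ultimately show "continuous (at t within {0..}) f" by simp
  qed
qed

lemma verlet_solution_exists:
  fixes U :: "'a::euclidean_space \<Rightarrow> real"
  assumes h: "h > 0"
  shows "\<exists>q w. verlet_solution U h x v q w"
proof -
  define a where "a k = fst ((verlet_step U h ^^ k) (x, v))" for k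
  define b where "b k = snd ((verlet_step U h ^^ k) (x, v))" for k
  define g where "g k = grad U (a k) + grad U (a (Suc k))" for k
  define P where "P k t = a k + (t - real k * h) *\<^sub>R b k
      - ((t - real k * h)\<^sup>2 / 2) *\<^sub>R grad U (a k)" for k t
  define R where "R k t = b k - ((t - real k * h) / 2) *\<^sub>R g k" for k t
  define q where "q t = P (nat \<lfloor>t / h\<rfloor>) t" for t
  define w where "w t = R (nat \<lfloor>t / h\<rfloor>) t" for t
  have step: "a (Suc k) = a k + h *\<^sub>R b k - (h\<^sup>2 / 2) *\<^sub>R grad U (a k)"
      "b (Suc k) = b k - (h / 2) *\<^sub>R g k" for k
    by (simp_all add: a_def b_def g_def verlet_step_def Let_def case_prod_beta)
  have grid: "q (real k * h) = a k" "w (real k * h) = b k" for k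
    using h by (simp_all add: q_def w_def P_def R_def)
  have cell: "q t = P k t" "w t = R k t" if "t \<in> {real k * h..real (Suc k) * h}" for k t
  proof -
    have "q t = P k t \<and> w t = R k t"
    proof (cases "t = real (Suc k) * h")
      case True
      have th: "t - real k * h = h" by (simp add: True algebra_simps)
      have "q t = a (Suc k)" "w t = b (Suc k)" using grid[of "Suc k"] True by blast+
      thus ?thesis by (simp add: P_def R_def step th)
    next
      case False
      hence "real k \<le> t / h" "t / h < real k + 1" using that h by (auto simp: field_simps)
      hence "\<lfloor>t / h\<rfloor> = int k" by (intro floor_unique) auto
      thus ?thesis by (simp add: q_def w_def)
    qed
    thus "q t = P k t" "w t = R k t" by auto
  qed
  have PR: "(P k has_vector_derivative b k - (t - real k * h) *\<^sub>R grad U (a k)) (at t)"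
      "(R k has_vector_derivative - ((1/2) *\<^sub>R g k)) (at t)" for k t
    unfolding P_def R_def by (rule verlet_cell_deriv)+
  have "continuous_on {real k * h..real (Suc k) * h} q"
      "continuous_on {real k * h..real (Suc k) * h} w" for k
  proof -
    have "continuous_on {real k * h..real (Suc k) * h} (P k)"
        "continuous_on {real k * h..real (Suc k) * h} (R k)"
      unfolding P_def R_def by (auto intro!: continuous_intros)
    thus "continuous_on {real k * h..real (Suc k) * h} q"
      "continuous_on {real k * h..real (Suc k) * h} w"
      using cell continuous_on_cong[OF refl, of _ q "P k"] continuous_on_cong[OF refl, of _ w "R k"] by blast+
  qed
  hence cont: "continuous_on {0..} q" "continuous_on {0..} w"
    using continuous_on_grid[OF h] by blast+
  have der: "(q has_vector_derivative
           w (grid_floor h t) - (t - grid_floor h t) *\<^sub>R grad U (q (grid_floor h t))) (at t) \<and>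
        (w has_vector_derivative
           - ((1/2) *\<^sub>R (grad U (q (grid_floor h t)) + grad U (q (grid_ceiling h t))))) (at t)"
    if t: "t > 0" "t / h \<notin> \<int>" for t
  proof -
    obtain k where k: "real k * h < t" "t < real (Suc k) * h"
      using grid_cellE[OF h t] .
    have "(q has_vector_derivative b k - (t - real k * h) *\<^sub>R grad U (a k)) (at t)"
      by (rule has_vector_derivative_transform_within_open[OF PR(1), where S = "{real k * h<..<real (Suc k) * h}"])
         (use k cell(1)[of _ k, symmetric] in auto)
    moreover have "(w has_vector_derivative - ((1/2) *\<^sub>R g k)) (at t)"
      by (rule has_vector_derivative_transform_within_open[OF PR(2), where S = "{real k * h<..<real (Suc k) * h}"])
         (use k cell(2)[of _ k, symmetric] in auto)
    ultimately show ?thesis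
      unfolding grid_cell[OF h k] grid g_def by simp
  qed
  have "q 0 = x" "w 0 = v" using grid[of 0] by (simp_all add: a_def b_def)
  with cont der have "verlet_solution U h x v q w"
    unfolding verlet_solution_def by blast
  thus ?thesis by blast
qed

lemma verlet_q_grid:
  fixes U :: "'a::euclidean_space \<Rightarrow> real"
  assumes "h > 0"
  shows "verlet_q U h (real k * h) x v = fst ((verlet_step U h ^^ k) (x, v))"
proof -
  have val: "q (real k * h) = fst ((verlet_step U h ^^ k) (x, v))"
    if "verlet_solution U h x v q w" for q w
    using arg_cong[OF verlet_solution_grid[OF assms that, of k], of fst] by simp
  obtain q w where "verlet_solution U h x v q w"
    using verlet_solution_exists[OF assms] by blast
  with val show ?thesis
    unfolding verlet_q_def by (intro the_equality) (force, blast)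
qed

definition std_gaussian :: "'a::euclidean_space measure" where
  "std_gaussian = density lborel (\<lambda>x. ennreal (\<Prod>b\<in>Basis. std_normal_density (x \<bullet> b)))"

definition uhmc_kernel ::
  "('a::euclidean_space \<Rightarrow> real) \<Rightarrow> real \<Rightarrow> real \<Rightarrow> 'a \<Rightarrow> 'a measure" where
  "uhmc_kernel U T h x = distr std_gaussian borel (\<lambda>\<xi>. verlet_q U h T x \<xi>)"

primrec kernel_power ::
  "('a::topological_space \<Rightarrow> 'a measure) \<Rightarrow> nat \<Rightarrow> 'a \<Rightarrow> 'a measure" where
  "kernel_power K 0 = (\<lambda>x. return borel x)"
| "kernel_power K (Suc m) = (\<lambda>x. kernel_power K m x \<bind> K)"

definition gibbs :: "('a::euclidean_space \<Rightarrow> real) \<Rightarrow> 'a measure" where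
  "gibbs U = density lborel (\<lambda>x. ennreal (exp (- U x) / (LINT y|lborel. exp (- U y))))"

definition TV :: "'a::topological_space measure \<Rightarrow> 'a measure \<Rightarrow> real" where
  "TV \<nu> \<eta> = (SUP A\<in>sets borel. \<bar>measure \<nu> A - measure \<eta> A\<bar>)"

definition couplings ::
  "'a::euclidean_space measure \<Rightarrow> 'a measure \<Rightarrow> ('a \<times> 'a) measure set" where
  "couplings \<nu> \<eta> = {\<gamma>. sets \<gamma> = sets (borel \<Otimes>\<^sub>M borel) \<and>
     distr \<gamma> borel fst = \<nu> \<and> distr \<gamma> borel snd = \<eta>}"

text \<open>Couplings are represented by their joint laws; the distance may be infinite.\<close>

definition W1 :: "'a::euclidean_space measure \<Rightarrow> 'a measure \<Rightarrow> ennreal" where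
  "W1 \<nu> \<eta> = (INF \<gamma>\<in>couplings \<nu> \<eta>. \<integral>\<^sup>+ z. ennreal (norm (fst z - snd z)) \<partial>\<gamma>)"

definition ennreal_sqrt :: "ennreal \<Rightarrow> ennreal" where
  "ennreal_sqrt a = (if a = \<infinity> then \<infinity> else ennreal (sqrt (enn2real a)))"

end

theory Submission
  imports Defs
begin

text \<open>Neither the Hamiltonian flow nor a Jacobian is used: for a test function \<open>f\<close> (continuously
  differentiable, values in \<open>[0,1]\<close>, bounded derivative) the difference of the integrals of \<open>f\<close>
  against \<open>\<mu>\<close> and the invariant measure is split into two parts, each differentiated along a curve
  of maps. Whenever the velocity of the curve is \<open>D\<psi> W\<close>, integration by parts against the
  density \<open>exp (- V)\<close> turns the derivative of the integral of \<open>f \<circ> \<psi>\<close> into the integral of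
  \<open>(f \<circ> \<psi>) \<delta>(W)\<close> with \<open>\<delta>(W) = W \<cdot> \<nabla>V - div W\<close>, and
  \<open>E \<delta>(W)\<^sup>2 \<le> E (D\<^sup>2V(W, W) + tr (DW)\<^sup>2)\<close> gives the right dependence on the dimension.

  Regularisation: moving the initial position from \<open>x\<close> to \<open>y\<close> is compensated by the velocity field
  \<open>w = (D\<^sub>v q\<^sub>T)\<^sup>-\<^sup>1 D\<^sub>x q\<^sub>T (y - x)\<close>, where \<open>q\<^sub>T\<close> is the Verlet position. Hence one transition turns
  the Wasserstein bound into a total variation bound.

  Discretisation error: the Verlet step \<open>\<psi>\<^sub>s\<close> of size \<open>s\<close> is a curve in \<open>s\<close> starting at the
  identity, whose velocity is \<open>D\<psi>\<^sub>s\<close> applied to the Hamiltonian field, which has zero divergence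
  \<open>\<delta>\<close> under \<open>\<mu> \<otimes> N(0, I)\<close>, plus a field of size \<open>O(s\<^sup>2)\<close>. So one step of size \<open>h\<close> changes the
  expectation of a test function by \<open>O(h\<^sup>3)\<close>, and since the composition of a test function with a
  Verlet step is again one, \<open>T / h\<close> steps change it by \<open>O(T h\<^sup>2)\<close>, always starting from the exact
  measure \<open>\<mu> \<otimes> N(0, I)\<close>.\<close>

section \<open>Smoothness by directional derivatives\<close>

text \<open>A total variation bound cannot use the derivative of a test function, whose size is not
  controlled; every such derivative has to be moved onto the density. The power of the dimension d
  is then decided by the size of the divergence. Bounding \<open>div W\<close> pointwise costs a
  factor d, whereas the second moment identity contains the trace of the square of
  \<open>DW\<close>, which is at most d times a squared operator norm, so only the square root of d
  is paid. That identity rests on two integrations by parts and wants fields that are twice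
  continuously differentiable. The error fields contain the Hessian of \<open>U\<close>, and the
  field of the regularisation solves an equation in the first derivative of the position map: hence
  the class C4. Since the divergence has mean zero, centring the test function saves a factor 2,
  which pays for treating position and velocity errors separately. The condition on
  \<open>L * (T\<^sup>2 + T * h)\<close> keeps the discrete trajectory close to free motion: the
  velocity derivative of the position differs from \<open>T\<close> times the identity by at most
  \<open>T/11\<close>, so it can be inverted.\<close>

definition dd :: "('a::euclidean_space \<Rightarrow> 'b::real_normed_vector) \<Rightarrow> 'a \<Rightarrow> 'a \<Rightarrow> 'b" where
  "dd f e x = frechet_derivative f (at x) e"

text \<open>Recursion over directional derivatives keeps the type of the function fixed; iterated
  Frechet derivatives would not.\<close>

primrec smooth :: "nat \<Rightarrow> ('a::euclidean_space \<Rightarrow> 'b::real_normed_vector) \<Rightarrow> bool" where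
  "smooth 0 f \<longleftrightarrow> continuous_on UNIV f"
| "smooth (Suc n) f \<longleftrightarrow> (\<forall>x. f differentiable at x) \<and> (\<forall>e. smooth n (dd f e))"

lemma dd_eqI: "(f has_derivative f') (at x) \<Longrightarrow> dd f e x = f' e"
  unfolding dd_def by (metis frechet_derivative_at)

lemma smooth_SucI:
  assumes "\<And>x. (f has_derivative f' x) (at x)" "\<And>e. smooth n (\<lambda>x. f' x e)"
  shows "smooth (Suc n) f"
proof -
  have "dd f e = (\<lambda>x. f' x e)" for e
    using dd_eqI[OF assms(1)] by blast
  thus ?thesis using assms by (auto simp: differentiable_def)
qed

lemma smooth_has_derivative: "smooth (Suc n) f \<Longrightarrow> (f has_derivative (\<lambda>e. dd f e x)) (at x)"
  unfolding dd_def using frechet_derivative_works[of f "at x"] by (simp add: eta_contract_eq)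

lemma smooth_SucD: "smooth (Suc n) f \<Longrightarrow> smooth n f"
proof (induction n arbitrary: f)
  case 0
  thus ?case
    by (auto intro!: continuous_at_imp_continuous_on differentiable_imp_continuous_within)
next
  case (Suc n)
  thus ?case by (metis smooth.simps(2))
qed

lemma smooth_mono: "smooth n f \<Longrightarrow> m \<le> n \<Longrightarrow> smooth m f"
  by (induction n) (auto simp: le_Suc_eq simp del: smooth.simps dest: smooth_SucD)

lemma smooth_continuous: "smooth n f \<Longrightarrow> continuous_on S f"
  using smooth_mono[of n f 0] by (auto intro: continuous_on_subset)

lemma smooth_measurable:
  fixes f :: "'a::euclidean_space \<Rightarrow> 'b::{real_normed_vector,second_countable_topology}"
  shows "smooth n f \<Longrightarrow> f \<in> borel_measurable borel"
  by (intro borel_measurable_continuous_onI smooth_continuous)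

lemma smooth_const [simp, intro]: "smooth n (\<lambda>x. c)"
proof (induction n arbitrary: c)
  case (Suc n)
  show ?case
    by (rule smooth_SucI[where f'="\<lambda>x e. 0"]) (use Suc in auto)
qed auto

lemma smooth_linear: "bounded_linear f \<Longrightarrow> smooth n f"
proof (induction n)
  case 0
  thus ?case by (simp add: linear_continuous_on)
next
  case (Suc n)
  show ?case
    by (rule smooth_SucI[where f'="\<lambda>x e. f e"]) (use Suc in \<open>auto intro: bounded_linear_imp_has_derivative\<close>)
qed

lemma smooth_ident [simp, intro]: "smooth n (\<lambda>x. x)"
  by (rule smooth_linear) (rule bounded_linear_ident)

lemma smooth_add: "smooth n f \<Longrightarrow> smooth n g \<Longrightarrow> smooth n (\<lambda>x. f x + g x)"
proof (induction n arbitrary: f g)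
  case (Suc n)
  show ?case
    by (rule smooth_SucI[OF has_derivative_add[OF smooth_has_derivative smooth_has_derivative]])
      (use Suc in auto)
qed (auto intro: continuous_intros)

lemma smooth_bilinear:
  assumes "bounded_bilinear pr"
  shows "smooth n f \<Longrightarrow> smooth n g \<Longrightarrow> smooth n (\<lambda>x. pr (f x) (g x))"
proof (induction n arbitrary: f g)
  case 0
  thus ?case by (auto intro: bounded_bilinear.continuous_on[OF assms])
next
  case (Suc n)
  note fg = smooth_SucD[OF Suc.prems(1)] smooth_SucD[OF Suc.prems(2)]
  show ?case
    by (rule smooth_SucI[OF bounded_bilinear.FDERIV[OF assms smooth_has_derivative[OF Suc.prems(1)] smooth_has_derivative[OF Suc.prems(2)]]])
      (use Suc fg in \<open>auto intro!: smooth_add\<close>)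
qed

lemmas smooth_scaleR = smooth_bilinear[OF bounded_bilinear_scaleR]
lemmas smooth_inner = smooth_bilinear[OF bounded_bilinear_inner]
lemmas smooth_mult = smooth_bilinear[OF bounded_bilinear_mult]

lemma smooth_bounded_linear:
  "bounded_linear F \<Longrightarrow> smooth n f \<Longrightarrow> smooth n (\<lambda>x. F (f x))"
proof (induction n arbitrary: f)
  case 0
  thus ?case by (auto intro: bounded_linear.continuous_on)
next
  case (Suc n)
  show ?case
    by (rule smooth_SucI[OF bounded_linear.has_derivative[OF Suc.prems(1) smooth_has_derivative[OF Suc.prems(2)]]])
      (use Suc in auto)
qed

lemma smooth_minus: "smooth n f \<Longrightarrow> smooth n (\<lambda>x. - f x)"
  by (rule smooth_bounded_linear[OF bounded_linear_minus[OF bounded_linear_ident]])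

lemma smooth_diff: "smooth n f \<Longrightarrow> smooth n g \<Longrightarrow> smooth n (\<lambda>x. f x - g x)"
  using smooth_add[OF _ smooth_minus, of n f g] by simp

lemma smooth_sum: "(\<And>i. i \<in> I \<Longrightarrow> smooth n (f i)) \<Longrightarrow> smooth n (\<lambda>x. \<Sum>i\<in>I. f i x)"
  by (induction I rule: infinite_finite_induct) (auto intro: smooth_add)

lemma smooth_divide_const:
  fixes f :: "'a::euclidean_space \<Rightarrow> real"
  shows "smooth n f \<Longrightarrow> smooth n (\<lambda>x. f x / c)"
  by (rule smooth_bounded_linear[OF bounded_linear_divide])

lemma smooth_fst: "smooth n fst" and smooth_snd: "smooth n snd"
  by (simp_all add: smooth_linear bounded_linear_fst bounded_linear_snd)

lemma smooth_Pair:
  assumes "smooth n f" "smooth n g" shows "smooth n (\<lambda>x. (f x, g x))"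
proof -
  have "smooth n (\<lambda>x. (f x, 0) + (0, g x))"
    by (intro smooth_add smooth_bounded_linear[where F="\<lambda>a. (a, 0)"] smooth_bounded_linear[where F="\<lambda>a. (0, a)"] assms
        bounded_linear_Pair bounded_linear_ident bounded_linear_zero)
  thus ?thesis by simp
qed

lemma linear_dd: "f differentiable at x \<Longrightarrow> linear (\<lambda>e. dd f e x)"
  unfolding dd_def using linear_frechet_derivative[of f "at x"] by (simp add: eta_contract_eq)

lemma linear_Basis_sum:
  fixes F :: "'a::euclidean_space \<Rightarrow> 'b::real_vector"
  assumes "linear F" shows "F a = (\<Sum>b\<in>Basis. (a \<bullet> b) *\<^sub>R F b)"
proof -
  have "F a = F (\<Sum>b\<in>Basis. (a \<bullet> b) *\<^sub>R b)" by (simp add: euclidean_representation)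
  thus ?thesis using assms by (simp add: linear_sum linear_scale)
qed

text \<open>In the chain rule a derivative is taken in a direction that moves with the point.
  Expanding this direction in the basis leaves finitely many functions with fixed direction, to
  which an induction hypothesis on the order applies.\<close>

lemma smooth_linear_apply:
  fixes A :: "'a::euclidean_space \<Rightarrow> 'c::euclidean_space \<Rightarrow> 'b::real_normed_vector"
  assumes "\<And>x. linear (A x)" "\<And>b. b \<in> Basis \<Longrightarrow> smooth n (\<lambda>x. A x b)" "smooth n w"
  shows "smooth n (\<lambda>x. A x (w x))"
proof -
  have "A x (w x) = (\<Sum>b\<in>Basis. (w x \<bullet> b) *\<^sub>R A x b)" for x
    by (rule linear_Basis_sum[OF assms(1)])
  moreover have "smooth n (\<lambda>x. \<Sum>b\<in>Basis. (w x \<bullet> b) *\<^sub>R A x b)"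
    by (intro smooth_sum smooth_scaleR smooth_inner assms smooth_const)
  ultimately show ?thesis by simp
qed

lemma smooth_compose:
  "smooth n f \<Longrightarrow> smooth n g \<Longrightarrow> smooth n (\<lambda>x. f (g x))"
proof (induction n arbitrary: f)
  case 0
  thus ?case by (auto intro: continuous_on_compose2)
next
  case (Suc n)
  show ?case
  proof (rule smooth_SucI)
    fix x show "((\<lambda>x. f (g x)) has_derivative (\<lambda>e. dd f (dd g e x) (g x))) (at x)"
      using has_derivative_compose[OF smooth_has_derivative[OF Suc.prems(2)] smooth_has_derivative[OF Suc.prems(1)]] .
  next
    fix e show "smooth n (\<lambda>x. dd f (dd g e x) (g x))"
      by (rule smooth_linear_apply[where A="\<lambda>x c. dd f c (g x)"])
        (use Suc smooth_SucD[OF Suc.prems(2)] in \<open>auto intro: linear_dd\<close>)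
  qed
qed

lemma dd_compose:
  "smooth (Suc n) f \<Longrightarrow> smooth (Suc n) g \<Longrightarrow> dd (\<lambda>x. f (g x)) e x = dd f (dd g e x) (g x)"
  using has_derivative_compose[OF smooth_has_derivative smooth_has_derivative] by (rule dd_eqI)

lemma smooth_exp: "smooth n (exp :: real \<Rightarrow> real)"
proof (induction n)
  case (Suc n)
  show ?case
    by (rule smooth_SucI[where f'="\<lambda>x e. exp x * e"])
      (auto intro!: derivative_eq_intros smooth_mult Suc)
qed (auto intro: continuous_intros)

text \<open>Powers of the positive part yield compactly supported functions of any prescribed finite
  smoothness with explicit derivatives. Only \<open>t = 0\<close> needs an argument: there the
  difference quotient is dominated by \<open>(max 0 h) ^ Suc n\<close>, which tends to zero.\<close>

lemma pospart_power_deriv: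
  "((\<lambda>t::real. (max 0 t) ^ Suc (Suc n)) has_derivative (\<lambda>e. (real (Suc (Suc n)) * (max 0 t) ^ Suc n) * e)) (at t)"
proof (cases "t = 0")
  case False
  show ?thesis
  proof (cases "t > 0")
    case True
    have "((\<lambda>t::real. t ^ Suc (Suc n)) has_derivative (\<lambda>e. (real (Suc (Suc n)) * (max 0 t) ^ Suc n) * e)) (at t)"
      using True by (auto intro!: derivative_eq_intros simp: fun_eq_iff simp del: power_Suc)
    thus ?thesis
      by (rule has_derivative_transform_within_open[OF _ open_greaterThan[of 0]]) (use True in auto)
  next
    case neg: False
    have "((\<lambda>t::real. 0) has_derivative (\<lambda>e. (real (Suc (Suc n)) * (max 0 t) ^ Suc n) * e)) (at t)"
      using neg by (auto intro!: derivative_eq_intros)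
    thus ?thesis
      by (rule has_derivative_transform_within_open[OF _ open_lessThan[of 0]]) (use False neg in auto)
  qed
next
  case True
  have "((\<lambda>h::real. (max 0 h) ^ Suc n) \<longlongrightarrow> (max 0 0) ^ Suc n) (at 0)"
    by (intro tendsto_intros)
  hence lim: "((\<lambda>h::real. (max 0 h) ^ Suc n) \<longlongrightarrow> 0) (at 0)"
    by simp
  have "((\<lambda>t::real. (max 0 t) ^ Suc (Suc n)) has_real_derivative 0) (at 0)"
    unfolding DERIV_def
  proof (rule Lim_null_comparison[OF _ lim])
    show "\<forall>\<^sub>F h in at 0. norm ((max 0 (0 + h) ^ Suc (Suc n) - max 0 0 ^ Suc (Suc n)) / h) \<le> (max 0 h) ^ Suc n"
      by (rule always_eventually) (auto simp: max_def abs_mult)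
  qed
  thus ?thesis using True by (simp add: has_field_derivative_def lambda_zero[symmetric])
qed

lemma smooth_pospart_power: "smooth n (\<lambda>t::real. (max 0 t) ^ Suc n)"
proof (induction n)
  case 0
  show ?case by (auto intro!: continuous_intros)
next
  case (Suc n)
  show ?case
    by (rule smooth_SucI[OF pospart_power_deriv]) (intro smooth_mult Suc smooth_const)
qed

section \<open>Derivatives along lines and symmetry of second derivatives\<close>

lemma dd_line:
  assumes "smooth (Suc n) f"
  shows "((\<lambda>s. f (p + s *\<^sub>R a)) has_vector_derivative dd f a (p + s *\<^sub>R a)) (at s)"
proof -
  have "((\<lambda>s. f (p + s *\<^sub>R a)) has_derivative (\<lambda>e. dd f (e *\<^sub>R a) (p + s *\<^sub>R a))) (at s)"
    by (rule has_derivative_compose[OF _ smooth_has_derivative[OF assms]])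
      (auto intro!: derivative_eq_intros)
  thus ?thesis
    using linear_scale[OF linear_dd, of f "p + s *\<^sub>R a" _ a] assms
    by (simp add: has_vector_derivative_def)
qed

text \<open>Both mixed derivatives are limits of the same double difference quotient.\<close>

lemma dd_commute_real:
  fixes f :: "'a::euclidean_space \<Rightarrow> real"
  assumes "smooth 2 f"
  shows "dd (dd f a) b x = dd (dd f b) a x"
proof -
  have s: "smooth (Suc (Suc 0)) f" using assms by (simp only: numeral_2_eq_2)
  \<comment> \<open>Two applications of the mean value theorem: along \<open>a\<close> to the
    increment in direction \<open>b\<close>, then along \<open>b\<close> to the directional
    derivative so obtained. The left side is symmetric in \<open>a\<close> and \<open>b\<close>, so
    the limit may be read in either order.\<close>
  have mv: "\<exists>\<sigma>\<in>{0<..<t}. \<exists>\<tau>\<in>{0<..<t}.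
      f (x + t *\<^sub>R a + t *\<^sub>R b) - f (x + t *\<^sub>R a) - f (x + t *\<^sub>R b) + f x
      = t * t * dd (dd f a) b (x + \<sigma> *\<^sub>R a + \<tau> *\<^sub>R b)" if t: "t > 0" for t and a b
  proof -
    have d1: "((\<lambda>s. f (x + s *\<^sub>R a + t *\<^sub>R b) - f (x + s *\<^sub>R a)) has_real_derivative
        dd f a (x + s *\<^sub>R a + t *\<^sub>R b) - dd f a (x + s *\<^sub>R a)) (at s)" for s
    proof -
      have "((\<lambda>s. f (x + s *\<^sub>R a + c)) has_real_derivative dd f a (x + s *\<^sub>R a + c)) (at s)" for c
        using dd_line[OF s, of "x + c" a s]
        by (simp add: has_real_derivative_iff_has_vector_derivative algebra_simps)
      from DERIV_diff[OF this[of "t *\<^sub>R b"] this[of 0]] show ?thesis by simp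
    qed
    from MVT2[OF t d1]
    obtain \<sigma> where \<sigma>: "0 < \<sigma>" "\<sigma> < t" and e1: "f (x + t *\<^sub>R a + t *\<^sub>R b) - f (x + t *\<^sub>R a) - (f (x + t *\<^sub>R b) - f x)
      = t * (dd f a (x + \<sigma> *\<^sub>R a + t *\<^sub>R b) - dd f a (x + \<sigma> *\<^sub>R a))"
      by auto
    have d2: "((\<lambda>s. dd f a (x + \<sigma> *\<^sub>R a + s *\<^sub>R b)) has_real_derivative
        dd (dd f a) b (x + \<sigma> *\<^sub>R a + s *\<^sub>R b)) (at s)" for s
    proof -
      have s': "smooth (Suc 0) (dd f a)" using s by simp
      show ?thesis
        using dd_line[OF s', of "x + \<sigma> *\<^sub>R a" b s]
        by (simp add: has_real_derivative_iff_has_vector_derivative)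
    qed
    from MVT2[OF t d2]
    obtain \<tau> where \<tau>: "0 < \<tau>" "\<tau> < t" and e2: "dd f a (x + \<sigma> *\<^sub>R a + t *\<^sub>R b) - dd f a (x + \<sigma> *\<^sub>R a)
      = t * dd (dd f a) b (x + \<sigma> *\<^sub>R a + \<tau> *\<^sub>R b)"
      by auto
    show ?thesis
      by (rule bexI[of _ \<sigma>], rule bexI[of _ \<tau>]) (use \<sigma> \<tau> e1 e2 in \<open>auto simp: algebra_simps\<close>)
  qed
  have lim: "((\<lambda>t. (f (x + t *\<^sub>R a + t *\<^sub>R b) - f (x + t *\<^sub>R a) - f (x + t *\<^sub>R b) + f x) / (t * t))
      \<longlongrightarrow> dd (dd f a) b x) (at_right 0)" for a b
  proof (rule tendstoI)
    fix \<epsilon> :: real assume \<epsilon>: "\<epsilon> > 0"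
    have "continuous_on UNIV (dd (dd f a) b)" using s by simp
    then obtain \<delta> where \<delta>: "\<delta> > 0" "\<And>y. dist y x < \<delta> \<Longrightarrow> dist (dd (dd f a) b y) (dd (dd f a) b x) < \<epsilon>"
      unfolding continuous_on_iff using \<epsilon> by (metis UNIV_I)
    \<comment> \<open>For \<sigma>, \<tau> < t < r the intermediate point stays within \<delta> of
      x; the summand 1 covers vanishing directions.\<close>
    define r where "r = \<delta> / (norm a + norm b + 1)"
    have pos: "norm a + norm b + 1 > 0" by (smt (verit) norm_ge_zero)
    have r: "r > 0" using \<delta> pos by (simp add: r_def)
    have "dist ((f (x + t *\<^sub>R a + t *\<^sub>R b) - f (x + t *\<^sub>R a) - f (x + t *\<^sub>R b) + f x) / (t * t)) (dd (dd f a) b x) < \<epsilon>"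
      if t: "0 < t" "t < r" for t
    proof -
      obtain \<sigma> \<tau> where st: "0 < \<sigma>" "\<sigma> < t" "0 < \<tau>" "\<tau> < t"
        and e: "f (x + t *\<^sub>R a + t *\<^sub>R b) - f (x + t *\<^sub>R a) - f (x + t *\<^sub>R b) + f x
      = t * t * dd (dd f a) b (x + \<sigma> *\<^sub>R a + \<tau> *\<^sub>R b)"
        using mv[OF t(1), of a b] by auto
      have "norm (\<sigma> *\<^sub>R a + \<tau> *\<^sub>R b) \<le> \<sigma> * norm a + \<tau> * norm b"
        using norm_triangle_ineq[of "\<sigma> *\<^sub>R a" "\<tau> *\<^sub>R b"] st by simp
      also have "\<dots> \<le> t * norm a + t * norm b"
        using st by (intro add_mono mult_right_mono) auto
      also have "\<dots> < t * (norm a + norm b + 1)" using t by (simp add: algebra_simps)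
      also have "\<dots> < r * (norm a + norm b + 1)"
        using t pos by (intro mult_strict_right_mono) auto
      also have "\<dots> = \<delta>" using pos by (simp add: r_def)
      finally have "dist (x + \<sigma> *\<^sub>R a + \<tau> *\<^sub>R b) x < \<delta>" by (simp add: dist_norm add.assoc)
      thus ?thesis using \<delta>(2) e t by simp
    qed
    thus "\<forall>\<^sub>F t in at_right 0. dist ((f (x + t *\<^sub>R a + t *\<^sub>R b) - f (x + t *\<^sub>R a) - f (x + t *\<^sub>R b) + f x) / (t * t)) (dd (dd f a) b x) < \<epsilon>"
      unfolding eventually_at_right_field using r by blast
  qed
  have "((\<lambda>t. (f (x + t *\<^sub>R a + t *\<^sub>R b) - f (x + t *\<^sub>R a) - f (x + t *\<^sub>R b) + f x) / (t * t))
      \<longlongrightarrow> dd (dd f b) a x) (at_right 0)"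
    using lim[of b a] by (simp add: algebra_simps)
  with lim[of a b] show ?thesis
    using tendsto_unique trivial_limit_at_right_real by blast
qed

text \<open>Makes the definite description in \<open>fderiv\<close> proper: a derivative is bounded
  linear, hence representable by \<open>Blinfun\<close>, and it is unique.\<close>

lemma fderiv_works:
  fixes f :: "'a::euclidean_space \<Rightarrow> 'b::real_normed_vector"
  assumes "f differentiable at x"
  shows "(f has_derivative blinfun_apply (fderiv f x)) (at x)"
proof -
  obtain f' where f': "(f has_derivative f') (at x)" using assms by (auto simp: differentiable_def)
  have "(f has_derivative blinfun_apply (Blinfun f')) (at x)"
    using f' by (simp add: bounded_linear_Blinfun_apply has_derivative_bounded_linear)
  moreover have "D = Blinfun f'" if "(f has_derivative blinfun_apply D) (at x)" for D
    using has_derivative_unique[OF that f'] by (metis blinfun_apply_inverse)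
  ultimately show ?thesis unfolding fderiv_def by (rule theI)
qed

text \<open>The bridge from iterated Frechet derivatives, whose types grow, to
  \<open>smooth\<close>: evaluation in a direction is bounded linear and so preserves
  smoothness.\<close>

lemma smooth_fderiv:
  assumes "C1 f" "smooth n (fderiv f)"
  shows "smooth (Suc n) f"
  by (rule smooth_SucI[OF fderiv_works])
    (use assms in \<open>auto simp: C1_def intro!: smooth_bounded_linear[OF blinfun.bounded_linear_left]\<close>)

declare smooth.simps [simp del]

section \<open>Integration by parts\<close>

lemma smooth_dd: "smooth n f \<Longrightarrow> m < n \<Longrightarrow> smooth m (dd f e)"
  by (metis Suc_leI smooth.simps(2) smooth_mono)

lemma has_derivative_dd: "smooth n f \<Longrightarrow> 0 < n \<Longrightarrow> (f has_derivative (\<lambda>e. dd f e x)) (at x)"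
  by (metis gr0_implies_Suc smooth_has_derivative)

lemma smooth_linear_dd: "smooth n f \<Longrightarrow> 0 < n \<Longrightarrow> linear (\<lambda>e. dd f e x)"
  using has_derivative_dd has_derivative_linear by blast

lemma dd_mult:
  fixes f g :: "'a::euclidean_space \<Rightarrow> real"
  assumes "smooth n f" "smooth m g" "0 < n" "0 < m"
  shows "dd (\<lambda>x. f x * g x) e x = f x * dd g e x + dd f e x * g x"
  by (rule dd_eqI) (rule has_derivative_mult[OF has_derivative_dd[OF assms(1,3)] has_derivative_dd[OF assms(2,4)]])

lemma dd_exp_uminus:
  fixes V :: "'a::euclidean_space \<Rightarrow> real"
  assumes "smooth n V" "0 < n"
  shows "dd (\<lambda>x. exp (- V x)) e x = - dd V e x * exp (- V x)"
  by (rule dd_eqI) (auto intro!: derivative_eq_intros has_derivative_dd assms)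

lemma smooth_exp_uminus:
  fixes V :: "'a::euclidean_space \<Rightarrow> real"
  shows "smooth n V \<Longrightarrow> smooth n (\<lambda>x. exp (- V x))"
  by (rule smooth_compose[OF smooth_exp smooth_minus])

text \<open>Exponent 3 is the least integer power for which the positive part is twice continuously
  differentiable; a truncated field has to remain \<open>smooth 2\<close>.\<close>

definition cutoff :: "real \<Rightarrow> 'a::euclidean_space \<Rightarrow> real" where
  "cutoff R x = (max 0 (1 - (x \<bullet> x) / R\<^sup>2)) ^ Suc 2"

lemma smooth_cutoff: "smooth 2 (cutoff R)"
  unfolding cutoff_def
  by (intro smooth_compose[OF smooth_pospart_power] smooth_diff smooth_divide_const smooth_inner
      smooth_const smooth_ident)

lemma cutoff_range: "0 \<le> cutoff R x" "cutoff R x \<le> 1"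
proof -
  have "0 \<le> x \<bullet> x / R\<^sup>2" by simp
  hence *: "0 \<le> max 0 (1 - (x \<bullet> x) / R\<^sup>2)" "max 0 (1 - (x \<bullet> x) / R\<^sup>2) \<le> 1" by auto
  show "0 \<le> cutoff R x" "cutoff R x \<le> 1"
    unfolding cutoff_def using * by (auto simp del: power_Suc intro: power_le_one)
qed

lemma cutoff_eq_0: "R > 0 \<Longrightarrow> R \<le> norm x \<Longrightarrow> cutoff R x = 0"
  by (simp add: cutoff_def dot_square_norm field_simps power_mono)

text \<open>The derivative is \<open>3 * p\<^sup>2 * (- 2 * (x \<bullet> e) / R\<^sup>2)\<close>
  with \<open>p\<close> between 0 and 1, and \<open>norm x \<le> R\<close> on the support. The
  factor \<open>1 / R\<close> makes it vanish in the limit, and for \<open>R \<ge> 1\<close> it is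
  bounded uniformly.\<close>

lemma dd_cutoff_bound:
  assumes "R > 0"
  shows "\<bar>dd (cutoff R) e x\<bar> \<le> 6 * norm e / R"
proof -
  have i: "((\<lambda>x::'a. 1 - (x \<bullet> x) / R\<^sup>2) has_derivative (\<lambda>e. - (2 * (x \<bullet> e)) / R\<^sup>2)) (at x)"
    unfolding divide_inverse by (auto intro!: derivative_eq_intros simp: inner_commute algebra_simps)
  have "(cutoff R has_derivative
     (\<lambda>e. (real (Suc 2) * max 0 (1 - (x \<bullet> x) / R\<^sup>2) ^ 2) * (- (2 * (x \<bullet> e)) / R\<^sup>2))) (at x)"
    unfolding cutoff_def
    by (rule has_derivative_compose[OF i pospart_power_deriv[of 1, unfolded Suc_1]])
  hence eq: "dd (cutoff R) e x = (3 * max 0 (1 - (x \<bullet> x) / R\<^sup>2) ^ 2) * (- (2 * (x \<bullet> e)) / R\<^sup>2)"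
    by (subst dd_eqI) auto
  show ?thesis
  proof (cases "norm x \<le> R")
    case True
    have "0 \<le> x \<bullet> x / R\<^sup>2" by simp
    hence m: "0 \<le> max 0 (1 - (x \<bullet> x) / R\<^sup>2)" "max 0 (1 - (x \<bullet> x) / R\<^sup>2) \<le> 1" by auto
    have "\<bar>x \<bullet> e\<bar> \<le> R * norm e"
      using Cauchy_Schwarz_ineq2[of x e] mult_right_mono[OF True, of "norm e"] by simp
    hence a: "2 * \<bar>x \<bullet> e\<bar> / R\<^sup>2 \<le> 2 * norm e / R"
      using assms by (simp add: field_simps power2_eq_square)
    have "\<bar>dd (cutoff R) e x\<bar> = 3 * max 0 (1 - (x \<bullet> x) / R\<^sup>2) ^ 2 * (2 * \<bar>x \<bullet> e\<bar> / R\<^sup>2)"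
      unfolding eq by (simp add: abs_mult)
    also have "\<dots> \<le> 3 * 1 * (2 * norm e / R)"
      using m by (intro mult_mono a mult_nonneg_nonneg) (auto intro: power_le_one)
    finally show ?thesis by simp
  next
    case False
    hence "R\<^sup>2 \<le> x \<bullet> x" using assms by (simp add: dot_square_norm power_mono)
    hence "1 - (x \<bullet> x) / R\<^sup>2 \<le> 0" using assms by (simp add: field_simps)
    thus ?thesis unfolding eq using assms by (simp add: max_def)
  qed
qed

lemma tendsto_cutoff: "(\<lambda>n. cutoff (real (Suc n)) x) \<longlonglongrightarrow> 1"
proof -
  have "(\<lambda>n. (max 0 (1 - (x \<bullet> x) * (inverse (real (Suc n)))\<^sup>2)) ^ Suc 2) \<longlonglongrightarrow> (max 0 (1 - (x \<bullet> x) * 0\<^sup>2)) ^ Suc 2"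
    by (intro tendsto_intros LIMSEQ_inverse_real_of_nat)
  thus ?thesis by (simp add: cutoff_def divide_inverse power_inverse del: of_nat_Suc)
qed

lemma tendsto_dd_cutoff: "(\<lambda>n. dd (cutoff (real (Suc n))) e x) \<longlonglongrightarrow> 0"
proof (rule Lim_null_comparison)
  show "\<forall>\<^sub>F n in sequentially. norm (dd (cutoff (real (Suc n))) e x) \<le> 6 * norm e * inverse (real (Suc n))"
    using dd_cutoff_bound[of "real (Suc _)" e x]
    by (auto simp: divide_inverse intro!: always_eventually simp del: of_nat_Suc)
  show "(\<lambda>n. 6 * norm e * inverse (real (Suc n))) \<longlonglongrightarrow> 0"
    using tendsto_mult_right_zero[OF LIMSEQ_inverse_real_of_nat] .
qed

lemma dd_eq_0_outside:
  fixes f :: "'a::euclidean_space \<Rightarrow> real"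
  assumes f0: "\<And>x. R \<le> norm x \<Longrightarrow> f x = 0" and x: "norm x > R"
  shows "dd f e x = 0"
proof -
  have "open {x::'a. norm x > R}" by (intro open_Collect_less continuous_intros)
  hence "(f has_derivative (\<lambda>e. 0)) (at x)"
    by (rule has_derivative_transform_within_open[rotated, of "{x. norm x > R}" _ "\<lambda>x. 0"])
      (use assms in \<open>auto intro: has_derivative_const\<close>)
  thus ?thesis by (rule dd_eqI)
qed

section \<open>Translation invariance and the vanishing integral of a derivative\<close>

lemma integral_lborel_shift:
  fixes f :: "'a::euclidean_space \<Rightarrow> real"
  assumes "f \<in> borel_measurable borel"
  shows "(\<integral>x. f (x + c) \<partial>lborel) = (\<integral>x. f x \<partial>lborel)"
proof -
  have "(\<integral>x. f x \<partial>lborel) = (\<integral>x. f x \<partial>(distr lborel borel ((+) c)))"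
    by (simp add: lborel_distr_plus)
  also have "\<dots> = (\<integral>x. f (c + x) \<partial>lborel)"
    using assms by (intro integral_distr) auto
  finally show ?thesis by (simp add: add.commute)
qed

lemma integrable_lborel_shift:
  fixes f :: "'a::euclidean_space \<Rightarrow> real"
  assumes "integrable lborel f"
  shows "integrable lborel (\<lambda>x. f (x + c))"
proof -
  have "integrable (distr lborel borel ((+) c)) f"
    using assms by (simp add: lborel_distr_plus)
  thus ?thesis
    using assms by (subst (asm) integrable_distr_eq) (auto simp: add.commute)
qed

lemma integrable_continuous_compact_support:
  fixes f :: "'a::euclidean_space \<Rightarrow> real"
  assumes "continuous_on UNIV f" and "\<And>x. R < norm x \<Longrightarrow> f x = 0"
  shows "integrable lborel f"
proof -
  have "integrable lborel (\<lambda>x. indicator (cball 0 R) x *\<^sub>R f x)"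
    by (intro borel_integrable_compact continuous_on_subset[OF assms(1)]) auto
  also have "(\<lambda>x. indicator (cball 0 R) x *\<^sub>R f x) = f"
    using assms(2) by (force simp: fun_eq_iff indicator_def)
  finally show ?thesis .
qed

text \<open>By translation invariance every difference quotient integrates to zero. The quotients
  are bounded by the mean value theorem, and with increments at most 1 they all live in the ball of
  radius \<open>R + norm e\<close>, so dominated convergence carries this over to the
  derivative.\<close>

lemma integral_dd_compact_support:
  fixes f :: "'a::euclidean_space \<Rightarrow> real"
  assumes s: "smooth 1 f" and f0: "\<And>x. R \<le> norm x \<Longrightarrow> f x = 0"
  shows "(\<integral>x. dd f e x \<partial>lborel) = 0"
proof -
  have s': "smooth (Suc 0) f" using s by simp
  have cf: "continuous_on UNIV f" by (rule smooth_continuous[OF s])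
  have cg: "continuous_on UNIV (dd f e)" by (rule smooth_continuous[OF smooth_dd[OF s, of 0]]) simp
  have g0: "dd f e x = 0" if "norm x > R" for x
    by (rule dd_eq_0_outside[of R, OF _ that]) (rule f0)
  have intf: "integrable lborel f"
    by (rule integrable_continuous_compact_support[OF cf, of R]) (use f0 in auto)
  have "bounded (dd f e ` cball 0 R)"
    by (intro compact_imp_bounded compact_continuous_image continuous_on_subset[OF cg]) auto
  then obtain B where B: "\<And>x. norm x \<le> R \<Longrightarrow> \<bar>dd f e x\<bar> \<le> B"
    unfolding bounded_iff by (metis imageI mem_cball_0 real_norm_def)
  have B': "\<bar>dd f e x\<bar> \<le> \<bar>B\<bar>" for x
    using B[of x] g0[of x] by (cases "norm x \<le> R") auto
  define q where "q n x = real (Suc n) * (f (x + inverse (real (Suc n)) *\<^sub>R e) - f x)" for n x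
  define w where "w x = \<bar>B\<bar> * indicat_real (cball 0 (R + norm e)) x" for x :: 'a
  have "(\<lambda>n. \<integral>x. q n x \<partial>lborel) \<longlonglongrightarrow> (\<integral>x. dd f e x \<partial>lborel)"
  proof (rule integral_dominated_convergence[where w=w])
    show "integrable lborel w" unfolding w_def
      by (intro integrable_mult_right integrable_real_indicator) (auto intro!: emeasure_bounded_finite[unfolded infinity_ennreal_def])
    show "dd f e \<in> borel_measurable lborel"
      using borel_measurable_continuous_onI[OF cg] by simp
    show "q n \<in> borel_measurable lborel" for n
      unfolding q_def using cf
      by (auto intro!: borel_measurable_continuous_onI continuous_intros continuous_on_compose2[OF cf])
    show "AE x in lborel. (\<lambda>n. q n x) \<longlonglongrightarrow> dd f e x"
    proof (rule AE_I2)
      fix x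
      have "((\<lambda>s. f (x + s *\<^sub>R e)) has_real_derivative dd f e x) (at 0)"
        using dd_line[OF s', of x e 0] by (simp add: has_real_derivative_iff_has_vector_derivative)
      hence "((\<lambda>h. (f (x + h *\<^sub>R e) - f x) / h) \<longlongrightarrow> dd f e x) (at 0)"
        by (simp add: DERIV_def)
      from filterlim_compose[OF this, of "\<lambda>n. inverse (real (Suc n))" sequentially]
      have "(\<lambda>n. (f (x + inverse (real (Suc n)) *\<^sub>R e) - f x) / inverse (real (Suc n))) \<longlonglongrightarrow> dd f e x"
        using LIMSEQ_inverse_real_of_nat by (auto simp: filterlim_at simp del: of_nat_Suc)
      thus "(\<lambda>n. q n x) \<longlonglongrightarrow> dd f e x"
        by (simp add: q_def divide_inverse mult.commute del: of_nat_Suc)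
    qed
    show "AE x in lborel. norm (q n x) \<le> w x" for n
    proof (rule AE_I2)
      fix x
      let ?t = "inverse (real (Suc n))"
      have t: "?t > 0" "?t \<le> 1" by (auto simp: field_simps)
      show "norm (q n x) \<le> w x"
      proof (cases "norm x \<le> R + norm e")
        case True
        have "((\<lambda>s. f (x + s *\<^sub>R e)) has_real_derivative dd f e (x + s *\<^sub>R e)) (at s)" for s
          using dd_line[OF s', of x e s] by (simp add: has_real_derivative_iff_has_vector_derivative)
        from MVT2[OF t(1) this] obtain z where "f (x + ?t *\<^sub>R e) - f x = ?t * dd f e (x + z *\<^sub>R e)"
          by auto
        hence "q n x = dd f e (x + z *\<^sub>R e)" by (simp add: q_def del: of_nat_Suc)
        thus ?thesis using B'[of "x + z *\<^sub>R e"] True by (simp add: w_def)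
      next
        case False
        have "norm x \<le> norm (x + ?t *\<^sub>R e) + norm (?t *\<^sub>R e)"
          by (metis add_diff_cancel_right' norm_triangle_ineq4)
        also have "norm (?t *\<^sub>R e) \<le> norm e"
          using t by (simp add: mult_left_le_one_le del: of_nat_Suc)
        finally have "norm (x + ?t *\<^sub>R e) \<ge> R" using False by simp
        moreover have "norm x \<ge> R" using False norm_ge_zero[of e] by linarith
        ultimately show ?thesis using f0 by (simp add: q_def w_def)
      qed
    qed
  qed
  moreover have "(\<integral>x. q n x \<partial>lborel) = 0" for n
    unfolding q_def
    using integrable_lborel_shift[OF intf] intf
    by (simp add: integral_lborel_shift borel_measurable_continuous_onI[OF cf] del: of_nat_Suc)
  ultimately show ?thesis
    by (simp add: LIMSEQ_const_iff)
qed

text \<open>Integrability of the function and of its derivative replaces any decay at infinity: in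
  the product with a cutoff, the term with the derivative of the cutoff tends to zero under
  domination by a multiple of \<open>f\<close>.\<close>

lemma integral_dd_eq_0:
  fixes f :: "'a::euclidean_space \<Rightarrow> real"
  assumes s: "smooth 1 f" and f: "integrable lborel f" and f': "integrable lborel (dd f e)"
  shows "(\<integral>x. dd f e x \<partial>lborel) = 0"
proof -
  let ?c = "\<lambda>n. cutoff (real (Suc n)) :: 'a \<Rightarrow> real"
  note sc = smooth_cutoff
  have [measurable]: "f \<in> borel_measurable borel" "dd f e \<in> borel_measurable borel"
    using f f' by auto
  have [measurable]: "cutoff r \<in> borel_measurable borel" "dd (cutoff r) e \<in> borel_measurable borel" for r
    using smooth_measurable[OF sc] smooth_measurable[OF smooth_dd[OF sc, of 0]] by auto
  define w where "w x = \<bar>dd f e x\<bar> + 6 * norm e * \<bar>f x\<bar>" for x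
  have "(\<lambda>n. \<integral>x. f x * dd (?c n) e x + dd f e x * ?c n x \<partial>lborel) \<longlonglongrightarrow> (\<integral>x. dd f e x \<partial>lborel)"
  proof (rule integral_dominated_convergence[where w=w])
    show "integrable lborel w" unfolding w_def using f f' by auto
    show "AE x in lborel. (\<lambda>n. f x * dd (?c n) e x + dd f e x * ?c n x) \<longlonglongrightarrow> dd f e x"
    proof (rule AE_I2)
      fix x
      have "(\<lambda>n. f x * dd (?c n) e x + dd f e x * ?c n x) \<longlonglongrightarrow> f x * 0 + dd f e x * 1"
        by (intro tendsto_intros tendsto_cutoff tendsto_dd_cutoff)
      thus "(\<lambda>n. f x * dd (?c n) e x + dd f e x * ?c n x) \<longlonglongrightarrow> dd f e x" by simp
    qed
    show "AE x in lborel. norm (f x * dd (?c n) e x + dd f e x * ?c n x) \<le> w x" for n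
    proof (rule AE_I2)
      fix x
      have "\<bar>dd (?c n) e x\<bar> \<le> 6 * norm e / real (Suc n)" by (rule dd_cutoff_bound) simp
      also have "\<dots> \<le> 6 * norm e / 1" by (intro divide_left_mono) auto
      finally have "\<bar>f x\<bar> * \<bar>dd (?c n) e x\<bar> \<le> \<bar>f x\<bar> * (6 * norm e)" by (intro mult_left_mono) auto
      moreover have "\<bar>dd f e x\<bar> * \<bar>?c n x\<bar> \<le> \<bar>dd f e x\<bar> * 1"
        using cutoff_range[of "real (Suc n)" x] by (intro mult_left_mono) auto
      ultimately show "norm (f x * dd (?c n) e x + dd f e x * ?c n x) \<le> w x"
        unfolding w_def real_norm_def
        using abs_triangle_ineq[of "f x * dd (?c n) e x" "dd f e x * ?c n x"]
        by (simp add: abs_mult algebra_simps del: of_nat_Suc)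
    qed
  qed auto
  moreover have "(\<integral>x. f x * dd (?c n) e x + dd f e x * ?c n x \<partial>lborel) = 0" for n
  proof -
    have "(\<integral>x. dd (\<lambda>x. f x * ?c n x) e x \<partial>lborel) = 0"
      by (rule integral_dd_compact_support[where R="real (Suc n)"])
        (use s smooth_mono[OF sc, of 1] in \<open>auto intro!: smooth_mult cutoff_eq_0 simp del: smooth.simps of_nat_Suc One_nat_def\<close>)
    thus ?thesis by (subst (asm) dd_mult[OF s sc]) auto
  qed
  ultimately show ?thesis
    by (simp add: LIMSEQ_const_iff)
qed

text \<open>The derivative of \<open>\<phi> w exp (- V)\<close> integrates to zero; differentiating
  the exponential contributes the drift term of the weighted divergence.\<close>

lemma integration_by_parts:
  fixes \<phi> w V :: "'a::euclidean_space \<Rightarrow> real"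
  assumes s: "smooth 1 \<phi>" "smooth 1 w" "smooth 1 V"
    and i: "integrable lborel (\<lambda>x. \<phi> x * w x * exp (- V x))"
      "integrable lborel (\<lambda>x. dd \<phi> e x * w x * exp (- V x))"
      "integrable lborel (\<lambda>x. \<phi> x * (dd V e x * w x - dd w e x) * exp (- V x))"
  shows "(\<integral>x. dd \<phi> e x * w x * exp (- V x) \<partial>lborel)
       = (\<integral>x. \<phi> x * (dd V e x * w x - dd w e x) * exp (- V x) \<partial>lborel)"
proof -
  let ?f = "\<lambda>x. (\<phi> x * w x) * exp (- V x)"
  have sp: "smooth 1 (\<lambda>x. \<phi> x * w x)" by (intro smooth_mult s)
  have sm: "smooth 1 ?f" by (intro smooth_mult[OF sp] smooth_exp_uminus s)
  have eq: "dd ?f e x = dd \<phi> e x * w x * exp (- V x) - \<phi> x * (dd V e x * w x - dd w e x) * exp (- V x)" for x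
    by (simp add: dd_mult[OF sp smooth_exp_uminus[OF s(3)]] dd_mult[OF s(1,2)] dd_exp_uminus[OF s(3)] ring_distribs del: One_nat_def)
  have "(\<integral>x. dd ?f e x \<partial>lborel) = 0"
  proof (rule integral_dd_eq_0[OF sm i(1)])
    show "integrable lborel (dd ?f e)"
      unfolding eq using i(2,3) by (intro Bochner_Integration.integrable_diff)
  qed
  thus ?thesis unfolding eq using i(2,3) by simp
qed

section \<open>Second moment of a divergence\<close>

text \<open>The second moment identity for a weighted divergence. Both factors of the square are
  differentiated away in turn: one integration by parts moves the field \<open>W i\<close> onto the
  other divergence, a second one removes the second derivatives that arise. The directions
  \<open>e i\<close> are arbitrary, so that fields pointing only in position or only in velocity are
  covered.\<close>

lemma skorokhod_compact_support:
  fixes V :: "'a::euclidean_space \<Rightarrow> real" and e :: "'i \<Rightarrow> 'a" and W :: "'i \<Rightarrow> 'a \<Rightarrow> real"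
  assumes V: "smooth 2 V" and W: "\<And>i. i \<in> I \<Longrightarrow> smooth 2 (W i)"
    and W0: "\<And>i x. i \<in> I \<Longrightarrow> R \<le> norm x \<Longrightarrow> W i x = 0"
  defines "\<delta> \<equiv> \<lambda>x. \<Sum>i\<in>I. dd V (e i) x * W i x - dd (W i) (e i) x"
    and "Q \<equiv> \<lambda>x. \<Sum>i\<in>I. \<Sum>j\<in>I. dd (W i) (e j) x * dd (W j) (e i) x
                + dd (dd V (e j)) (e i) x * W i x * W j x"
  shows "integrable lborel (\<lambda>x. (\<delta> x)\<^sup>2 * exp (- V x))"
    and "(\<integral>x. (\<delta> x)\<^sup>2 * exp (- V x) \<partial>lborel) = (\<integral>x. Q x * exp (- V x) \<partial>lborel)"
proof -
  define a where "a i x = dd V (e i) x * W i x - dd (W i) (e i) x" for i x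
  have sV: "smooth 1 (dd V c)" "smooth 1 V" "smooth 0 (dd (dd V c) c')" for c c'
    using smooth_dd[OF V, of 1] smooth_mono[OF V, of 1] smooth_dd[OF smooth_dd[OF V, of 1], of 0] by simp_all
  have sW: "smooth 1 (dd (W i) c)" "smooth 1 (W i)" "smooth 0 (dd (dd (W i) c) c')" if "i \<in> I" for i c c'
    using smooth_dd[OF W[OF that], of 1] smooth_mono[OF W[OF that], of 1]
      smooth_dd[OF smooth_dd[OF W[OF that], of 1], of 0] by simp_all
  have sa: "smooth 1 (a i)" if "i \<in> I" for i
    unfolding a_def by (intro smooth_diff smooth_mult sV sW that)
  have cont: "continuous_on UNIV V" "continuous_on UNIV (dd V c)" "continuous_on UNIV (dd (dd V c) c')" for c c'
    using sV by (auto intro: smooth_continuous)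
  have contW: "continuous_on UNIV (W i)" "continuous_on UNIV (dd (W i) c)" "continuous_on UNIV (dd (dd (W i) c) c')"
     "continuous_on UNIV (a i)" "continuous_on UNIV (dd (a i) c)" if "i \<in> I" for i c c'
    by (rule smooth_continuous[OF sW(2)[OF that]] smooth_continuous[OF sW(1)[OF that]]
        smooth_continuous[OF sW(3)[OF that]] smooth_continuous[OF sa[OF that]]
        smooth_continuous[OF smooth_dd[OF sa[OF that] zero_less_one]])+
  have W0': "dd (W i) c x = 0" "W i x = 0" "a i x = 0" if "i \<in> I" "norm x > R" for i x c
  proof -
    show *: "dd (W i) c x = 0" for c
      by (rule dd_eq_0_outside[of R, OF _ that(2)]) (rule W0[OF that(1)])
    show "W i x = 0" "a i x = 0" using W0[of i x] that * by (auto simp: a_def)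
  qed
  have int: "integrable lborel (\<lambda>x. f x * exp (- V x))"
    if "continuous_on UNIV f" "\<And>x. norm x > R \<Longrightarrow> f x = 0" for f
    by (rule integrable_continuous_compact_support[of _ R]) (use that cont in \<open>auto intro!: continuous_intros\<close>)
  \<comment> \<open>The two derivatives of \<open>W j\<close> are exchanged so that the first and
    the last term together form a weighted divergence in direction \<open>e j\<close>.\<close>
  have daj: "dd (a j) c x = dd V (e j) x * dd (W j) c x + dd (dd V (e j)) c x * W j x - dd (dd (W j) c) (e j) x"
    if "j \<in> I" for j c x
  proof -
    have "dd (a j) c x = dd V (e j) x * dd (W j) c x + dd (dd V (e j)) c x * W j x - dd (dd (W j) (e j)) c x"
      unfolding a_def
      by (rule dd_eqI) (intro has_derivative_diff has_derivative_mult has_derivative_dd[of 1] sV sW that; simp)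
    thus ?thesis using dd_commute_real[OF W[OF that]] by simp
  qed
  have main: "(\<integral>x. a i x * a j x * exp (- V x) \<partial>lborel)
     = (\<integral>x. (dd (W i) (e j) x * dd (W j) (e i) x + dd (dd V (e j)) (e i) x * W i x * W j x) * exp (- V x) \<partial>lborel)"
    if i: "i \<in> I" and j: "j \<in> I" for i j
  proof -
    let ?X = "\<lambda>x. W i x * (dd V (e j) x * dd (W j) (e i) x - dd (dd (W j) (e i)) (e j) x)"
    let ?Y = "\<lambda>x. dd (dd V (e j)) (e i) x * W i x * W j x"
    let ?Z = "\<lambda>x. dd (W i) (e j) x * dd (W j) (e i) x"
    have iX: "integrable lborel (\<lambda>x. ?X x * exp (- V x))" and iY: "integrable lborel (\<lambda>x. ?Y x * exp (- V x))"
      and iZ: "integrable lborel (\<lambda>x. ?Z x * exp (- V x))"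
      using i j W0' by (auto intro!: int continuous_intros contW cont)
    have "(\<integral>x. a i x * a j x * exp (- V x) \<partial>lborel)
        = (\<integral>x. a j x * (dd V (e i) x * W i x - dd (W i) (e i) x) * exp (- V x) \<partial>lborel)"
      by (simp add: a_def mult.commute)
    also have "\<dots> = (\<integral>x. dd (a j) (e i) x * W i x * exp (- V x) \<partial>lborel)"
      by (rule integration_by_parts[symmetric])
        (use i j W0' in \<open>auto intro!: sa sW sV int continuous_intros contW cont simp del: One_nat_def\<close>)
    also have "\<dots> = (\<integral>x. ?X x * exp (- V x) + ?Y x * exp (- V x) \<partial>lborel)"
      by (simp add: daj[OF j] algebra_simps)
    also have "\<dots> = (\<integral>x. ?X x * exp (- V x) \<partial>lborel) + (\<integral>x. ?Y x * exp (- V x) \<partial>lborel)"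
      using iX iY by simp
    \<comment> \<open>Second integration by parts, with \<open>dd (W j) (e i)\<close> as the
      component in direction \<open>e j\<close> and \<open>W i\<close> as the function that is
      differentiated.\<close>
    also have "(\<integral>x. ?X x * exp (- V x) \<partial>lborel) = (\<integral>x. ?Z x * exp (- V x) \<partial>lborel)"
      by (rule integration_by_parts[symmetric])
        (use i j W0' in \<open>auto intro!: sa sW sV int continuous_intros contW cont simp del: One_nat_def\<close>)
    also have "(\<integral>x. ?Z x * exp (- V x) \<partial>lborel) + (\<integral>x. ?Y x * exp (- V x) \<partial>lborel)
      = (\<integral>x. ?Z x * exp (- V x) + ?Y x * exp (- V x) \<partial>lborel)"
      using iZ iY by simp
    finally show ?thesis by (simp add: algebra_simps)
  qed
  have d: "(\<delta> x)\<^sup>2 * exp (- V x) = (\<Sum>i\<in>I. \<Sum>j\<in>I. a i x * a j x * exp (- V x))" for x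
    by (simp only: \<delta>_def a_def power2_eq_square sum_product) (simp only: sum_distrib_right)
  have ia: "integrable lborel (\<lambda>x. a i x * a j x * exp (- V x))" if "i \<in> I" "j \<in> I" for i j
    using that W0' by (auto intro!: int continuous_intros contW)
  show "integrable lborel (\<lambda>x. (\<delta> x)\<^sup>2 * exp (- V x))"
    unfolding d by (intro Bochner_Integration.integrable_sum ia)
  have iq: "integrable lborel (\<lambda>x. (dd (W i) (e j) x * dd (W j) (e i) x + dd (dd V (e j)) (e i) x * W i x * W j x) * exp (- V x))"
    if "i \<in> I" "j \<in> I" for i j
    using that W0' by (auto intro!: int continuous_intros contW cont)
  show "(\<integral>x. (\<delta> x)\<^sup>2 * exp (- V x) \<partial>lborel) = (\<integral>x. Q x * exp (- V x) \<partial>lborel)"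
    unfolding d Q_def sum_distrib_right
    by (simp add: Bochner_Integration.integral_sum ia iq main)
qed

lemma dd_mult_cutoff:
  fixes f :: "'a::euclidean_space \<Rightarrow> real"
  assumes "smooth n f" "0 < n"
  shows "dd (\<lambda>x. cutoff r x * f x) c x = cutoff r x * dd f c x + dd (cutoff r) c x * f x"
  by (rule dd_mult[OF smooth_cutoff assms(1)]) (use assms in auto)

text \<open>Truncation and Fatou's lemma reduce this to compactly supported fields, so square
  integrability of the divergence is a conclusion.\<close>

lemma skorokhod_bound:
  fixes V :: "'a::euclidean_space \<Rightarrow> real" and e :: "'i \<Rightarrow> 'a" and W :: "'i \<Rightarrow> 'a \<Rightarrow> real"
  assumes fin: "finite I" and V: "smooth 2 V" and W: "\<And>i. i \<in> I \<Longrightarrow> smooth 2 (W i)"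
    and iV: "integrable lborel (\<lambda>x. exp (- V x))"
    and iW: "\<And>i. i \<in> I \<Longrightarrow> integrable lborel (\<lambda>x. (W i x)\<^sup>2 * exp (- V x))"
    and K: "\<And>i j x. i \<in> I \<Longrightarrow> j \<in> I \<Longrightarrow> \<bar>dd (W i) (e j) x\<bar> \<le> K"
    and \<Lambda>: "\<And>i j x. i \<in> I \<Longrightarrow> j \<in> I \<Longrightarrow> \<bar>dd (dd V (e j)) (e i) x\<bar> \<le> \<Lambda>"
  defines "\<delta> \<equiv> \<lambda>x. \<Sum>i\<in>I. dd V (e i) x * W i x - dd (W i) (e i) x"
    and "Q \<equiv> \<lambda>x. \<Sum>i\<in>I. \<Sum>j\<in>I. dd (W i) (e j) x * dd (W j) (e i) x
                + dd (dd V (e j)) (e i) x * W i x * W j x"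
  shows "integrable lborel (\<lambda>x. (\<delta> x)\<^sup>2 * exp (- V x))"
    and "(\<integral>x. (\<delta> x)\<^sup>2 * exp (- V x) \<partial>lborel) \<le> (\<integral>x. Q x * exp (- V x) \<partial>lborel)"
proof -
  define c where "c n = (cutoff (real (Suc n)) :: 'a \<Rightarrow> real)" for n
  define \<delta>' where "\<delta>' n x = (\<Sum>i\<in>I. dd V (e i) x * (c n x * W i x) - dd (\<lambda>x. c n x * W i x) (e i) x)" for n x
  define Q' where "Q' n x = (\<Sum>i\<in>I. \<Sum>j\<in>I. dd (\<lambda>x. c n x * W i x) (e j) x * dd (\<lambda>x. c n x * W j x) (e i) x
                + dd (dd V (e j)) (e i) x * (c n x * W i x) * (c n x * W j x))" for n x
  define E where "E = (\<Sum>j\<in>I. norm (e j))"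
  \<comment> \<open>A truncated derivative has square at most
    \<open>2 * K\<^sup>2 + 72 * E\<^sup>2 * (W i x)\<^sup>2\<close>, because the cutoff is at most 1
    and its derivative at most \<open>6 * E\<close>; the product of two of them is bounded by half
    the sum of their squares.\<close>
  define w where "w x = (\<Sum>i\<in>I. \<Sum>j\<in>I. (2 * K\<^sup>2 + (36 * E\<^sup>2 + \<bar>\<Lambda>\<bar>) * ((W i x)\<^sup>2 + (W j x)\<^sup>2)) * exp (- V x))" for x
  have E: "norm (e j) \<le> E" if "j \<in> I" for j
    unfolding E_def using that fin by (intro member_le_sum) auto
  have sc: "smooth 2 (\<lambda>x. c n x * W i x)" if "i \<in> I" for n i
    unfolding c_def by (intro smooth_mult smooth_cutoff W that)
  have c0: "c n x * W i x = 0" if "real (Suc n) \<le> norm x" for n i x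
    using cutoff_eq_0[OF _ that] by (simp add: c_def)
  have crange: "0 \<le> c n x" "c n x \<le> 1" for n x
    using cutoff_range[of "real (Suc n)" x] by (simp_all only: c_def)
  have cdd: "\<bar>dd (c n) (e j) x\<bar> \<le> 6 * E" if "j \<in> I" for n x j
  proof -
    have "\<bar>dd (c n) (e j) x\<bar> \<le> 6 * norm (e j) / real (Suc n)"
      unfolding c_def by (rule dd_cutoff_bound) simp
    also have "\<dots> \<le> 6 * norm (e j) / 1" by (intro divide_left_mono) auto
    finally show ?thesis using E[OF that] by simp
  qed
  have dcW: "dd (\<lambda>x. c n x * W i x) u x = c n x * dd (W i) u x + dd (c n) u x * W i x" if "i \<in> I" for i n u x
    unfolding c_def by (rule dd_mult_cutoff[OF W[OF that]]) simp
  have sk: "integrable lborel (\<lambda>x. (\<delta>' n x)\<^sup>2 * exp (- V x))"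
    "(\<integral>x. (\<delta>' n x)\<^sup>2 * exp (- V x) \<partial>lborel) = (\<integral>x. Q' n x * exp (- V x) \<partial>lborel)" for n
    unfolding \<delta>'_def Q'_def
    by (rule skorokhod_compact_support[where R="real (Suc n)" and W="\<lambda>i x. c n x * W i x", OF V sc c0]; assumption)+
  have lim_dc: "(\<lambda>n. dd (\<lambda>x. c n x * W i x) u x) \<longlonglongrightarrow> dd (W i) u x" if "i \<in> I" for i u x
  proof -
    have "(\<lambda>n. c n x * dd (W i) u x + dd (c n) u x * W i x) \<longlonglongrightarrow> 1 * dd (W i) u x + 0 * W i x"
      unfolding c_def by (intro tendsto_intros tendsto_cutoff tendsto_dd_cutoff)
    thus ?thesis by (simp add: dcW[OF that])
  qed
  have lim_c: "(\<lambda>n. c n x * W i x) \<longlonglongrightarrow> W i x" for i x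
    using tendsto_mult[OF tendsto_cutoff tendsto_const, of x "W i x"] by (simp add: c_def)
  have lim_\<delta>: "(\<lambda>n. (\<delta>' n x)\<^sup>2 * exp (- V x)) \<longlonglongrightarrow> (\<delta> x)\<^sup>2 * exp (- V x)" for x
    unfolding \<delta>'_def \<delta>_def by (intro tendsto_intros lim_dc lim_c)
  have lim_Q: "(\<lambda>n. Q' n x * exp (- V x)) \<longlonglongrightarrow> Q x * exp (- V x)" for x
    unfolding Q'_def Q_def by (intro tendsto_intros lim_dc lim_c)
  have mV [measurable]: "V \<in> borel_measurable borel" "dd V u \<in> borel_measurable borel" "dd (dd V u) u' \<in> borel_measurable borel" for u u'
    using smooth_measurable[OF V] smooth_measurable[OF smooth_dd[OF V, of 1]]
      smooth_measurable[OF smooth_dd[OF smooth_dd[OF V, of 1], of 0]] by auto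
  have mW: "W i \<in> borel_measurable borel" "dd (W i) u \<in> borel_measurable borel"
    "(\<lambda>x. c n x * W i x) \<in> borel_measurable borel" "dd (\<lambda>x. c n x * W i x) u \<in> borel_measurable borel" if "i \<in> I" for i n u
    using smooth_measurable[OF W[OF that]] smooth_measurable[OF smooth_dd[OF W[OF that], of 1]]
      smooth_measurable[OF sc[OF that]] smooth_measurable[OF smooth_dd[OF sc[OF that], of 1]] by auto
  have m: "\<delta> \<in> borel_measurable borel" "Q \<in> borel_measurable borel"
    "\<delta>' n \<in> borel_measurable borel" "Q' n \<in> borel_measurable borel" for n
    unfolding \<delta>_def Q_def \<delta>'_def Q'_def
    by (intro borel_measurable_sum borel_measurable_diff borel_measurable_add borel_measurable_times mV mW; assumption)+
  \<comment> \<open>The integrand \<open>Q'\<close> has no sign, so on this side the limit is taken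
    by domination; Fatou's lemma is kept for the squares.\<close>
  have limint: "(\<lambda>n. \<integral>x. Q' n x * exp (- V x) \<partial>lborel) \<longlonglongrightarrow> (\<integral>x. Q x * exp (- V x) \<partial>lborel)"
  proof (rule integral_dominated_convergence[where w=w])
    show "integrable lborel w"
      unfolding w_def ring_distribs using iV iW
      by (intro Bochner_Integration.integrable_sum Bochner_Integration.integrable_add)
        (auto simp: mult.assoc)
    show "AE x in lborel. norm (Q' n x * exp (- V x)) \<le> w x" for n
    proof (rule AE_I2)
      fix x
      have t: "\<bar>dd (\<lambda>x. c n x * W i x) (e j) x * dd (\<lambda>x. c n x * W j x) (e i) x
                + dd (dd V (e j)) (e i) x * (c n x * W i x) * (c n x * W j x)\<bar>
          \<le> 2 * K\<^sup>2 + (36 * E\<^sup>2 + \<bar>\<Lambda>\<bar>) * ((W i x)\<^sup>2 + (W j x)\<^sup>2)" if i: "i \<in> I" and j: "j \<in> I" for i j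
      proof -
        have b: "(dd (\<lambda>x. c n x * W i x) (e j) x)\<^sup>2 \<le> 2 * K\<^sup>2 + 72 * E\<^sup>2 * (W i x)\<^sup>2" if i: "i \<in> I" and j: "j \<in> I" for i j
        proof -
          have 1: "\<bar>c n x * dd (W i) (e j) x\<bar> \<le> K"
            using mult_mono[OF crange(2)[of n x] K[OF i j, of x]] crange[of n x] by (simp add: abs_mult)
          have 2: "\<bar>dd (c n) (e j) x * W i x\<bar> \<le> 6 * E * \<bar>W i x\<bar>"
            using mult_right_mono[OF cdd[OF j, of n x], of "\<bar>W i x\<bar>"] by (simp add: abs_mult)
          have "(dd (\<lambda>x. c n x * W i x) (e j) x)\<^sup>2 \<le> 2 * (c n x * dd (W i) (e j) x)\<^sup>2 + 2 * (dd (c n) (e j) x * W i x)\<^sup>2"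
            unfolding dcW[OF i] using sum_squares_bound[of "c n x * dd (W i) (e j) x" "dd (c n) (e j) x * W i x"]
            by (simp add: power2_sum)
          also have "\<dots> \<le> 2 * K\<^sup>2 + 2 * (6 * E * \<bar>W i x\<bar>)\<^sup>2"
            using power_mono[OF 1, of 2] power_mono[OF 2, of 2] by simp
          finally show ?thesis by (simp add: power_mult_distrib)
        qed
        have "\<bar>dd (\<lambda>x. c n x * W i x) (e j) x * dd (\<lambda>x. c n x * W j x) (e i) x\<bar> \<le> 2 * K\<^sup>2 + 36 * E\<^sup>2 * ((W i x)\<^sup>2 + (W j x)\<^sup>2)"
          using b[OF i j] b[OF j i] sum_squares_bound[of "\<bar>dd (\<lambda>x. c n x * W i x) (e j) x\<bar>" "\<bar>dd (\<lambda>x. c n x * W j x) (e i) x\<bar>"]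
          by (simp add: abs_mult algebra_simps)
        moreover have "\<bar>dd (dd V (e j)) (e i) x * (c n x * W i x) * (c n x * W j x)\<bar> \<le> \<bar>\<Lambda>\<bar> * ((W i x)\<^sup>2 + (W j x)\<^sup>2)"
        proof -
          have "\<bar>c n x * W i x\<bar> \<le> \<bar>W i x\<bar>" for i
            using mult_right_mono[OF crange(2)[of n x], of "\<bar>W i x\<bar>"] crange(1)[of n x] by (simp add: abs_mult)
          hence "\<bar>c n x * W i x\<bar> * \<bar>c n x * W j x\<bar> \<le> \<bar>W i x\<bar> * \<bar>W j x\<bar>" by (intro mult_mono) auto
          also have "\<dots> \<le> (W i x)\<^sup>2 + (W j x)\<^sup>2"
            using sum_squares_bound[of "\<bar>W i x\<bar>" "\<bar>W j x\<bar>"] mult_nonneg_nonneg[of "\<bar>W i x\<bar>" "\<bar>W j x\<bar>"]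
            unfolding power2_abs by linarith
          finally have "\<bar>dd (dd V (e j)) (e i) x\<bar> * (\<bar>c n x * W i x\<bar> * \<bar>c n x * W j x\<bar>) \<le> \<bar>\<Lambda>\<bar> * ((W i x)\<^sup>2 + (W j x)\<^sup>2)"
            using \<Lambda>[OF i j, of x] by (intro mult_mono) auto
          thus ?thesis by (simp add: abs_mult mult.assoc)
        qed
        ultimately show ?thesis by (simp add: algebra_simps)
      qed
      have "\<bar>Q' n x\<bar> \<le> (\<Sum>i\<in>I. \<Sum>j\<in>I. 2 * K\<^sup>2 + (36 * E\<^sup>2 + \<bar>\<Lambda>\<bar>) * ((W i x)\<^sup>2 + (W j x)\<^sup>2))"
        unfolding Q'_def by (intro order_trans[OF sum_abs] sum_mono t)
      hence "\<bar>Q' n x\<bar> * exp (- V x) \<le> w x"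
        unfolding w_def sum_distrib_right[symmetric] by (intro mult_right_mono) auto
      thus "norm (Q' n x * exp (- V x)) \<le> w x" by (simp add: abs_mult)
    qed
  qed (use m lim_Q in auto)
  have nn: "0 \<le> (\<integral>x. Q' n x * exp (- V x) \<partial>lborel)" for n
    unfolding sk(2)[of n, symmetric] by (intro integral_nonneg_AE) auto
  have "(\<integral>\<^sup>+x. ennreal ((\<delta> x)\<^sup>2 * exp (- V x)) \<partial>lborel)
      = (\<integral>\<^sup>+x. liminf (\<lambda>n. ennreal ((\<delta>' n x)\<^sup>2 * exp (- V x))) \<partial>lborel)"
  proof (intro nn_integral_cong)
    fix x
    have "(\<lambda>n. ennreal ((\<delta>' n x)\<^sup>2 * exp (- V x))) \<longlonglongrightarrow> ennreal ((\<delta> x)\<^sup>2 * exp (- V x))"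
      by (intro tendsto_ennrealI lim_\<delta>)
    from lim_imp_Liminf[OF _ this] show "ennreal ((\<delta> x)\<^sup>2 * exp (- V x)) = liminf (\<lambda>n. ennreal ((\<delta>' n x)\<^sup>2 * exp (- V x)))"
      by simp
  qed
  also have "\<dots> \<le> liminf (\<lambda>n. \<integral>\<^sup>+x. ennreal ((\<delta>' n x)\<^sup>2 * exp (- V x)) \<partial>lborel)"
    using m by (intro nn_integral_liminf) auto
  also have "(\<lambda>n. \<integral>\<^sup>+x. ennreal ((\<delta>' n x)\<^sup>2 * exp (- V x)) \<partial>lborel) = (\<lambda>n. ennreal (\<integral>x. Q' n x * exp (- V x) \<partial>lborel))"
    using sk by (subst nn_integral_eq_integral) auto
  also have "liminf \<dots> = ennreal (\<integral>x. Q x * exp (- V x) \<partial>lborel)"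
    by (intro lim_imp_Liminf tendsto_ennrealI limint) auto
  finally have *: "(\<integral>\<^sup>+x. ennreal ((\<delta> x)\<^sup>2 * exp (- V x)) \<partial>lborel) \<le> ennreal (\<integral>x. Q x * exp (- V x) \<partial>lborel)" .
  show i: "integrable lborel (\<lambda>x. (\<delta> x)\<^sup>2 * exp (- V x))"
    using m * by (intro integrableI_nonneg) (auto simp: less_top[symmetric] top_unique)
  \<comment> \<open>Needed to remove \<open>ennreal\<close>. The integrand may be negative, but its
    integral is a limit of integrals of squares.\<close>
  have "0 \<le> (\<integral>x. Q x * exp (- V x) \<partial>lborel)"
    by (rule LIMSEQ_le_const[OF limint]) (use nn in auto)
  thus "(\<integral>x. (\<delta> x)\<^sup>2 * exp (- V x) \<partial>lborel) \<le> (\<integral>x. Q x * exp (- V x) \<partial>lborel)"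
    using * by (subst (asm) nn_integral_eq_integral[OF i]) auto
qed

section \<open>Test functions and total variation\<close>

text \<open>The mean value inequality bounds the difference quotients by \<open>B\<close>, so
  dominated convergence applies along every sequence. Derivatives within a closed interval are used
  because the curves of maps are followed from one end point to the other.\<close>

lemma has_derivative_under_integral:
  fixes \<phi> \<phi>' :: "real \<Rightarrow> 'a \<Rightarrow> real"
  assumes d: "\<And>s x. s \<in> {a..b} \<Longrightarrow> ((\<lambda>s. \<phi> s x) has_real_derivative \<phi>' s x) (at s within {a..b})"
    and B: "\<And>s x. s \<in> {a..b} \<Longrightarrow> \<bar>\<phi>' s x\<bar> \<le> B x" and iB: "integrable M B"
    and i: "\<And>s. s \<in> {a..b} \<Longrightarrow> integrable M (\<phi> s)"
    and m: "\<And>s. s \<in> {a..b} \<Longrightarrow> \<phi>' s \<in> borel_measurable M"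
    and s: "s \<in> {a..b}"
  shows "((\<lambda>s. \<integral>x. \<phi> s x \<partial>M) has_real_derivative (\<integral>x. \<phi>' s x \<partial>M)) (at s within {a..b})"
  unfolding has_field_derivative_iff tendsto_at_iff_sequentially
proof (intro allI impI)
  fix X assume X: "\<forall>i. X i \<in> {a..b} - {s}" and lim: "X \<longlonglongrightarrow> s"
  have X': "X n \<in> {a..b}" "X n \<noteq> s" for n using X by auto
  have "(\<lambda>n. \<integral>x. (\<phi> (X n) x - \<phi> s x) / (X n - s) \<partial>M) \<longlonglongrightarrow> (\<integral>x. \<phi>' s x \<partial>M)"
  proof (rule integral_dominated_convergence[OF m[OF s] _ iB])
    show "(\<lambda>x. (\<phi> (X n) x - \<phi> s x) / (X n - s)) \<in> borel_measurable M" for n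
      using i[OF X'(1)] i[OF s] by auto
    show "AE x in M. (\<lambda>n. (\<phi> (X n) x - \<phi> s x) / (X n - s)) \<longlonglongrightarrow> \<phi>' s x"
    proof (rule AE_I2)
      fix x
      have "((\<lambda>y. (\<phi> y x - \<phi> s x) / (y - s)) \<longlongrightarrow> \<phi>' s x) (at s within {a..b})"
        using d[OF s] by (simp add: has_field_derivative_iff)
      thus "(\<lambda>n. (\<phi> (X n) x - \<phi> s x) / (X n - s)) \<longlonglongrightarrow> \<phi>' s x"
        using X lim unfolding tendsto_at_iff_sequentially by (auto simp: o_def)
    qed
    show "AE x in M. norm ((\<phi> (X n) x - \<phi> s x) / (X n - s)) \<le> B x" for n
    proof (rule AE_I2)
      fix x
      have "norm (\<phi> (X n) x - \<phi> s x) \<le> B x * norm (X n - s)"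
        by (rule field_differentiable_bound[of "{a..b}" _ "\<lambda>s. \<phi>' s x"]) (use d B X' s in auto)
      thus "norm ((\<phi> (X n) x - \<phi> s x) / (X n - s)) \<le> B x"
        using X'(2)[of n] by (simp add: field_simps)
    qed
  qed
  moreover have "(\<integral>x. (\<phi> (X n) x - \<phi> s x) / (X n - s) \<partial>M) = ((\<integral>x. \<phi> (X n) x \<partial>M) - (\<integral>x. \<phi> s x \<partial>M)) / (X n - s)" for n
    using i[OF X'(1)[of n]] i[OF s] by simp
  ultimately have "(\<lambda>n. ((\<integral>x. \<phi> (X n) x \<partial>M) - (\<integral>x. \<phi> s x \<partial>M)) / (X n - s)) \<longlonglongrightarrow> (\<integral>x. \<phi>' s x \<partial>M)"
    by (simp only:)
  thus "((\<lambda>y. ((\<integral>x. \<phi> y x \<partial>M) - (\<integral>x. \<phi> s x \<partial>M)) / (y - s)) \<circ> X) \<longlonglongrightarrow> (\<integral>x. \<phi>' s x \<partial>M)"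
    by (simp add: o_def)
qed

lemma increment_bound:
  fixes f :: "real \<Rightarrow> real"
  assumes "a \<le> b" and d: "\<And>s. s \<in> {a..b} \<Longrightarrow> (f has_real_derivative f' s) (at s within {a..b})"
    and B: "\<And>s. s \<in> {a..b} \<Longrightarrow> \<bar>f' s\<bar> \<le> g s" and g: "(g has_integral J) {a..b}"
  shows "\<bar>f b - f a\<bar> \<le> J"
proof -
  have f: "(f' has_integral (f b - f a)) {a..b}"
    by (rule fundamental_theorem_of_calculus[OF assms(1)])
      (use d in \<open>simp add: has_real_derivative_iff_has_vector_derivative\<close>)
  have "norm (integral {a..b} f') \<le> integral {a..b} g"
    by (rule integral_norm_bound_integral) (use f g B in \<open>auto simp: has_integral_integrable\<close>)
  thus ?thesis using f g by (simp add: integral_unique)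
qed

text \<open>The range is what allows centring at 1/2. The bound on the derivative serves only
  integrability and domination and never enters an estimate, so the class may be composed with any
  map whose derivative is bounded.\<close>

definition test_fun :: "('a::euclidean_space \<Rightarrow> real) \<Rightarrow> bool" where
  "test_fun f \<longleftrightarrow> smooth 1 f \<and> (\<forall>x. 0 \<le> f x \<and> f x \<le> 1) \<and> (\<exists>B. \<forall>x e. \<bar>dd f e x\<bar> \<le> B * norm e)"

lemma linear_bound_Basis:
  fixes F :: "'a::euclidean_space \<Rightarrow> 'b::real_normed_vector"
  assumes "linear F" shows "norm (F e) \<le> (\<Sum>b\<in>Basis. norm (F b)) * norm e"
proof -
  have "norm (F e) \<le> (\<Sum>b\<in>Basis. norm ((e \<bullet> b) *\<^sub>R F b))"
    unfolding linear_Basis_sum[OF assms, of e] by (rule norm_sum)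
  also have "\<dots> \<le> (\<Sum>b\<in>Basis. norm (F b) * norm e)"
  proof (rule sum_mono)
    fix b :: 'a assume "b \<in> Basis"
    from mult_right_mono[OF Basis_le_norm[OF this, of e], of "norm (F b)"]
    show "norm ((e \<bullet> b) *\<^sub>R F b) \<le> norm (F b) * norm e" by (simp add: mult.commute)
  qed
  finally show ?thesis by (simp add: sum_distrib_right)
qed

lemma dd_bound_compact_support:
  fixes f :: "'a::euclidean_space \<Rightarrow> real"
  assumes s: "smooth 1 f" and f0: "\<And>x. R \<le> norm x \<Longrightarrow> f x = 0"
  shows "\<exists>B. \<forall>x e. \<bar>dd f e x\<bar> \<le> B * norm e"
proof -
  have "\<exists>B. \<forall>x. \<bar>dd f b x\<bar> \<le> B" for b
  proof -
    have "bounded (dd f b ` cball 0 R)"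
      by (intro compact_imp_bounded compact_continuous_image smooth_continuous[OF smooth_dd[OF s zero_less_one]]) auto
    then obtain B where B: "\<And>x. norm x \<le> R \<Longrightarrow> \<bar>dd f b x\<bar> \<le> B"
      unfolding bounded_iff by (metis imageI mem_cball_0 real_norm_def)
    have "\<bar>dd f b x\<bar> \<le> \<bar>B\<bar>" for x
      using B[of x] dd_eq_0_outside[of R f x b] f0 by (cases "norm x \<le> R") auto
    thus ?thesis by blast
  qed
  then obtain B where B: "\<And>b x. \<bar>dd f b x\<bar> \<le> B b" by metis
  have "\<bar>dd f e x\<bar> \<le> (\<Sum>b\<in>Basis. B b) * norm e" for x e
  proof -
    have "norm (dd f e x) \<le> (\<Sum>b\<in>Basis. norm (dd f b x)) * norm e"
      by (rule linear_bound_Basis[OF smooth_linear_dd[OF s zero_less_one]])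
    also have "\<dots> \<le> (\<Sum>b\<in>Basis. B b) * norm e"
      using B by (intro mult_right_mono sum_mono) auto
    finally show ?thesis by simp
  qed
  thus ?thesis by blast
qed

text \<open>Compactness leaves finitely many balls inside \<open>G\<close> whose halves cover
  \<open>K\<close>. The sum of one bump per ball exceeds 1/2 on \<open>K\<close> and is then
  flattened to the value 1 by a second power of a positive part.\<close>

lemma test_fun_Urysohn:
  fixes K G :: "'a::euclidean_space set"
  assumes K: "compact K" and G: "open G" and KG: "K \<subseteq> G"
  obtains f where "test_fun f" "\<And>x. x \<in> K \<Longrightarrow> f x = 1" "\<And>x. x \<notin> G \<Longrightarrow> f x = 0"
proof -
  have "\<forall>x\<in>K. \<exists>r>0. ball x r \<subseteq> G" using G KG by (meson open_contains_ball subsetD)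
  then obtain r where r: "\<And>x. x \<in> K \<Longrightarrow> r x > 0" "\<And>x. x \<in> K \<Longrightarrow> ball x (r x) \<subseteq> G" by metis
  have "K \<subseteq> (\<Union>x\<in>K. ball x (r x / 2))" using r by force
  then obtain D where D: "D \<subseteq> K" "finite D" "K \<subseteq> (\<Union>x\<in>D. ball x (r x / 2))"
    using compactE_image[OF K, of K "\<lambda>x. ball x (r x / 2)"] by auto
  define p where "p x z = (max 0 (1 - ((z - x) \<bullet> (z - x)) / (r x)\<^sup>2)) ^ Suc 1" for x z
  define S where "S z = (\<Sum>x\<in>D. p x z)" for z
  define f where "f z = 1 - (max 0 (1 - 2 * S z)) ^ Suc 1" for z
  have p: "smooth 1 (p x)" for x
    unfolding p_def
    by (intro smooth_compose[OF smooth_pospart_power] smooth_diff smooth_divide_const smooth_inner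
        smooth_const smooth_ident)
  have sf: "smooth 1 f"
    unfolding f_def S_def
    by (intro smooth_diff smooth_const smooth_compose[OF smooth_pospart_power] smooth_mult smooth_sum p)
  have p0: "0 \<le> p x z" for x z by (simp add: p_def)
  have S0: "0 \<le> S z" for z unfolding S_def by (intro sum_nonneg p0)
  have fr: "0 \<le> f z \<and> f z \<le> 1" for z
  proof -
    have "max 0 (1 - 2 * S z) ^ Suc 1 \<le> 1" using S0[of z] by (intro power_le_one) auto
    thus ?thesis by (simp add: f_def)
  qed
  have pout: "p x z = 0" if "x \<in> D" "r x \<le> dist x z" for x z
  proof -
    have "(r x)\<^sup>2 \<le> (z - x) \<bullet> (z - x)"
      using that r(1)[of x] D by (auto simp: dot_square_norm dist_norm norm_minus_commute intro!: power_mono)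
    thus ?thesis using r(1)[of x] D that by (auto simp: p_def max_def field_simps)
  qed
  have f0: "f z = 0" if "\<And>x. x \<in> D \<Longrightarrow> r x \<le> dist x z" for z
    using pout[OF _ that] by (simp add: f_def S_def)
  have out: "f z = 0" if "z \<notin> G" for z
    using that r(2) D(1) by (intro f0) (meson in_mono linorder_not_less mem_ball)
  have one: "f z = 1" if z: "z \<in> K" for z
  proof -
    obtain x where x: "x \<in> D" "dist x z < r x / 2" using D(3) z by auto
    have "(dist x z)\<^sup>2 \<le> (r x / 2)\<^sup>2" using x by (intro power_mono) auto
    hence "1 - ((z - x) \<bullet> (z - x)) / (r x)\<^sup>2 \<ge> 3 / 4"
      using x r(1)[of x] D(1) by (auto simp: dot_square_norm dist_norm norm_minus_commute field_simps)
    \<comment> \<open>A point of the half ball has bump value at least 9/16 > 1/2, which is what the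
      outer function needs in order to be constant.\<close>
    hence "p x z \<ge> (3/4) ^ Suc 1" unfolding p_def by (intro power_mono) linarith+
    moreover have "p x z \<le> S z"
      unfolding S_def using x D p0 by (intro member_le_sum) auto
    ultimately have "1 - 2 * S z \<le> 0" by (simp add: power2_eq_square)
    thus ?thesis by (simp add: f_def)
  qed
  have "\<exists>B. \<forall>x e. \<bar>dd f e x\<bar> \<le> B * norm e"
  proof (rule dd_bound_compact_support[OF sf])
    fix z :: 'a assume z: "(\<Sum>x\<in>D. norm x + r x) \<le> norm z"
    show "f z = 0"
    proof (rule f0)
      fix x assume x: "x \<in> D"
      have "norm x + r x \<le> (\<Sum>x\<in>D. norm x + r x)"
      proof (rule member_le_sum[of x D "\<lambda>x. norm x + r x"])
        fix y assume "y \<in> D - {x}"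
        hence "r y > 0" using r(1) D(1) by blast
        thus "0 \<le> norm y + r y" by (smt (verit) norm_ge_zero)
      qed (use x D in auto)
      thus "r x \<le> dist x z" using z norm_triangle_ineq2[of z x] by (simp add: dist_norm norm_minus_commute)
    qed
  qed
  hence "test_fun f" unfolding test_fun_def using sf fr by blast
  thus thesis using one out by (rule that)
qed

lemma test_fun_integrable:
  assumes "finite_measure \<nu>" "sets \<nu> = sets borel" "test_fun f"
  shows "integrable \<nu> f"
proof -
  interpret finite_measure \<nu> by fact
  have "f \<in> borel_measurable \<nu>"
    using assms smooth_measurable[of 1 f] by (simp add: test_fun_def cong: measurable_cong_sets)
  thus ?thesis
    using assms by (intro integrable_const_bound[of _ 1]) (auto simp: test_fun_def)
qed

text \<open>Inner regularity of \<nu> and outer regularity of \<eta> enclose a Borel set between a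
  compact and an open set, and a test function fits between their indicators. This bounds \<nu> by
  \<eta> up to \<epsilon> on every Borel set.\<close>

lemma TV_le_test_fun:
  fixes \<nu> \<eta> :: "'a::euclidean_space measure"
  assumes p: "prob_space \<nu>" "prob_space \<eta>" and sets: "sets \<nu> = sets borel" "sets \<eta> = sets borel"
    and test: "\<And>f. test_fun f \<Longrightarrow> \<bar>(\<integral>x. f x \<partial>\<nu>) - (\<integral>x. f x \<partial>\<eta>)\<bar> \<le> \<epsilon>"
  shows "TV \<nu> \<eta> \<le> \<epsilon>"
proof -
  interpret N: prob_space \<nu> by fact
  interpret E: prob_space \<eta> by fact
  have spc: "space \<nu> = UNIV" "space \<eta> = UNIV"
    using sets_eq_imp_space_eq[OF sets(1)] sets_eq_imp_space_eq[OF sets(2)] by auto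
  have half: "measure \<nu> A \<le> measure \<eta> A + \<epsilon>" if A: "A \<in> sets borel" for A
  proof (rule field_le_epsilon)
    fix \<delta> :: real assume \<delta>: "\<delta> > 0"
    have "\<exists>K. K \<subseteq> A \<and> compact K \<and> emeasure \<nu> A \<le> emeasure \<nu> K + ennreal (\<delta> / 2)"
    proof (cases "emeasure \<nu> A = 0")
      case True thus ?thesis by (intro exI[of _ "{}"]) auto
    next
      case False
      have "emeasure \<nu> A - ennreal (\<delta> / 2) < emeasure \<nu> A"
        using False \<delta> by (intro ennreal_between) (auto simp: zero_less_iff_neq_zero N.emeasure_eq_measure)
      also have "emeasure \<nu> A = (SUP K\<in>{K. K \<subseteq> A \<and> compact K}. emeasure \<nu> K)"
        using inner_regular[OF sets(1) _ A] by simp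
      finally obtain K where "K \<subseteq> A" "compact K" "emeasure \<nu> A - ennreal (\<delta> / 2) < emeasure \<nu> K"
        unfolding less_SUP_iff by auto
      thus ?thesis by (metis add.commute ennreal_minus_le_iff less_imp_le)
    qed
    then obtain K where K: "K \<subseteq> A" "compact K" "emeasure \<nu> A \<le> emeasure \<nu> K + ennreal (\<delta> / 2)" by blast
    have "emeasure \<eta> A < emeasure \<eta> A + ennreal (\<delta> / 2)"
      using \<delta> by (simp add: E.emeasure_eq_measure ennreal_less_iff flip: ennreal_plus)
    moreover have "emeasure \<eta> A = (INF G\<in>{G. A \<subseteq> G \<and> open G}. emeasure \<eta> G)"
      using outer_regular[OF sets(2) _ A] by simp
    ultimately have "(INF G\<in>{G. A \<subseteq> G \<and> open G}. emeasure \<eta> G) < emeasure \<eta> A + ennreal (\<delta> / 2)"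
      by metis
    then obtain G where G: "A \<subseteq> G" "open G" "emeasure \<eta> G < emeasure \<eta> A + ennreal (\<delta> / 2)"
      unfolding INF_less_iff by auto
    obtain f where f: "test_fun f" "\<And>x. x \<in> K \<Longrightarrow> f x = 1" "\<And>x. x \<notin> G \<Longrightarrow> f x = 0"
      using test_fun_Urysohn[OF K(2) G(2)] K(1) G(1) by blast
    have r: "0 \<le> f x" "f x \<le> 1" for x using f(1) by (auto simp: test_fun_def)
    have mK: "K \<in> sets \<nu>" using sets K(2) by (simp add: borel_compact)
    have mG: "G \<in> sets \<eta>" using sets G(2) by simp
    have "measure \<nu> A \<le> measure \<nu> K + \<delta> / 2"
      using K(3) \<delta> by (simp add: N.emeasure_eq_measure flip: ennreal_plus)
    also have "measure \<nu> K = (\<integral>x. indicator K x \<partial>\<nu>)" using mK spc by simp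
    also have "\<dots> \<le> (\<integral>x. f x \<partial>\<nu>)"
      using test_fun_integrable[OF N.finite_measure_axioms sets(1) f(1)] mK f(2) r
      by (intro integral_mono integrable_real_indicator) (auto simp: N.emeasure_eq_measure split: split_indicator)
    also have "\<dots> \<le> (\<integral>x. f x \<partial>\<eta>) + \<epsilon>" using test[OF f(1)] by linarith
    also have "(\<integral>x. f x \<partial>\<eta>) \<le> (\<integral>x. indicator G x \<partial>\<eta>)"
      using test_fun_integrable[OF E.finite_measure_axioms sets(2) f(1)] mG f(3) r
      by (intro integral_mono integrable_real_indicator) (auto simp: E.emeasure_eq_measure split: split_indicator)
    also have "\<dots> = measure \<eta> G" using mG spc by simp
    also have "\<dots> \<le> measure \<eta> A + \<delta> / 2"
      using G(3) \<delta> by (simp add: E.emeasure_eq_measure ennreal_less_iff flip: ennreal_plus)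
    finally show "measure \<nu> A \<le> measure \<eta> A + \<epsilon> + \<delta>" by simp
  qed
  have "\<bar>measure \<nu> A - measure \<eta> A\<bar> \<le> \<epsilon>" if A: "A \<in> sets borel" for A
  proof -
    \<comment> \<open>The opposite inequality is the same one for the complement, since both
      measures have mass 1.\<close>
    have "measure \<nu> (- A) = 1 - measure \<nu> A" "measure \<eta> (- A) = 1 - measure \<eta> A"
      using N.prob_compl[of A] E.prob_compl[of A] A sets spc by (auto simp: Compl_eq_Diff_UNIV)
    moreover have "- A \<in> sets borel" by (rule borel_comp[OF A])
    ultimately show ?thesis using half[OF A] half[of "- A"] by linarith
  qed
  thus ?thesis unfolding TV_def by (intro cSUP_least) auto
qed

section \<open>The standard Gaussian density and its coordinate moments\<close>

lemma std_gaussian_density_eq: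
  fixes v :: "'a::euclidean_space"
  shows "(\<Prod>b\<in>Basis. std_normal_density (v \<bullet> b))
    = exp (- (v \<bullet> v / 2 + real DIM('a) * ln (sqrt (2 * pi))))"
proof -
  have "std_normal_density t = exp (- (t\<^sup>2 / 2) - ln (sqrt (2 * pi)))" for t :: real
    by (simp add: std_normal_density_def exp_diff)
  hence "(\<Prod>b\<in>Basis. std_normal_density (v \<bullet> b)) = exp (\<Sum>b\<in>Basis. - ((v \<bullet> b)\<^sup>2 / 2) - ln (sqrt (2 * pi)))"
    by (simp add: exp_sum)
  also have "(\<Sum>b\<in>Basis. - ((v \<bullet> b)\<^sup>2 / 2) - ln (sqrt (2 * pi))) = - (v \<bullet> v / 2 + real DIM('a) * ln (sqrt (2 * pi)))"
    by (simp add: euclidean_inner[of v v] sum_subtractf sum_negf sum_divide_distrib power2_eq_square)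
  finally show ?thesis .
qed

text \<open>An even power of one coordinate times the density is a product over the coordinates, so
  the integral factorises into one-dimensional moments, all equal to 1 except the one in direction
  \<open>b\<close>.\<close>

lemma gaussian_moment:
  fixes b :: "'a::euclidean_space"
  assumes b: "b \<in> Basis"
  shows "integrable lborel (\<lambda>v. (v \<bullet> b) ^ (2 * k) * (\<Prod>b\<in>Basis. std_normal_density (v \<bullet> b)))"
    and "(\<integral>v. (v \<bullet> b) ^ (2 * k) * (\<Prod>b\<in>Basis. std_normal_density (v \<bullet> b)) \<partial>lborel) = fact (2 * k) / (2 ^ k * fact k)"
proof -
  let ?m = "fact (2 * k) / (2 ^ k * fact k) :: real"
  define f where "f c t = (if c = b then ennreal (std_normal_density t * t ^ (2 * k)) else ennreal (std_normal_density t))" for c :: 'a and t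
  have [measurable]: "f c \<in> borel_measurable borel" for c unfolding f_def by auto
  have "(\<integral>\<^sup>+v. ennreal ((v \<bullet> b) ^ (2 * k) * (\<Prod>b\<in>Basis. std_normal_density (v \<bullet> b))) \<partial>lborel)
      = (\<integral>\<^sup>+v. (\<Prod>c\<in>Basis. f c (v \<bullet> c)) \<partial>lborel)"
  proof (intro nn_integral_cong)
    fix v :: 'a
    have "(\<Prod>c\<in>Basis. f c (v \<bullet> c)) = ennreal (std_normal_density (v \<bullet> b) * (v \<bullet> b) ^ (2 * k)) * (\<Prod>c\<in>Basis - {b}. ennreal (std_normal_density (v \<bullet> c)))"
      using b by (subst prod.remove[of _ b]) (auto simp: f_def intro!: arg_cong2[of _ _ _ _ "(*)"] prod.cong)
    also have "\<dots> = ennreal (std_normal_density (v \<bullet> b) * (v \<bullet> b) ^ (2 * k) * (\<Prod>c\<in>Basis - {b}. std_normal_density (v \<bullet> c)))"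
      by (subst prod_ennreal) (auto simp: ennreal_mult' prod_nonneg intro!: ennreal_mult''[symmetric])
    also have "std_normal_density (v \<bullet> b) * (v \<bullet> b) ^ (2 * k) * (\<Prod>c\<in>Basis - {b}. std_normal_density (v \<bullet> c))
       = (v \<bullet> b) ^ (2 * k) * (\<Prod>c\<in>Basis. std_normal_density (v \<bullet> c))"
      using b by (subst prod.remove[of Basis b "\<lambda>c. std_normal_density (v \<bullet> c)"]) auto
    finally show "ennreal ((v \<bullet> b) ^ (2 * k) * (\<Prod>b\<in>Basis. std_normal_density (v \<bullet> b))) = (\<Prod>c\<in>Basis. f c (v \<bullet> c))"
      by simp
  qed
  also have "\<dots> = (\<Prod>c\<in>Basis. \<integral>\<^sup>+t. f c t \<partial>lborel)"
    by (rule nn_integral_lborel_prod) auto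
  also have "\<dots> = (\<Prod>c\<in>Basis. if c = b then ennreal ?m else 1)"
  proof (intro prod.cong refl)
    fix c :: 'a
    have n: "(\<integral>\<^sup>+t. ennreal (std_normal_density t * t ^ (2 * k)) \<partial>lborel) = ennreal (fact (2 * k) / (2 ^ k * fact k))" for k
      using std_normal_moment_even[of k] by (subst nn_integral_eq_integral)
        (auto simp: has_bochner_integral_iff zero_le_even_power)
    show "(\<integral>\<^sup>+t. f c t \<partial>lborel) = (if c = b then ennreal ?m else 1)"
      using n[of k] n[of 0] by (simp add: f_def)
  qed
  also have "\<dots> = ennreal ?m"
    using b by (simp add: prod.If_cases)
  finally have *: "(\<integral>\<^sup>+v. ennreal ((v \<bullet> b) ^ (2 * k) * (\<Prod>b\<in>Basis. std_normal_density (v \<bullet> b))) \<partial>lborel) = ennreal ?m" .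
  have nn: "0 \<le> (v \<bullet> b) ^ (2 * k) * (\<Prod>b\<in>Basis. std_normal_density (v \<bullet> b))" for v
    by (intro mult_nonneg_nonneg prod_nonneg) (auto simp: zero_le_even_power)
  have m: "(\<lambda>v. (v \<bullet> b) ^ (2 * k) * (\<Prod>b\<in>Basis. std_normal_density (v \<bullet> b))) \<in> borel_measurable lborel"
    by measurable
  show i: "integrable lborel (\<lambda>v. (v \<bullet> b) ^ (2 * k) * (\<Prod>b\<in>Basis. std_normal_density (v \<bullet> b)))"
    by (rule integrableI_nonneg[OF m]) (use nn * in auto)
  show "(\<integral>v. (v \<bullet> b) ^ (2 * k) * (\<Prod>b\<in>Basis. std_normal_density (v \<bullet> b)) \<partial>lborel) = ?m"
    using * nn_integral_eq_integral[OF i] nn by (simp add: integral_nonneg_AE)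
qed

lemma dd_inner_left:
  fixes W :: "'c::euclidean_space \<Rightarrow> 'a::euclidean_space"
  assumes "smooth n W" "0 < n"
  shows "dd (\<lambda>z. W z \<bullet> b) c z = dd W c z \<bullet> b"
  by (rule dd_eqI) (auto intro!: derivative_eq_intros has_derivative_dd[OF assms])

text \<open>The trace of a square is at most the squared Hilbert-Schmidt norm, a sum of
  \<open>DIM('a)\<close> squared column norms. The square of the trace would cost another factor of
  the dimension.\<close>

lemma trace_square_le:
  fixes A :: "'a::euclidean_space \<Rightarrow> 'a"
  assumes "\<And>b. b \<in> Basis \<Longrightarrow> norm (A b) \<le> \<beta>"
  shows "(\<Sum>i\<in>Basis. \<Sum>j\<in>Basis. (A j \<bullet> i) * (A i \<bullet> j)) \<le> real DIM('a) * \<beta>\<^sup>2"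
proof -
  have "(\<Sum>i\<in>Basis. \<Sum>j\<in>Basis. (A j \<bullet> i) * (A i \<bullet> j))
      \<le> (\<Sum>i\<in>Basis. \<Sum>j\<in>Basis. ((A j \<bullet> i)\<^sup>2 + (A i \<bullet> j)\<^sup>2) / 2)"
  proof (intro sum_mono)
    fix i j
    show "(A j \<bullet> i) * (A i \<bullet> j) \<le> ((A j \<bullet> i)\<^sup>2 + (A i \<bullet> j)\<^sup>2) / 2"
      using sum_squares_bound[of "A j \<bullet> i" "A i \<bullet> j"] by simp
  qed
  also have "\<dots> = ((\<Sum>i\<in>Basis. \<Sum>j\<in>Basis. (A j \<bullet> i)\<^sup>2) + (\<Sum>i\<in>Basis. \<Sum>j\<in>Basis. (A i \<bullet> j)\<^sup>2)) / 2"
    by (simp add: sum.distrib flip: sum_divide_distrib)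
  also have "(\<Sum>i\<in>Basis. \<Sum>j\<in>Basis. (A j \<bullet> i)\<^sup>2) = (\<Sum>i\<in>Basis. \<Sum>j\<in>Basis. (A i \<bullet> j)\<^sup>2)"
    by (rule sum.swap)
  also have "(\<Sum>i\<in>Basis. \<Sum>j\<in>Basis. (A i \<bullet> j)\<^sup>2) = (\<Sum>i\<in>Basis. (norm (A i))\<^sup>2)"
    unfolding power2_norm_eq_inner by (simp add: euclidean_inner[of "A _" "A _"] power2_eq_square)
  also have "\<dots> \<le> (\<Sum>i\<in>(Basis::'a set). \<beta>\<^sup>2)"
    using assms by (intro sum_mono power_mono) auto
  finally show ?thesis by simp
qed

text \<open>The abstract estimate behind both halves of the theorem. The field \<open>W\<close> points in the
  directions \<open>\<iota>\<close>; its divergence \<open>\<delta>\<close> with respect to the density \<open>exp (- V)\<close> has mean zero, so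
  the test function may be centred at \<open>1/2\<close>.\<close>

lemma weighted_divergence_bound:
  fixes V \<phi> :: "'c::euclidean_space \<Rightarrow> real" and W :: "'c \<Rightarrow> 'a::euclidean_space" and \<iota> :: "'a \<Rightarrow> 'c"
  assumes \<iota>: "linear \<iota>" and V: "smooth 2 V" and W: "smooth 2 W" and \<phi>: "test_fun \<phi>"
    and iV: "integrable lborel (\<lambda>z. exp (- V z))" and V1: "(\<integral>z. exp (- V z) \<partial>lborel) = 1"
    and iW: "integrable lborel (\<lambda>z. (norm (W z))\<^sup>2 * exp (- V z))"
    and idV: "\<And>b. b \<in> Basis \<Longrightarrow> integrable lborel (\<lambda>z. (dd V (\<iota> b) z)\<^sup>2 * exp (- V z))"
    and \<beta>: "\<And>z b. b \<in> Basis \<Longrightarrow> norm (dd W (\<iota> b) z) \<le> \<beta> z" "\<And>z. \<beta> z \<le> K"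
    and m\<beta>: "\<beta> \<in> borel_measurable borel"
    and H: "\<And>i j z. i \<in> Basis \<Longrightarrow> j \<in> Basis \<Longrightarrow> \<bar>dd (dd V (\<iota> j)) (\<iota> i) z\<bar> \<le> \<Lambda>"
    and Q: "\<And>z a. (\<Sum>i\<in>Basis. \<Sum>j\<in>Basis. dd (dd V (\<iota> j)) (\<iota> i) z * (a \<bullet> i) * (a \<bullet> j)) \<le> \<Lambda> * (norm a)\<^sup>2"
    and \<alpha>: "\<alpha> > 0" "(\<integral>z. (real DIM('a) * (\<beta> z)\<^sup>2 + \<Lambda> * (norm (W z))\<^sup>2) * exp (- V z) \<partial>lborel) \<le> \<alpha>\<^sup>2"
  shows "\<bar>\<integral>z. dd \<phi> (\<iota> (W z)) z * exp (- V z) \<partial>lborel\<bar> \<le> \<alpha> / 2"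
    and "(\<integral>z. dd \<phi> (\<iota> (W z)) z * exp (- V z) \<partial>lborel)
       = (\<integral>z. \<phi> z * (\<Sum>b\<in>Basis. dd V (\<iota> b) z * (W z \<bullet> b) - dd W (\<iota> b) z \<bullet> b) * exp (- V z) \<partial>lborel)"
    and "integrable lborel (\<lambda>z. dd \<phi> (\<iota> (W z)) z * exp (- V z))"
proof -
  define w where "w b z = W z \<bullet> b" for b z
  define \<delta> where "\<delta> z = (\<Sum>b\<in>Basis. dd V (\<iota> b) z * (W z \<bullet> b) - dd W (\<iota> b) z \<bullet> b)" for z
  have sw: "smooth 2 (w b)" for b unfolding w_def by (intro smooth_inner W smooth_const)
  have dw: "dd (w b) c z = dd W c z \<bullet> b" for b c z
    unfolding w_def by (rule dd_inner_left[OF W]) simp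
  have s1: "smooth 1 \<phi>" "smooth 1 (w b)" "smooth 1 V" for b
    using \<phi> smooth_mono[OF sw, of 1] smooth_mono[OF V, of 1] by (auto simp: test_fun_def)
  obtain B where B: "\<And>z e. \<bar>dd \<phi> e z\<bar> \<le> B * norm e" using \<phi> by (auto simp: test_fun_def)
  have \<phi>r: "0 \<le> \<phi> z" "\<phi> z \<le> 1" for z using \<phi> by (auto simp: test_fun_def)
  have [measurable]: "V \<in> borel_measurable borel" "\<phi> \<in> borel_measurable borel" "w b \<in> borel_measurable borel"
    "dd \<phi> e \<in> borel_measurable borel" "dd V e \<in> borel_measurable borel" "dd (w b) e \<in> borel_measurable borel"
    "W \<in> borel_measurable borel" "dd W e \<in> borel_measurable borel" for b e
    using smooth_measurable[OF V] smooth_measurable[OF s1(1)] smooth_measurable[OF sw] smooth_measurable[OF W]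
      smooth_measurable[OF smooth_dd[OF s1(1) zero_less_one]] smooth_measurable[OF smooth_dd[OF s1(3) zero_less_one]]
      smooth_measurable[OF smooth_dd[OF s1(2) zero_less_one]] smooth_measurable[OF smooth_dd[OF W, of 1]]
    by auto
  note [measurable] = m\<beta>
  have iw2: "integrable lborel (\<lambda>z. (w b z)\<^sup>2 * exp (- V z))" if "b \<in> Basis" for b
  proof (rule Bochner_Integration.integrable_bound[OF iW])
    show "AE z in lborel. norm ((w b z)\<^sup>2 * exp (- V z)) \<le> norm ((norm (W z))\<^sup>2 * exp (- V z))"
      using power_mono[OF Basis_le_norm[OF that], of _ 2] by (auto simp: w_def intro!: AE_I2 mult_right_mono)
  qed auto
  have iw: "integrable lborel (\<lambda>z. w b z * exp (- V z))" if "b \<in> Basis" for b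
  proof (rule Bochner_Integration.integrable_bound[OF Bochner_Integration.integrable_add[OF iV iw2[OF that]]])
    have "\<bar>t\<bar> \<le> 1 + t\<^sup>2" for t :: real
      using sum_squares_bound[of 1 "\<bar>t\<bar>"] by (simp add: power2_eq_square)
    from mult_right_mono[OF this, of "exp (- V _)"]
    show "AE z in lborel. norm (w b z * exp (- V z)) \<le> norm (exp (- V z) + (w b z)\<^sup>2 * exp (- V z))"
      by (intro AE_I2) (simp add: abs_mult ring_distribs)
  qed auto
  have iVw: "integrable lborel (\<lambda>z. dd V (\<iota> b) z * w b z * exp (- V z))" if "b \<in> Basis" for b
  proof (rule Bochner_Integration.integrable_bound[OF Bochner_Integration.integrable_add[OF idV[OF that] iw2[OF that]]])
    have "\<bar>t * u\<bar> \<le> t\<^sup>2 + u\<^sup>2" for t u :: real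
      using sum_squares_bound[of "\<bar>t\<bar>" "\<bar>u\<bar>"] mult_nonneg_nonneg[of "\<bar>t\<bar>" "\<bar>u\<bar>"]
      unfolding abs_mult power2_abs by linarith
    from mult_right_mono[OF this, of "exp (- V _)"]
    show "AE z in lborel. norm (dd V (\<iota> b) z * w b z * exp (- V z)) \<le> norm ((dd V (\<iota> b) z)\<^sup>2 * exp (- V z) + (w b z)\<^sup>2 * exp (- V z))"
      by (intro AE_I2) (simp add: abs_mult ring_distribs)
  qed auto
  have ddw: "\<bar>dd (w c) (\<iota> b) z\<bar> \<le> K" if "b \<in> Basis" "c \<in> Basis" for b c z
    using Basis_le_norm[OF that(2), of "dd W (\<iota> b) z"] \<beta>(1)[OF that(1), of z] \<beta>(2)[of z] by (simp add: dw)
  have idw: "integrable lborel (\<lambda>z. dd (w b) (\<iota> b) z * exp (- V z))" if "b \<in> Basis" for b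
    by (rule Bochner_Integration.integrable_bound[OF integrable_mult_right[OF iV, of K]])
      (use ddw[OF that that] in \<open>auto intro!: AE_I2 simp: abs_mult order_trans[OF _ abs_ge_self]\<close>)
  have i\<delta>b: "integrable lborel (\<lambda>z. (dd V (\<iota> b) z * w b z - dd (w b) (\<iota> b) z) * exp (- V z))" if "b \<in> Basis" for b
    unfolding left_diff_distrib by (intro Bochner_Integration.integrable_diff iVw idw that)
  have bnd: "integrable lborel (\<lambda>z. p z * q z * exp (- V z))"
    if "p \<in> borel_measurable borel" "\<And>z. \<bar>p z\<bar> \<le> C" "q \<in> borel_measurable borel"
      "integrable lborel (\<lambda>z. q z * exp (- V z))" for p q :: "'c \<Rightarrow> real" and C
  proof (rule Bochner_Integration.integrable_bound[OF integrable_mult_right[OF that(4), of C]])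
    show "AE z in lborel. norm (p z * q z * exp (- V z)) \<le> norm (C * (q z * exp (- V z)))"
      using mult_right_mono[OF order_trans[OF that(2) abs_ge_self], of "\<bar>q _\<bar> * exp (- V _)"]
      by (intro AE_I2) (simp add: abs_mult mult.assoc)
  qed (use that(1,3) in auto)
  have ibp: "(\<integral>z. dd \<phi> (\<iota> b) z * w b z * exp (- V z) \<partial>lborel)
       = (\<integral>z. \<phi> z * (dd V (\<iota> b) z * w b z - dd (w b) (\<iota> b) z) * exp (- V z) \<partial>lborel)"
     "integrable lborel (\<lambda>z. dd \<phi> (\<iota> b) z * w b z * exp (- V z))"
     "integrable lborel (\<lambda>z. \<phi> z * (dd V (\<iota> b) z * w b z - dd (w b) (\<iota> b) z) * exp (- V z))"
     if "b \<in> Basis" for b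
  proof -
    show 1: "integrable lborel (\<lambda>z. dd \<phi> (\<iota> b) z * w b z * exp (- V z))"
      by (rule bnd[OF _ B _ iw[OF that]]) auto
    show 2: "integrable lborel (\<lambda>z. \<phi> z * (dd V (\<iota> b) z * w b z - dd (w b) (\<iota> b) z) * exp (- V z))"
      by (rule bnd[OF _ _ _ i\<delta>b[OF that], of _ 1]) (use \<phi>r in auto)
    have "integrable lborel (\<lambda>z. \<phi> z * w b z * exp (- V z))"
      by (rule bnd[OF _ _ _ iw[OF that], of _ 1]) (use \<phi>r in auto)
    thus "(\<integral>z. dd \<phi> (\<iota> b) z * w b z * exp (- V z) \<partial>lborel)
       = (\<integral>z. \<phi> z * (dd V (\<iota> b) z * w b z - dd (w b) (\<iota> b) z) * exp (- V z) \<partial>lborel)"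
      using 1 2 s1 by (intro integration_by_parts)
  qed
  \<comment> \<open>Integration by parts against the constant function 1: the divergence has mean
    zero.\<close>
  have ibp1: "(\<integral>z. (dd V (\<iota> b) z * w b z - dd (w b) (\<iota> b) z) * exp (- V z) \<partial>lborel) = 0" if "b \<in> Basis" for b
  proof -
    have "(\<integral>z. dd (\<lambda>z. 1) (\<iota> b) z * w b z * exp (- V z) \<partial>lborel)
       = (\<integral>z. 1 * (dd V (\<iota> b) z * w b z - dd (w b) (\<iota> b) z) * exp (- V z) \<partial>lborel)"
      using iw[OF that] i\<delta>b[OF that] s1 by (intro integration_by_parts) (auto simp: dd_def)
    thus ?thesis by (simp add: dd_def)
  qed
  have lin\<phi>: "dd \<phi> (\<iota> (W z)) z = (\<Sum>b\<in>Basis. dd \<phi> (\<iota> b) z * w b z)" for z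
    using linear_Basis_sum[OF linear_compose[OF \<iota> smooth_linear_dd[OF s1(1) zero_less_one, of z]], of "W z"]
    by (simp add: o_def w_def mult.commute)
  have \<delta>eq: "\<delta> z = (\<Sum>b\<in>Basis. dd V (\<iota> b) z * w b z - dd (w b) (\<iota> b) z)" for z
    by (simp add: \<delta>_def w_def dw flip: w_def)
  have i\<delta>: "integrable lborel (\<lambda>z. \<delta> z * exp (- V z))"
    unfolding \<delta>eq sum_distrib_right by (intro Bochner_Integration.integrable_sum i\<delta>b)
  have [measurable]: "\<delta> \<in> borel_measurable borel" unfolding \<delta>_def by measurable
  have \<delta>0: "(\<integral>z. \<delta> z * exp (- V z) \<partial>lborel) = 0"
    unfolding \<delta>eq sum_distrib_right by (simp add: Bochner_Integration.integral_sum i\<delta>b ibp1)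
  show "integrable lborel (\<lambda>z. dd \<phi> (\<iota> (W z)) z * exp (- V z))"
    unfolding lin\<phi> sum_distrib_right by (intro Bochner_Integration.integrable_sum ibp)
  have "(\<integral>z. dd \<phi> (\<iota> (W z)) z * exp (- V z) \<partial>lborel)
      = (\<Sum>b\<in>Basis. \<integral>z. dd \<phi> (\<iota> b) z * w b z * exp (- V z) \<partial>lborel)"
    unfolding lin\<phi> sum_distrib_right by (intro Bochner_Integration.integral_sum ibp)
  also have "\<dots> = (\<Sum>b\<in>Basis. \<integral>z. \<phi> z * (dd V (\<iota> b) z * w b z - dd (w b) (\<iota> b) z) * exp (- V z) \<partial>lborel)"
    by (intro sum.cong ibp refl)
  also have "\<dots> = (\<integral>z. \<phi> z * \<delta> z * exp (- V z) \<partial>lborel)"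
    unfolding \<delta>eq sum_distrib_right sum_distrib_left
    by (intro Bochner_Integration.integral_sum[symmetric] ibp)
  finally have eq: "(\<integral>z. dd \<phi> (\<iota> (W z)) z * exp (- V z) \<partial>lborel) = (\<integral>z. \<phi> z * \<delta> z * exp (- V z) \<partial>lborel)" .
  thus "(\<integral>z. dd \<phi> (\<iota> (W z)) z * exp (- V z) \<partial>lborel)
       = (\<integral>z. \<phi> z * (\<Sum>b\<in>Basis. dd V (\<iota> b) z * (W z \<bullet> b) - dd W (\<iota> b) z \<bullet> b) * exp (- V z) \<partial>lborel)"
    by (simp only: \<delta>_def)

  let ?Q = "\<lambda>z. \<Sum>i\<in>Basis. \<Sum>j\<in>Basis. dd (w i) (\<iota> j) z * dd (w j) (\<iota> i) z
                + dd (dd V (\<iota> j)) (\<iota> i) z * w i z * w j z"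
  note sk = skorokhod_bound[where I=Basis and e=\<iota> and W=w, OF finite_Basis V sw iV iw2 ddw H, folded \<delta>eq]
  have sk1: "integrable lborel (\<lambda>z. (\<delta> z)\<^sup>2 * exp (- V z))" by (rule sk) 
  have "(\<integral>z. (\<delta> z)\<^sup>2 * exp (- V z) \<partial>lborel) \<le> (\<integral>z. ?Q z * exp (- V z) \<partial>lborel)" by (rule sk)
  also have "\<dots> \<le> (\<integral>z. (real DIM('a) * (\<beta> z)\<^sup>2 + \<Lambda> * (norm (W z))\<^sup>2) * exp (- V z) \<partial>lborel)"
  proof (rule integral_mono_AE')
    have \<beta>0: "0 \<le> \<beta> z" for z
      using order_trans[OF norm_ge_zero \<beta>(1)] nonempty_Basis by blast
    have "integrable lborel (\<lambda>z. (\<beta> z)\<^sup>2 * 1 * exp (- V z))"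
      by (rule bnd[of _ "K\<^sup>2"]) (use iV \<beta>0 \<beta>(2) in \<open>auto intro!: power_mono\<close>)
    from integrable_mult_right[OF this, of "real DIM('a)"] integrable_mult_right[OF iW, of \<Lambda>]
    show "integrable lborel (\<lambda>z. (real DIM('a) * (\<beta> z)\<^sup>2 + \<Lambda> * (norm (W z))\<^sup>2) * exp (- V z))"
      by (simp add: ring_distribs mult.assoc)
    have "?Q z \<le> real DIM('a) * (\<beta> z)\<^sup>2 + \<Lambda> * (norm (W z))\<^sup>2" for z
      using trace_square_le[of "\<lambda>b. dd W (\<iota> b) z" "\<beta> z"] \<beta>(1) Q[of z "W z"]
      by (simp add: sum.distrib dw w_def flip: w_def)
    thus "AE z in lborel. ?Q z * exp (- V z) \<le> (real DIM('a) * (\<beta> z)\<^sup>2 + \<Lambda> * (norm (W z))\<^sup>2) * exp (- V z)"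
      by (intro AE_I2 mult_right_mono) auto
    have "0 \<le> \<Lambda>"
      using H[of "SOME i. i \<in> Basis" "SOME i. i \<in> Basis"] SOME_Basis by (smt (verit))
    thus "AE z in lborel. 0 \<le> (real DIM('a) * (\<beta> z)\<^sup>2 + \<Lambda> * (norm (W z))\<^sup>2) * exp (- V z)"
      by (intro AE_I2) auto
  qed
  finally have \<delta>2: "(\<integral>z. (\<delta> z)\<^sup>2 * exp (- V z) \<partial>lborel) \<le> \<alpha>\<^sup>2" using \<alpha>(2) by linarith
  have i\<phi>\<delta>: "integrable lborel (\<lambda>z. \<phi> z * \<delta> z * exp (- V z))"
    by (rule bnd[OF _ _ _ i\<delta>, of _ 1]) (use \<phi>r in auto)
  have e1: "(\<integral>z. \<phi> z * \<delta> z * exp (- V z) \<partial>lborel)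
      = (\<integral>z. \<phi> z * \<delta> z * exp (- V z) - 1/2 * (\<delta> z * exp (- V z)) \<partial>lborel)"
    using i\<phi>\<delta> i\<delta> \<delta>0 by simp
  have "\<bar>\<integral>z. \<phi> z * \<delta> z * exp (- V z) - 1/2 * (\<delta> z * exp (- V z)) \<partial>lborel\<bar> \<le> (\<integral>z. (1/2) * ((\<delta> z)\<^sup>2 * exp (- V z) / (2 * \<alpha>) + \<alpha> / 2 * exp (- V z)) \<partial>lborel)"
  proof (rule order_trans[OF integral_abs_bound], rule integral_mono)
    show "integrable lborel (\<lambda>z. \<bar>\<phi> z * \<delta> z * exp (- V z) - 1/2 * (\<delta> z * exp (- V z))\<bar>)"
      using i\<phi>\<delta> i\<delta> by (intro integrable_abs) auto
    show "integrable lborel (\<lambda>z. (1/2) * ((\<delta> z)\<^sup>2 * exp (- V z) / (2 * \<alpha>) + \<alpha> / 2 * exp (- V z)))"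
      using sk1 iV by auto
    fix z
    \<comment> \<open>Young's inequality with parameter \<alpha> stands in for Cauchy-Schwarz. It
      loses nothing when the second moment equals \<open>\<alpha>\<^sup>2\<close>: each summand then
      integrates to \<open>\<alpha> / 2\<close>.\<close>
    have "\<bar>\<delta> z\<bar> \<le> (\<delta> z)\<^sup>2 / (2 * \<alpha>) + \<alpha> / 2"
      using sum_squares_bound[of "\<bar>\<delta> z\<bar>" \<alpha>] \<alpha>(1) by (simp add: field_simps power2_eq_square)
    moreover have "\<bar>\<phi> z - 1/2\<bar> \<le> 1/2" using \<phi>r[of z] unfolding abs_le_iff by linarith
    ultimately have "\<bar>\<phi> z - 1/2\<bar> * \<bar>\<delta> z\<bar> \<le> (1/2) * ((\<delta> z)\<^sup>2 / (2 * \<alpha>) + \<alpha> / 2)"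
      by (intro mult_mono) auto
    from mult_right_mono[OF this, of "exp (- V z)"]
    have "\<bar>(\<phi> z - 1/2) * \<delta> z * exp (- V z)\<bar> \<le> (1/2) * ((\<delta> z)\<^sup>2 / (2 * \<alpha>) + \<alpha> / 2) * exp (- V z)"
      by (simp add: abs_mult)
    also have "\<dots> = (1/2) * ((\<delta> z)\<^sup>2 * exp (- V z) / (2 * \<alpha>) + \<alpha> / 2 * exp (- V z))"
      by (simp add: ring_distribs)
    finally have *: "\<bar>(\<phi> z - 1/2) * \<delta> z * exp (- V z)\<bar> \<le> \<dots>" .
    have "\<phi> z * \<delta> z * exp (- V z) - 1/2 * (\<delta> z * exp (- V z)) = (\<phi> z - 1/2) * \<delta> z * exp (- V z)"
      by (simp add: left_diff_distrib)
    with * show "\<bar>\<phi> z * \<delta> z * exp (- V z) - 1/2 * (\<delta> z * exp (- V z))\<bar>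
        \<le> (1/2) * ((\<delta> z)\<^sup>2 * exp (- V z) / (2 * \<alpha>) + \<alpha> / 2 * exp (- V z))"
      by (simp only:)
  qed
  also have "\<dots> = (1/2) * ((\<integral>z. (\<delta> z)\<^sup>2 * exp (- V z) \<partial>lborel) / (2 * \<alpha>) + \<alpha> / 2)"
    unfolding integral_mult_right_zero
    by (subst Bochner_Integration.integral_add[OF integrable_divide integrable_mult_right[OF iV]])
      (rule sk1, simp only: integral_mult_right_zero integral_divide_zero V1 mult_1_right)
  also have "\<dots> \<le> (1/2) * (\<alpha>\<^sup>2 / (2 * \<alpha>) + \<alpha> / 2)"
    using \<delta>2 \<alpha>(1) by (intro mult_left_mono add_right_mono divide_right_mono) auto
  also have "\<dots> = \<alpha> / 2" using \<alpha>(1) by (simp add: power2_eq_square)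
  finally show "\<bar>\<integral>z. dd \<phi> (\<iota> (W z)) z * exp (- V z) \<partial>lborel\<bar> \<le> \<alpha> / 2" by (simp only: eq e1)
qed

section \<open>The Verlet step and its error fields\<close>

text \<open>Once smoothness is known, a directional derivative may be computed on a single line,
  which avoids the full derivative of a complicated field.\<close>

lemma dd_eq_line:
  assumes "smooth n f" "0 < n" "((\<lambda>t. f (p + t *\<^sub>R a)) has_vector_derivative D) (at 0)"
  shows "dd f a p = D"
proof -
  obtain m where "n = Suc m" using assms(2) gr0_implies_Suc by blast
  hence "((\<lambda>t. f (p + t *\<^sub>R a)) has_vector_derivative dd f a p) (at 0)"
    using dd_line[of m f p a 0] assms(1) by simp
  thus ?thesis using assms(3) vector_derivative_unique_at by blast
qed

text \<open>The gradient \<open>g\<close> is a parameter of its own: it alone determines the Verlet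
  map, while \<open>U\<close> may be shifted by a constant that normalises \<open>exp (- U)\<close>.
  \<open>L\<close> and \<open>LH\<close> bound the second and third derivatives of
  \<open>U\<close>.\<close>

locale potential =
  fixes U :: "'a::euclidean_space \<Rightarrow> real" and g :: "'a \<Rightarrow> 'a" and L LH :: real
  assumes U': "\<And>x. (U has_derivative (\<lambda>e. g x \<bullet> e)) (at x)"
    and g: "smooth 3 g" and H: "\<And>x e. norm (dd g e x) \<le> L * norm e"
    and K: "\<And>x e f. norm (dd (dd g f) e x) \<le> LH * norm e * norm f"
    and g0: "g 0 = 0" and L0: "0 < L" and LH0: "0 \<le> LH"
begin

lemma smooth_g: "n \<le> 3 \<Longrightarrow> smooth n g"
  by (rule smooth_mono[OF g])

lemma smooth_g_compose: "n \<le> 3 \<Longrightarrow> smooth n k \<Longrightarrow> smooth n (\<lambda>z. g (k z))"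
  by (rule smooth_compose[OF smooth_g])

lemma gd: "(g has_derivative (\<lambda>e. dd g e x)) (at x)"
  by (rule has_derivative_dd[OF g]) simp

lemma g_chain: "(k has_derivative k') F \<Longrightarrow> F = at z within S \<Longrightarrow> ((\<lambda>z. g (k z)) has_derivative (\<lambda>e. dd g (k' e) (k z))) F"
  using has_derivative_compose[OF _ gd] by blast

lemma gbl: "bounded_linear (\<lambda>e. dd g e x)"
  using gd has_derivative_bounded_linear by blast

lemma glin: "linear (\<lambda>e. dd g e x)"
  using gbl bounded_linear.linear by blast

lemmas dd_g_add = linear_add[OF glin] and dd_g_diff = linear_diff[OF glin]
  and dd_g_scaleR = linear_scale[OF glin] and dd_g_0 = linear_0[OF glin] and dd_g_minus = linear_neg[OF glin]

lemma smooth_dd_g: "n \<le> 2 \<Longrightarrow> smooth n a \<Longrightarrow> smooth n k \<Longrightarrow> smooth n (\<lambda>z. dd g (a z) (k z))"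
  by (rule smooth_linear_apply[where A="\<lambda>z e. dd g e (k z)"])
    (auto intro!: glin smooth_compose[OF smooth_dd[OF g]])

lemma g_lip: "norm (g x - g y) \<le> L * norm (x - y)"
proof (rule differentiable_bound[of UNIV g "\<lambda>x e. dd g e x"])
  show "onorm (\<lambda>e. dd g e x) \<le> L" for x by (rule onorm_bound) (use H L0 in auto)
qed (use gd in auto)

lemma g_bound: "norm (g x) \<le> L * norm x"
  using g_lip[of x 0] g0 by simp

lemma dd_g_lip: "norm (dd g f x - dd g f y) \<le> LH * norm f * norm (x - y)"
proof (rule differentiable_bound[of UNIV "dd g f" "\<lambda>x e. dd (dd g f) e x"])
  show "onorm (\<lambda>e. dd (dd g f) e x) \<le> LH * norm f" for x
    by (rule onorm_bound) (use K[of f _ x] LH0 in \<open>auto simp: mult_ac\<close>)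
  show "(dd g f has_derivative (\<lambda>e. dd (dd g f) e x)) (at x within UNIV)" for x
    using has_derivative_dd[OF smooth_dd[OF g, of 2]] by simp
qed auto

text \<open>After subtraction of the linear part, the derivative is at most
  \<open>LH * norm a\<close> on the ball around \<open>x\<close>. The mean value inequality then
  gives the constant 1 instead of the optimal 1/2; the later constants leave room for this.\<close>

lemma g_taylor: "norm (g (x + a) - g x - dd g a x) \<le> LH * (norm a)\<^sup>2"
proof -
  define G where "G y = g y - dd g y x" for y
  have "norm (G (x + a) - G x) \<le> (LH * norm a) * norm (x + a - x)"
  proof (rule differentiable_bound[of "cball x (norm a)" G "\<lambda>y e. dd g e y - dd g e x"])
    show "(G has_derivative (\<lambda>e. dd g e y - dd g e x)) (at y within cball x (norm a))" for y
      unfolding G_def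
      by (intro has_derivative_diff has_derivative_at_withinI[OF gd] bounded_linear_imp_has_derivative[OF gbl])
    fix y assume "y \<in> cball x (norm a)"
    hence y: "norm (y - x) \<le> norm a" by (simp add: dist_norm norm_minus_commute)
    show "onorm (\<lambda>e. dd g e y - dd g e x) \<le> LH * norm a"
    proof (rule onorm_bound)
      fix e
      have "norm (dd g e y - dd g e x) \<le> (LH * norm e) * norm (y - x)" by (rule dd_g_lip)
      also have "\<dots> \<le> (LH * norm e) * norm a" using y LH0 by (intro mult_left_mono) auto
      finally show "norm (dd g e y - dd g e x) \<le> LH * norm a * norm e" by (simp add: mult_ac)
    qed (use LH0 in auto)
  qed (auto simp: dist_norm)
  thus ?thesis by (simp add: G_def dd_g_add algebra_simps power2_eq_square)
qed

lemma smooth_U: "smooth 2 U"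
  unfolding numeral_2_eq_2
  by (rule smooth_SucI[OF U']) (intro smooth_inner smooth_g smooth_const; simp)

text \<open>One Verlet step of size \<open>s\<close> is \<open>psi s\<close>: \<open>uu\<close> is the velocity after the first half kick,
  \<open>yy\<close> the new position, and the primed versions are their derivatives in \<open>z\<close>.\<close>

definition uu :: "real \<Rightarrow> 'a \<times> 'a \<Rightarrow> 'a" where "uu s z = snd z - (s/2) *\<^sub>R g (fst z)"
definition yy :: "real \<Rightarrow> 'a \<times> 'a \<Rightarrow> 'a" where "yy s z = fst z + s *\<^sub>R uu s z"
definition psi :: "real \<Rightarrow> 'a \<times> 'a \<Rightarrow> 'a \<times> 'a" where
  "psi s z = (yy s z, uu s z - (s/2) *\<^sub>R g (yy s z))"
definition uu' :: "real \<Rightarrow> 'a \<times> 'a \<Rightarrow> 'a \<times> 'a \<Rightarrow> 'a" where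
  "uu' s z c = snd c - (s/2) *\<^sub>R dd g (fst c) (fst z)"
definition yy' :: "real \<Rightarrow> 'a \<times> 'a \<Rightarrow> 'a \<times> 'a \<Rightarrow> 'a" where "yy' s z c = fst c + s *\<^sub>R uu' s z c"

lemma smooth_uu: "n \<le> 3 \<Longrightarrow> smooth n (uu s)"
  unfolding uu_def by (intro smooth_diff smooth_scaleR smooth_const smooth_snd smooth_g_compose smooth_fst)

lemma smooth_yy: "n \<le> 3 \<Longrightarrow> smooth n (yy s)"
  unfolding yy_def by (intro smooth_add smooth_scaleR smooth_const smooth_fst smooth_uu)

lemma smooth_psi: "n \<le> 3 \<Longrightarrow> smooth n (psi s)"
  unfolding psi_def
  by (intro smooth_Pair smooth_diff smooth_scaleR smooth_const smooth_uu smooth_yy smooth_g_compose)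

lemma uu_deriv: "(uu s has_derivative uu' s z) (at z)"
  unfolding uu_def uu'_def
  by (auto intro!: derivative_eq_intros g_chain)

lemma yy_deriv: "(yy s has_derivative yy' s z) (at z)"
  unfolding yy_def yy'_def
  by (auto intro!: derivative_eq_intros uu_deriv)

lemma dd_psi: "dd (psi s) c z = (yy' s z c, uu' s z c - (s/2) *\<^sub>R dd g (yy' s z c) (yy s z))"
  unfolding psi_def
  by (rule dd_eqI) (auto intro!: derivative_eq_intros g_chain uu_deriv yy_deriv)

definition psidot :: "real \<Rightarrow> 'a \<times> 'a \<Rightarrow> 'a \<times> 'a" where
  "psidot s z = (uu s z - (s/2) *\<^sub>R g (fst z),
     - ((1/2) *\<^sub>R (g (fst z) + g (yy s z))) - (s/2) *\<^sub>R dd g (uu s z - (s/2) *\<^sub>R g (fst z)) (yy s z))"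

lemma psi_time_deriv: "((\<lambda>s. psi s z) has_vector_derivative psidot s z) (at s)"
proof -
  have y: "((\<lambda>s. yy s z) has_derivative (\<lambda>t. t *\<^sub>R (uu s z - (s/2) *\<^sub>R g (fst z)))) (at s)"
    unfolding yy_def uu_def
    by (auto intro!: derivative_eq_intros simp: fun_eq_iff algebra_simps) (simp flip: scaleR_add_left)
  have u: "((\<lambda>s. uu s z) has_derivative (\<lambda>t. t *\<^sub>R (- ((1/2) *\<^sub>R g (fst z))))) (at s)"
    unfolding uu_def by (auto intro!: derivative_eq_intros simp: fun_eq_iff algebra_simps)
  have c: "((\<lambda>s::real. s/2) has_derivative (\<lambda>t. t/2)) (at s)"
    by (auto intro!: derivative_eq_intros)
  show ?thesis
    unfolding psi_def psidot_def has_vector_derivative_def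
    by (rule has_derivative_eq_rhs, rule has_derivative_Pair[OF y], rule has_derivative_diff[OF u],
        rule has_derivative_scaleR[OF c g_chain[OF y refl]])
      (simp add: fun_eq_iff dd_g_scaleR dd_g_diff algebra_simps)
qed

text \<open>The derivative of the step factors into kick, drift and kick, so
  \<open>dd (psi s) c z = psidot s z\<close> can be solved for \<open>c\<close> explicitly:
  \<open>fst c = uu s z + (s/2) *\<^sub>R g (yy s z)\<close>, and \<open>snd c\<close> follows from
  the first half kick. \<open>Wq\<close> and \<open>Wv\<close> are the components of
  \<open>c\<close> minus the Hamiltonian field with components \<open>snd z\<close> and
  \<open>- g (fst z)\<close>.\<close>

definition Wq :: "real \<Rightarrow> 'a \<times> 'a \<Rightarrow> 'a" where "Wq s z = (s/2) *\<^sub>R (g (yy s z) - g (fst z))"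
definition Wv :: "real \<Rightarrow> 'a \<times> 'a \<Rightarrow> 'a" where
  "Wv s z = (1/2) *\<^sub>R (g (fst z) - g (yy s z)) + (s/2) *\<^sub>R dd g (uu s z + (s/2) *\<^sub>R g (yy s z)) (fst z)"

lemma smooth_Wq: "smooth 2 (Wq s)"
  unfolding Wq_def
  by (intro smooth_scaleR smooth_const smooth_diff smooth_g_compose smooth_yy smooth_fst; simp)

lemma smooth_Wv: "smooth 2 (Wv s)"
  unfolding Wv_def
  by (intro smooth_add smooth_scaleR smooth_const smooth_diff smooth_dd_g smooth_g_compose smooth_yy smooth_uu smooth_fst; simp)

text \<open>Up to the fields \<open>Wq\<close> and \<open>Wv\<close>, the velocity of the step, pulled back by the step, is the
  Hamiltonian vector field.\<close>

lemma psidot_decomp: "psidot s z = dd (psi s) ((Wq s z, 0) + (0, Wv s z) + ((snd z, 0) - (0, g (fst z)))) z"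
proof -
  define c where "c = (Wq s z, 0) + (0, Wv s z) + ((snd z, 0) - (0, g (fst z)))"
  have f: "fst c = uu s z + (s/2) *\<^sub>R g (yy s z)"
    by (simp add: c_def Wq_def uu_def algebra_simps)
  have sc: "snd c = Wv s z - g (fst z)" by (simp add: c_def)
  have w: "Wv s z = (1/2) *\<^sub>R (g (fst z) - g (yy s z)) + (s/2) *\<^sub>R dd g (fst c) (fst z)"
    by (simp add: Wv_def f)
  have "uu' s z c = Wv s z - g (fst z) - (s/2) *\<^sub>R dd g (fst c) (fst z)" by (simp add: uu'_def sc)
  also have "\<dots> = - ((1/2) *\<^sub>R (g (fst z) + g (yy s z)))"
    unfolding w using scaleR_half_double[of "g (fst z)"] by (simp add: algebra_simps)
  finally have u: "uu' s z c = - ((1/2) *\<^sub>R (g (fst z) + g (yy s z)))" .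
  have y: "yy' s z c = uu s z - (s/2) *\<^sub>R g (fst z)"
    unfolding yy'_def u f by (simp add: algebra_simps)
  show ?thesis unfolding c_def[symmetric] dd_psi psidot_def u y by simp
qed

section \<open>Sizes of the error fields and of their derivatives\<close>

lemma uu_bound: "norm (uu s z) \<le> norm (snd z) + \<bar>s\<bar>/2 * (L * norm (fst z))"
proof -
  have "norm (uu s z) \<le> norm (snd z) + norm ((s/2) *\<^sub>R g (fst z))"
    unfolding uu_def by (rule norm_triangle_ineq4)
  also have "norm ((s/2) *\<^sub>R g (fst z)) \<le> \<bar>s\<bar>/2 * (L * norm (fst z))"
    using mult_left_mono[OF g_bound[of "fst z"], of "\<bar>s\<bar>/2"] by simp
  finally show ?thesis by simp
qed

lemma Wq_bound: "norm (Wq s z) \<le> s\<^sup>2/2 * (L * norm (uu s z))"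
proof -
  have "norm (Wq s z) \<le> \<bar>s\<bar>/2 * (L * norm (yy s z - fst z))"
    unfolding Wq_def using mult_left_mono[OF g_lip[of "yy s z" "fst z"], of "\<bar>s\<bar>/2"] by simp
  also have "\<dots> = s\<^sup>2/2 * (L * norm (uu s z))"
    by (simp add: yy_def power2_eq_square)
  finally show ?thesis .
qed

text \<open>The terms of first order in \<open>s\<close> cancel: half the increment of
  \<open>g\<close> over the drift meets \<open>s/2\<close> times the Hessian applied to the drift
  velocity. A Taylor remainder and a product of Hessian and gradient remain, both of order
  \<open>s\<^sup>2\<close>; this is the second order of the scheme.\<close>

lemma Wv_bound: "norm (Wv s z) \<le> s\<^sup>2/2 * (LH * (norm (uu s z))\<^sup>2) + s\<^sup>2/4 * (L * norm (g (yy s z)))"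
proof -
  have "Wv s z = - ((1/2) *\<^sub>R (g (fst z + s *\<^sub>R uu s z) - g (fst z) - dd g (s *\<^sub>R uu s z) (fst z)))
     + (s\<^sup>2/4) *\<^sub>R dd g (g (yy s z)) (fst z)"
    unfolding Wv_def by (simp add: dd_g_add dd_g_scaleR algebra_simps power2_eq_square flip: yy_def)
  hence "norm (Wv s z) \<le> 1/2 * norm (g (fst z + s *\<^sub>R uu s z) - g (fst z) - dd g (s *\<^sub>R uu s z) (fst z))
     + s\<^sup>2/4 * norm (dd g (g (yy s z)) (fst z))"
    by (metis (no_types, opaque_lifting) norm_triangle_le abs_of_nonneg norm_minus_cancel norm_scaleR order_refl
      zero_le_divide_iff zero_le_numeral zero_le_one zero_le_power2)
  also have "\<dots> \<le> 1/2 * (LH * (norm (s *\<^sub>R uu s z))\<^sup>2) + s\<^sup>2/4 * (L * norm (g (yy s z)))"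
    by (intro add_mono mult_left_mono g_taylor H) auto
  finally show ?thesis by (simp add: power_mult_distrib mult_ac)
qed

text \<open>The first argument of the minimum carries the estimate; the second one only makes \<open>\<beta>\<close>
  bounded.\<close>

definition \<beta> :: "real \<Rightarrow> 'a \<times> 'a \<Rightarrow> real" where
  "\<beta> s z = \<bar>s\<bar>/2 * (min (LH * (\<bar>s\<bar> * norm (uu s z))) (2 * L) + s\<^sup>2/2 * L\<^sup>2)"

lemma dd_g_yy_bound:
  assumes "norm a = 1"
  shows "norm (dd g a (yy s z) - dd g a (fst z)) \<le> min (LH * (\<bar>s\<bar> * norm (uu s z))) (2 * L)"
proof -
  have "norm (dd g a (yy s z) - dd g a (fst z)) \<le> LH * (\<bar>s\<bar> * norm (uu s z))"
    using dd_g_lip[of a "yy s z" "fst z"] assms by (simp add: yy_def)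
  moreover have "norm (dd g a (yy s z) - dd g a (fst z)) \<le> 2 * L"
    using norm_triangle_ineq4[of "dd g a (yy s z)" "dd g a (fst z)"] H[of a "yy s z"] H[of a "fst z"] assms by simp
  ultimately show ?thesis by simp
qed

lemma dd_g_dd_g_bound: "norm a = 1 \<Longrightarrow> norm (dd g (dd g a x) y) \<le> L\<^sup>2"
proof -
  assume a: "norm a = 1"
  have "norm (dd g (dd g a x) y) \<le> L * norm (dd g a x)" by (rule H)
  also have "\<dots> \<le> L * L" using H[of a x] L0 a by (intro mult_left_mono) auto
  finally show ?thesis by (simp add: power2_eq_square)
qed

text \<open>The field has no velocity component, so this block alone enters the trace term. Its two
  parts are a difference of Hessians at the end points of the drift and a product of two Hessians
  that stems from the first half kick.\<close>

lemma dd_Wq_bound: assumes a: "norm a = 1" shows "norm (dd (Wq s) (a, 0) z) \<le> \<beta> s z"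
proof -
  have "(Wq s has_derivative (\<lambda>c. (s/2) *\<^sub>R (dd g (yy' s z c) (yy s z) - dd g (fst c) (fst z)))) (at z)"
    unfolding Wq_def by (auto intro!: derivative_eq_intros g_chain yy_deriv)
  from dd_eqI[OF this, of "(a, 0)"]
  have "dd (Wq s) (a, 0) z = (s/2) *\<^sub>R (dd g (yy' s z (a, 0)) (yy s z) - dd g a (fst z))"
    by simp
  also have "\<dots> = (s/2) *\<^sub>R ((dd g a (yy s z) - dd g a (fst z)) - (s\<^sup>2/2) *\<^sub>R dd g (dd g a (fst z)) (yy s z))"
    by (simp add: yy'_def uu'_def dd_g_add dd_g_diff dd_g_scaleR dd_g_minus power2_eq_square)
  finally have eq: "dd (Wq s) (a, 0) z = \<dots>" .
  have "norm (dd (Wq s) (a, 0) z) \<le> \<bar>s\<bar>/2 * (norm (dd g a (yy s z) - dd g a (fst z)) + s\<^sup>2/2 * norm (dd g (dd g a (fst z)) (yy s z)))"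
    unfolding eq using norm_triangle_ineq4[of "dd g a (yy s z) - dd g a (fst z)" "(s\<^sup>2/2) *\<^sub>R dd g (dd g a (fst z)) (yy s z)"]
    by (simp add: mult_left_mono)
  also have "\<dots> \<le> \<beta> s z"
    unfolding \<beta>_def by (intro mult_left_mono add_mono dd_g_yy_bound dd_g_dd_g_bound a) auto
  finally show ?thesis .
qed

text \<open>Along a velocity direction the base point \<open>fst z\<close> is fixed, so
  differentiating the Hessian term produces no third derivative of \<open>U\<close>. What remains
  has the same structure as for \<open>Wq\<close>, hence the common bound
  \<open>\<beta>\<close>.\<close>

lemma dd_Wv_bound: assumes a: "norm a = 1" shows "norm (dd (Wv s) (0, a) z) \<le> \<beta> s z"
proof -
  obtain x v where z: "z = (x, v)" by (cases z)
  have y: "((\<lambda>t. yy s (z + t *\<^sub>R (0, a))) has_derivative (\<lambda>t. t *\<^sub>R (s *\<^sub>R a))) (at 0)"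
    unfolding yy_def uu_def z by (auto intro!: derivative_eq_intros simp: fun_eq_iff)
  have u: "((\<lambda>t. uu s (z + t *\<^sub>R (0, a))) has_derivative (\<lambda>t. t *\<^sub>R a)) (at 0)"
    unfolding uu_def z by (auto intro!: derivative_eq_intros simp: fun_eq_iff)
  have gy: "((\<lambda>t. g (yy s (z + t *\<^sub>R (0, a)))) has_derivative (\<lambda>t. dd g (t *\<^sub>R (s *\<^sub>R a)) (yy s z))) (at 0)"
    using g_chain[OF y refl] by (simp add: zero_prod_def[symmetric])
  let ?D = "(1/2) *\<^sub>R (- dd g (s *\<^sub>R a) (yy s z)) + (s/2) *\<^sub>R dd g (a + (s/2) *\<^sub>R dd g (s *\<^sub>R a) (yy s z)) x"
  have "dd (Wv s) (0, a) z = ?D"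
  proof (rule dd_eq_line[OF smooth_Wv])
    have "((\<lambda>t. (1/2) *\<^sub>R (g x - g (yy s (z + t *\<^sub>R (0, a)))) + (s/2) *\<^sub>R dd g (uu s (z + t *\<^sub>R (0, a)) + (s/2) *\<^sub>R g (yy s (z + t *\<^sub>R (0, a)))) x)
       has_derivative (\<lambda>t. (1/2) *\<^sub>R (0 - dd g (t *\<^sub>R (s *\<^sub>R a)) (yy s z)) + (s/2) *\<^sub>R dd g (t *\<^sub>R a + (s/2) *\<^sub>R dd g (t *\<^sub>R (s *\<^sub>R a)) (yy s z)) x)) (at 0)"
      by (intro has_derivative_add has_derivative_scaleR_right has_derivative_diff has_derivative_const gy u
          bounded_linear.has_derivative[OF gbl])
    hence "((\<lambda>t. (1/2) *\<^sub>R (g x - g (yy s (z + t *\<^sub>R (0, a)))) + (s/2) *\<^sub>R dd g (uu s (z + t *\<^sub>R (0, a)) + (s/2) *\<^sub>R g (yy s (z + t *\<^sub>R (0, a)))) x)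
       has_derivative (\<lambda>t. t *\<^sub>R ?D)) (at 0)"
      by (rule has_derivative_eq_rhs) (simp add: fun_eq_iff dd_g_add dd_g_scaleR algebra_simps)
    thus "((\<lambda>t. Wv s (z + t *\<^sub>R (0, a))) has_vector_derivative ?D) (at 0)"
      unfolding Wv_def has_vector_derivative_def by (simp add: z)
  qed simp
  also have "?D = (s/2) *\<^sub>R ((s\<^sup>2/2) *\<^sub>R dd g (dd g a (yy s z)) (fst z) - (dd g a (yy s z) - dd g a (fst z)))"
    by (simp add: z dd_g_add dd_g_scaleR algebra_simps power2_eq_square)
  finally have eq: "dd (Wv s) (0, a) z = \<dots>" .
  have "norm (dd (Wv s) (0, a) z) \<le> \<bar>s\<bar>/2 * (norm (dd g a (yy s z) - dd g a (fst z)) + s\<^sup>2/2 * norm (dd g (dd g a (yy s z)) (fst z)))"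
    unfolding eq using norm_triangle_ineq4[of "(s\<^sup>2/2) *\<^sub>R dd g (dd g a (yy s z)) (fst z)" "dd g a (yy s z) - dd g a (fst z)"]
    by (simp add: mult_left_mono)
  also have "\<dots> \<le> \<beta> s z"
    unfolding \<beta>_def by (intro mult_left_mono add_mono dd_g_yy_bound dd_g_dd_g_bound a) auto
  finally show ?thesis .
qed

text \<open>The value of \<open>C\<close> is immaterial; its existence makes test functions stable
  under composition with a step.\<close>

lemma dd_psi_bound: "\<exists>C\<ge>0. \<forall>c z. norm (dd (psi s) c z) \<le> C * norm c"
proof -
  let ?a = "1 + \<bar>s\<bar>/2 * L" let ?b = "1 + \<bar>s\<bar> * ?a"
  have a0: "0 \<le> ?a" "0 \<le> ?b" using L0 by auto
  have "norm (dd (psi s) c z) \<le> (?b + ?a + \<bar>s\<bar>/2 * (L * ?b)) * norm c" for c z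
  proof -
    have n: "norm (fst c) \<le> norm c" "norm (snd c) \<le> norm c"
      by (metis norm_fst_le prod.collapse) (metis norm_snd_le prod.collapse)
    have "norm (uu' s z c) \<le> norm (snd c) + \<bar>s\<bar>/2 * (L * norm (fst c))"
      unfolding uu'_def using norm_triangle_ineq4[of "snd c" "(s/2) *\<^sub>R dd g (fst c) (fst z)"]
        mult_left_mono[OF H[of "fst c" "fst z"], of "\<bar>s\<bar>/2"] by simp
    also have "\<dots> \<le> norm c + \<bar>s\<bar>/2 * (L * norm c)"
      using n L0 by (intro add_mono mult_left_mono) auto
    finally have u: "norm (uu' s z c) \<le> ?a * norm c" by (simp add: algebra_simps)
    have "norm (yy' s z c) \<le> norm (fst c) + \<bar>s\<bar> * norm (uu' s z c)"
      unfolding yy'_def using norm_triangle_ineq[of "fst c" "s *\<^sub>R uu' s z c"] by simp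
    also have "\<dots> \<le> norm c + \<bar>s\<bar> * (?a * norm c)"
      using n u by (intro add_mono mult_left_mono) auto
    finally have y: "norm (yy' s z c) \<le> ?b * norm c" by (simp add: algebra_simps)
    have "norm (dd (psi s) c z) \<le> norm (yy' s z c) + norm (uu' s z c - (s/2) *\<^sub>R dd g (yy' s z c) (yy s z))"
      unfolding dd_psi by (rule norm_Pair_le)
    also have "\<dots> \<le> norm (yy' s z c) + (norm (uu' s z c) + \<bar>s\<bar>/2 * norm (dd g (yy' s z c) (yy s z)))"
      using norm_triangle_ineq4[of "uu' s z c" "(s/2) *\<^sub>R dd g (yy' s z c) (yy s z)"] by simp
    also have "\<dots> \<le> ?b * norm c + (?a * norm c + \<bar>s\<bar>/2 * (L * (?b * norm c)))"
      using u y L0 by (intro add_mono mult_left_mono order_trans[OF H]) auto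
    finally show ?thesis by (simp add: algebra_simps)
  qed
  moreover have "0 \<le> ?b + ?a + \<bar>s\<bar>/2 * (L * ?b)" using a0 L0 by (intro add_nonneg_nonneg mult_nonneg_nonneg) auto
  ultimately show ?thesis by blast
qed

lemma test_fun_psi: assumes f: "test_fun f" shows "test_fun (\<lambda>z. f (psi s z))"
proof -
  have sf: "smooth 1 f" using f by (simp add: test_fun_def)
  have sp: "smooth 1 (psi s)" by (rule smooth_psi) simp
  obtain B where B: "\<And>z e. \<bar>dd f e z\<bar> \<le> B * norm e" using f by (auto simp: test_fun_def)
  obtain C where C: "C \<ge> 0" "\<And>c z. norm (dd (psi s) c z) \<le> C * norm c" using dd_psi_bound by blast
  have "\<bar>dd (\<lambda>z. f (psi s z)) e z\<bar> \<le> (\<bar>B\<bar> * C) * norm e" for z e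
  proof -
    have "\<bar>dd (\<lambda>z. f (psi s z)) e z\<bar> = \<bar>dd f (dd (psi s) e z) (psi s z)\<bar>"
      using dd_compose[of 0 f "psi s" e z] sf sp by simp
    also have "\<dots> \<le> \<bar>B\<bar> * norm (dd (psi s) e z)"
      using B[of "dd (psi s) e z" "psi s z"] mult_right_mono[OF abs_ge_self[of B], of "norm (dd (psi s) e z)"] by simp
    also have "\<dots> \<le> \<bar>B\<bar> * (C * norm e)" by (intro mult_left_mono C) auto
    finally show ?thesis by simp
  qed
  thus ?thesis using f smooth_compose[OF sf sp] unfolding test_fun_def by blast
qed

end

section \<open>Gaussian and Gibbs moments\<close>

lemma measurable_fst_borel [measurable]:
    "fst \<in> measurable borel (borel :: 'a::euclidean_space measure)"
  and measurable_snd_borel [measurable]: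
    "snd \<in> measurable borel (borel :: 'b::euclidean_space measure)"
  by (intro borel_measurable_continuous_onI continuous_intros)+

lemma integral_lborel_product:
  fixes f :: "'a::euclidean_space \<Rightarrow> real" and k :: "'b::euclidean_space \<Rightarrow> real"
  assumes f: "integrable lborel f" "\<And>x. 0 \<le> f x" and k: "integrable lborel k" "\<And>x. 0 \<le> k x"
  shows "integrable lborel (\<lambda>z. f (fst z) * k (snd z))"
    and "(\<integral>z. f (fst z) * k (snd z) \<partial>lborel) = (\<integral>x. f x \<partial>lborel) * (\<integral>x. k x \<partial>lborel)"
proof -
  have [measurable]: "f \<in> borel_measurable borel" "k \<in> borel_measurable borel" using f k by auto
  have "(\<integral>\<^sup>+z. ennreal (f (fst z) * k (snd z)) \<partial>lborel) = (\<integral>\<^sup>+z. ennreal (f (fst z) * k (snd z)) \<partial>(lborel \<Otimes>\<^sub>M lborel))"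
    by (simp add: lborel_prod)
  also have "\<dots> = (\<integral>\<^sup>+x. \<integral>\<^sup>+y. ennreal (f x * k y) \<partial>lborel \<partial>lborel)"
    by (subst lborel.nn_integral_fst[symmetric]) auto
  also have "\<dots> = (\<integral>\<^sup>+x. ennreal (f x) * ennreal (\<integral>y. k y \<partial>lborel) \<partial>lborel)"
    using f k by (simp add: ennreal_mult nn_integral_cmult nn_integral_eq_integral)
  also have "\<dots> = ennreal ((\<integral>x. f x \<partial>lborel) * (\<integral>x. k x \<partial>lborel))"
    using f k by (simp add: nn_integral_multc nn_integral_eq_integral ennreal_mult integral_nonneg_AE)
  finally have *: "(\<integral>\<^sup>+z. ennreal (f (fst z) * k (snd z)) \<partial>lborel) = ennreal ((\<integral>x. f x \<partial>lborel) * (\<integral>x. k x \<partial>lborel))" .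
  show i: "integrable lborel (\<lambda>z. f (fst z) * k (snd z))"
    by (rule integrableI_nonneg) (use f k * in auto)
  show "(\<integral>z. f (fst z) * k (snd z) \<partial>lborel) = (\<integral>x. f x \<partial>lborel) * (\<integral>x. k x \<partial>lborel)"
    using * f k by (subst (asm) nn_integral_eq_integral[OF i]) (auto simp: integral_nonneg_AE)
qed

definition gaussV :: "'a::euclidean_space \<Rightarrow> real" where
  "gaussV v = v \<bullet> v / 2 + real DIM('a) * ln (sqrt (2 * pi))"

lemma exp_gaussV: "exp (- gaussV v) = (\<Prod>b\<in>Basis. std_normal_density (v \<bullet> b))"
  by (simp add: std_gaussian_density_eq gaussV_def)

lemma smooth_gaussV: "smooth n gaussV"
  unfolding gaussV_def by (intro smooth_add smooth_divide_const smooth_inner smooth_ident smooth_const)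

lemma measurable_gaussV [measurable]: "gaussV \<in> borel_measurable borel"
  by (rule smooth_measurable[OF smooth_gaussV])

lemma gaussV_deriv: "(gaussV has_derivative (\<lambda>e. v \<bullet> e)) (at v)"
  unfolding gaussV_def by (auto intro!: derivative_eq_intros simp: fun_eq_iff inner_commute)

lemma gaussV_integral:
  shows "integrable lborel (\<lambda>v::'a::euclidean_space. exp (- gaussV v))"
    and "(\<integral>v. exp (- gaussV (v::'a)) \<partial>lborel) = 1"
  using gaussian_moment[OF SOME_Basis, of 0] by (simp_all add: exp_gaussV)

lemma gaussV_moment2:
  shows "integrable lborel (\<lambda>v::'a::euclidean_space. (norm v)\<^sup>2 * exp (- gaussV v))"
    and "(\<integral>v. (norm (v::'a))\<^sup>2 * exp (- gaussV v) \<partial>lborel) = real DIM('a)"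
proof -
  have eq: "(norm v)\<^sup>2 * exp (- gaussV v) = (\<Sum>b\<in>Basis. (v \<bullet> b) ^ (2 * 1) * (\<Prod>b\<in>Basis. std_normal_density (v \<bullet> b)))" for v :: 'a
    unfolding power2_norm_eq_inner by (subst euclidean_inner) (simp add: exp_gaussV power2_eq_square sum_distrib_right)
  show "integrable lborel (\<lambda>v::'a. (norm v)\<^sup>2 * exp (- gaussV v))"
    unfolding eq by (intro Bochner_Integration.integrable_sum gaussian_moment)
  show "(\<integral>v. (norm (v::'a))\<^sup>2 * exp (- gaussV v) \<partial>lborel) = real DIM('a)"
  proof -
    have "(\<integral>v. (v \<bullet> b) ^ (2 * 1) * (\<Prod>b\<in>Basis. std_normal_density (v \<bullet> b)) \<partial>lborel) = 1" if "b \<in> Basis" for b :: 'a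
      by (subst gaussian_moment(2)[OF that]) simp
    thus ?thesis unfolding eq by (subst Bochner_Integration.integral_sum[OF gaussian_moment(1)]) auto
  qed
qed

text \<open>Cauchy-Schwarz over the coordinates reduces the claim to the fourth moment 3 of one
  coordinate. The exact value is \<open>d\<^sup>2 + 2 * d\<close> for dimension \<open>d\<close>, so
  the order in the dimension is right.\<close>

lemma gaussV_moment4:
  shows "integrable lborel (\<lambda>v::'a::euclidean_space. (norm v) ^ 4 * exp (- gaussV v))"
    and "(\<integral>v. (norm (v::'a)) ^ 4 * exp (- gaussV v) \<partial>lborel) \<le> 3 * (real DIM('a))\<^sup>2"
proof -
  let ?B = "\<lambda>v::'a. real DIM('a) * (\<Sum>b\<in>Basis. (v \<bullet> b) ^ (2 * 2) * (\<Prod>b\<in>Basis. std_normal_density (v \<bullet> b)))"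
  have iB: "integrable lborel ?B"
    by (intro integrable_mult_right Bochner_Integration.integrable_sum gaussian_moment)
  have B: "(\<integral>v. ?B v \<partial>lborel) = 3 * (real DIM('a))\<^sup>2"
  proof -
    have "(\<integral>v. (v \<bullet> b) ^ (2 * 2) * (\<Prod>b\<in>Basis. std_normal_density (v \<bullet> b)) \<partial>lborel) = 3" if "b \<in> Basis" for b :: 'a
      by (subst gaussian_moment(2)[OF that]) (simp add: fact_numeral)
    thus ?thesis unfolding integral_mult_right_zero
      by (subst Bochner_Integration.integral_sum[OF gaussian_moment(1)]) (auto simp: power2_eq_square)
  qed
  have le: "(norm v) ^ 4 * exp (- gaussV v) \<le> ?B v" for v :: 'a
  proof -
    have "(norm v) ^ 4 = (\<Sum>b\<in>Basis. (v \<bullet> b)\<^sup>2 * 1)\<^sup>2"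
    proof -
      have "(norm v) ^ 4 = ((norm v)\<^sup>2)\<^sup>2" by simp
      also have "(norm v)\<^sup>2 = (\<Sum>b\<in>Basis. (v \<bullet> b)\<^sup>2 * 1)"
        unfolding power2_norm_eq_inner by (subst euclidean_inner) (simp add: power2_eq_square)
      finally show ?thesis .
    qed
    also have "\<dots> \<le> (\<Sum>b\<in>Basis. ((v \<bullet> b)\<^sup>2)\<^sup>2) * (\<Sum>b\<in>(Basis::'a set). 1\<^sup>2)"
      by (rule Cauchy_Schwarz_ineq_sum)
    finally have "(norm v) ^ 4 \<le> real DIM('a) * (\<Sum>b\<in>Basis. (v \<bullet> b) ^ (2 * 2))"
      by (simp add: mult.commute)
    from mult_right_mono[OF this, of "exp (- gaussV v)"] show ?thesis
      by (simp add: exp_gaussV sum_distrib_right mult.assoc prod_nonneg)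
  qed
  show i: "integrable lborel (\<lambda>v::'a. (norm v) ^ 4 * exp (- gaussV v))"
    by (rule Bochner_Integration.integrable_bound[OF iB])
      (use le in \<open>auto intro!: AE_I2 order_trans[OF _ abs_ge_self]\<close>)
  show "(\<integral>v. (norm (v::'a)) ^ 4 * exp (- gaussV v) \<partial>lborel) \<le> 3 * (real DIM('a))\<^sup>2"
    unfolding B[symmetric] by (rule integral_mono[OF i iB le])
qed

lemma quadratic_form_sum:
  fixes A :: "'a::euclidean_space \<Rightarrow> 'a"
  assumes "linear A"
  shows "(\<Sum>i\<in>Basis. \<Sum>j\<in>Basis. (A i \<bullet> j) * (a \<bullet> i) * (a \<bullet> j)) = A a \<bullet> a"
proof -
  have "A a \<bullet> a = (\<Sum>i\<in>Basis. (a \<bullet> i) * (A i \<bullet> a))"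
    by (subst linear_Basis_sum[OF assms]) (simp add: inner_sum_left)
  also have "\<dots> = (\<Sum>i\<in>Basis. (a \<bullet> i) * (\<Sum>j\<in>Basis. (A i \<bullet> j) * (a \<bullet> j)))"
    by (subst (2) euclidean_inner) simp
  finally show ?thesis by (simp add: sum_distrib_left mult_ac)
qed

text \<open>The factor \<open>LH\<^sup>2\<close> is kept inside the fourth moment, so that nothing
  is claimed about \<open>norm x ^ 4\<close> when \<open>LH = 0\<close>.\<close>

locale gibbs_potential = potential +
  assumes iU: "integrable lborel (\<lambda>x. exp (- U x))" and U1: "(\<integral>x. exp (- U x) \<partial>lborel) = 1"
    and i2: "integrable lborel (\<lambda>x. (norm x)\<^sup>2 * exp (- U x))"
    and i4: "integrable lborel (\<lambda>x. LH\<^sup>2 * (norm x) ^ 4 * exp (- U x))"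
begin

definition m2 :: real where "m2 = (\<integral>x. (norm x)\<^sup>2 * exp (- U x) \<partial>lborel)"
definition m4 :: real where "m4 = (\<integral>x. LH\<^sup>2 * (norm x) ^ 4 * exp (- U x) \<partial>lborel)"
definition V :: "'a \<times> 'a \<Rightarrow> real" where "V z = U (fst z) + gaussV (snd z)"

lemma exp_V: "exp (- V z) = exp (- U (fst z)) * exp (- gaussV (snd z))"
  by (simp add: V_def flip: exp_add)

lemma m2_nonneg: "0 \<le> m2" and m4_nonneg: "0 \<le> m4"
  unfolding m2_def m4_def by (intro integral_nonneg_AE; simp)+

lemma V_integral: "integrable lborel (\<lambda>z. exp (- V z))" "(\<integral>z. exp (- V z) \<partial>lborel) = 1"
  using integral_lborel_product[OF iU _ gaussV_integral(1)[where 'a='a]]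
  by (simp_all add: exp_V U1 gaussV_integral(2))

lemma moment_x2: "integrable lborel (\<lambda>z. (norm (fst z))\<^sup>2 * exp (- V z))"
    "(\<integral>z. (norm (fst z))\<^sup>2 * exp (- V z) \<partial>lborel) = m2"
  using integral_lborel_product[OF i2 _ gaussV_integral(1)[where 'a='a]]
  by (simp_all add: exp_V m2_def mult.assoc gaussV_integral(2))

lemma moment_x4: "integrable lborel (\<lambda>z. LH\<^sup>2 * (norm (fst z)) ^ 4 * exp (- V z))"
    "(\<integral>z. LH\<^sup>2 * (norm (fst z)) ^ 4 * exp (- V z) \<partial>lborel) = m4"
proof -
  have eq: "LH\<^sup>2 * (norm (fst z)) ^ 4 * exp (- V z) = LH\<^sup>2 * (norm (fst z)) ^ 4 * exp (- U (fst z)) * exp (- gaussV (snd z))" for z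
    by (simp add: exp_V)
  note p = integral_lborel_product[OF i4 _ gaussV_integral(1)[where 'a='a]]
  show "integrable lborel (\<lambda>z. LH\<^sup>2 * (norm (fst z)) ^ 4 * exp (- V z))"
    unfolding eq by (rule p) auto
  show "(\<integral>z. LH\<^sup>2 * (norm (fst z)) ^ 4 * exp (- V z) \<partial>lborel) = m4"
    unfolding eq m4_def by (subst p(2)) (simp_all only: gaussV_integral(2) mult_1_right, auto)
qed

lemma moment_v2: "integrable lborel (\<lambda>z. (norm (snd z))\<^sup>2 * exp (- V z))"
    "(\<integral>z. (norm (snd z))\<^sup>2 * exp (- V z) \<partial>lborel) = real DIM('a)"
proof -
  have eq: "(norm (snd z))\<^sup>2 * exp (- V z) = exp (- U (fst z)) * ((norm (snd z))\<^sup>2 * exp (- gaussV (snd z)))" for z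
    by (simp add: exp_V)
  show "integrable lborel (\<lambda>z. (norm (snd z))\<^sup>2 * exp (- V z))"
    "(\<integral>z. (norm (snd z))\<^sup>2 * exp (- V z) \<partial>lborel) = real DIM('a)"
    unfolding eq using integral_lborel_product[OF iU _ gaussV_moment2(1)[where 'a='a]]
    by (simp_all add: U1 gaussV_moment2(2))
qed

lemma moment_v4: "integrable lborel (\<lambda>z. (norm (snd z)) ^ 4 * exp (- V z))"
    "(\<integral>z. (norm (snd z)) ^ 4 * exp (- V z) \<partial>lborel) \<le> 3 * (real DIM('a))\<^sup>2"
proof -
  have eq: "(norm (snd z)) ^ 4 * exp (- V z) = exp (- U (fst z)) * ((norm (snd z)) ^ 4 * exp (- gaussV (snd z)))" for z
    by (simp add: exp_V)
  show "integrable lborel (\<lambda>z. (norm (snd z)) ^ 4 * exp (- V z))"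
    "(\<integral>z. (norm (snd z)) ^ 4 * exp (- V z) \<partial>lborel) \<le> 3 * (real DIM('a))\<^sup>2"
    unfolding eq using integral_lborel_product[OF iU _ gaussV_moment4(1)[where 'a='a]] gaussV_moment4(2)[where 'a='a]
    by (simp_all add: U1)
qed

text \<open>Template for the bounds \<open>Pq\<close> and \<open>Pv\<close> of the error fields.
  Only the coefficient of the fourth velocity moment needs a sign, the other moments being known
  exactly.\<close>

lemma polynomial_moment:
  assumes "0 \<le> c"
  shows "integrable lborel (\<lambda>z. (a * (norm (snd z))\<^sup>2 + b * (norm (fst z))\<^sup>2 + c * (norm (snd z)) ^ 4
       + e * (LH\<^sup>2 * (norm (fst z)) ^ 4) + k) * exp (- V z))" (is "integrable _ ?f")
    and "(\<integral>z. (a * (norm (snd z))\<^sup>2 + b * (norm (fst z))\<^sup>2 + c * (norm (snd z)) ^ 4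
       + e * (LH\<^sup>2 * (norm (fst z)) ^ 4) + k) * exp (- V z) \<partial>lborel)
      \<le> a * real DIM('a) + b * m2 + c * (3 * (real DIM('a))\<^sup>2) + e * m4 + k"
proof -
  have eq: "?f = (\<lambda>z. a * ((norm (snd z))\<^sup>2 * exp (- V z)) + b * ((norm (fst z))\<^sup>2 * exp (- V z))
     + c * ((norm (snd z)) ^ 4 * exp (- V z)) + e * (LH\<^sup>2 * (norm (fst z)) ^ 4 * exp (- V z)) + k * exp (- V z))"
    by (simp add: fun_eq_iff ring_distribs mult.assoc)
  have i: "integrable lborel (\<lambda>z. a * ((norm (snd z))\<^sup>2 * exp (- V z)))"
    "integrable lborel (\<lambda>z. b * ((norm (fst z))\<^sup>2 * exp (- V z)))"
    "integrable lborel (\<lambda>z. c * ((norm (snd z)) ^ 4 * exp (- V z)))"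
    "integrable lborel (\<lambda>z. e * (LH\<^sup>2 * (norm (fst z)) ^ 4 * exp (- V z)))"
    "integrable lborel (\<lambda>z. k * exp (- V z))"
    by (intro integrable_mult_right moment_v2 moment_x2 moment_x4 moment_v4 V_integral)+
  show "integrable lborel ?f"
    unfolding eq by (intro Bochner_Integration.integrable_add i)
  have "integral\<^sup>L lborel ?f = a * real DIM('a) + b * m2 + c * (\<integral>z. (norm (snd z)) ^ 4 * exp (- V z) \<partial>lborel) + e * m4 + k * 1"
    unfolding eq
    by (simp only: Bochner_Integration.integral_add Bochner_Integration.integrable_add i integral_mult_right_zero
        moment_v2(2) moment_x2(2) V_integral(2))
      (simp only: moment_x4(2)[symmetric] integral_mult_right_zero mult.assoc)
  also have "\<dots> \<le> a * real DIM('a) + b * m2 + c * (3 * (real DIM('a))\<^sup>2) + e * m4 + k * 1"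
    using moment_v4(2) assms by (intro add_mono mult_left_mono order_refl) auto
  finally show "integral\<^sup>L lborel ?f \<le> a * real DIM('a) + b * m2 + c * (3 * (real DIM('a))\<^sup>2) + e * m4 + k"
    by simp
qed

section \<open>Derivatives of the phase space potential and the Hamiltonian field\<close>

lemma V_deriv: "(V has_derivative (\<lambda>c. g (fst z) \<bullet> fst c + snd z \<bullet> snd c)) (at z)"
  unfolding V_def
  by (intro has_derivative_add has_derivative_compose[OF _ U'] has_derivative_compose[OF _ gaussV_deriv]
      derivative_eq_intros) auto

lemma dd_V: "dd V c = (\<lambda>z. g (fst z) \<bullet> fst c + snd z \<bullet> snd c)"
  using dd_eqI[OF V_deriv] by blast

lemma dd_dd_V: "dd (dd V c) e z = dd g (fst e) (fst z) \<bullet> fst c + snd e \<bullet> snd c"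
  unfolding dd_V by (rule dd_eqI) (auto intro!: derivative_eq_intros g_chain)

lemma smooth_V: "smooth 2 V"
  unfolding V_def
  by (intro smooth_add smooth_compose[OF smooth_U] smooth_compose[OF smooth_gaussV] smooth_fst smooth_snd)

lemma measurable_V [measurable]: "V \<in> borel_measurable borel"
  by (rule smooth_measurable[OF smooth_V])

lemma measurable_g [measurable]: "g \<in> borel_measurable borel"
  by (rule smooth_measurable[OF g])

lemma g2_integrable: "integrable lborel (\<lambda>z. (norm (g (fst z)))\<^sup>2 * exp (- V z))"
proof (rule Bochner_Integration.integrable_bound[OF integrable_mult_right[OF moment_x2(1), of "L\<^sup>2"]])
  show "AE z in lborel. norm ((norm (g (fst z)))\<^sup>2 * exp (- V z)) \<le> norm (L\<^sup>2 * ((norm (fst z))\<^sup>2 * exp (- V z)))"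
  proof (rule AE_I2)
    fix z :: "'a \<times> 'a"
    have "(norm (g (fst z)))\<^sup>2 \<le> L\<^sup>2 * (norm (fst z))\<^sup>2"
      using power_mono[OF g_bound[of "fst z"], of 2] by (simp add: power_mult_distrib)
    from mult_right_mono[OF this, of "exp (- V z)"]
    show "norm ((norm (g (fst z)))\<^sup>2 * exp (- V z)) \<le> norm (L\<^sup>2 * ((norm (fst z))\<^sup>2 * exp (- V z)))"
      by (simp add: abs_mult mult.assoc)
  qed
qed auto

lemma dd_V_sq_integrable:
  assumes "b \<in> Basis"
  shows "integrable lborel (\<lambda>z. (dd V (b, 0) z)\<^sup>2 * exp (- V z))"
    "integrable lborel (\<lambda>z. (dd V (0, b) z)\<^sup>2 * exp (- V z))"
proof -
  have le: "(a \<bullet> b)\<^sup>2 * exp (- V z) \<le> (norm a)\<^sup>2 * exp (- V z)" for a z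
    using power_mono[OF Basis_le_norm[OF assms, of a], of 2] by (intro mult_right_mono) auto
  show "integrable lborel (\<lambda>z. (dd V (b, 0) z)\<^sup>2 * exp (- V z))"
    by (rule Bochner_Integration.integrable_bound[OF g2_integrable]) (use le in \<open>auto simp: dd_V intro!: AE_I2\<close>)
  show "integrable lborel (\<lambda>z. (dd V (0, b) z)\<^sup>2 * exp (- V z))"
    by (rule Bochner_Integration.integrable_bound[OF moment_v2(1)]) (use le in \<open>auto simp: dd_V intro!: AE_I2\<close>)
qed

lemma linear_Pair0: "linear (\<lambda>a::'a. (a, 0::'a))" "linear (\<lambda>a::'a. (0::'a, a))"
  by (auto intro!: linearI)

lemma q_Hessian:
  shows "i \<in> Basis \<Longrightarrow> j \<in> Basis \<Longrightarrow> \<bar>dd (dd V (j, 0)) (i, 0) z\<bar> \<le> L"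
    and "(\<Sum>i\<in>Basis. \<Sum>j\<in>Basis. dd (dd V (j, 0)) (i, 0) z * (a \<bullet> i) * (a \<bullet> j)) \<le> L * (norm a)\<^sup>2"
proof -
  assume "i \<in> Basis" "j \<in> Basis"
  thus "\<bar>dd (dd V (j, 0)) (i, 0) z\<bar> \<le> L"
    using Basis_le_norm[of j "dd g i (fst z)"] H[of i "fst z"] by (simp add: dd_dd_V)
next
  have "dd g a (fst z) \<bullet> a \<le> norm (dd g a (fst z)) * norm a" by (rule norm_cauchy_schwarz)
  also have "\<dots> \<le> L * norm a * norm a" by (intro mult_right_mono H) auto
  finally show "(\<Sum>i\<in>Basis. \<Sum>j\<in>Basis. dd (dd V (j, 0)) (i, 0) z * (a \<bullet> i) * (a \<bullet> j)) \<le> L * (norm a)\<^sup>2"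
    using quadratic_form_sum[OF glin, of "fst z" a] by (simp add: dd_dd_V power2_eq_square)
qed

lemma v_Hessian:
  shows "i \<in> Basis \<Longrightarrow> j \<in> Basis \<Longrightarrow> \<bar>dd (dd V (0, j)) (0, i) z\<bar> \<le> 1"
    and "(\<Sum>i\<in>Basis. \<Sum>j\<in>Basis. dd (dd V (0, j)) (0, i) z * (a \<bullet> i) * (a \<bullet> j)) \<le> 1 * (norm a)\<^sup>2"
  using quadratic_form_sum[OF linear_id, of a]
  by (auto simp: dd_dd_V dd_g_0 inner_Basis power2_norm_eq_inner)

text \<open>Position drift and force separately have a non-zero weighted divergence, but both
  integrals equal that of \<open>\<phi> z * (g (fst z) \<bullet> snd z)\<close>:
  \<open>snd z\<close> is independent of the position and \<open>g (fst z)\<close> of the velocity,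
  so the plain divergences vanish.\<close>

lemma Hamiltonian_divergence:
  assumes "test_fun \<phi>"
  shows "integrable lborel (\<lambda>z. dd \<phi> (snd z, 0) z * exp (- V z))"
    and "integrable lborel (\<lambda>z. dd \<phi> (0, g (fst z)) z * exp (- V z))"
    and "(\<integral>z. dd \<phi> (snd z, 0) z * exp (- V z) \<partial>lborel) = (\<integral>z. dd \<phi> (0, g (fst z)) z * exp (- V z) \<partial>lborel)"
proof -
  have sg: "smooth 2 (\<lambda>z. g (fst z))" by (intro smooth_g_compose smooth_fst) simp
  have d1: "dd snd (b, 0) z = 0" for b :: 'a and z :: "'a \<times> 'a"
    by (subst dd_eqI[where f'=snd]) (auto intro: derivative_eq_intros)
  have d2: "dd (\<lambda>z. g (fst z)) (0, b) z = 0" for b z :: "_"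
    by (subst dd_eqI[OF g_chain[OF has_derivative_fst[OF has_derivative_ident] refl]]) (simp add: dd_g_0)
  \<comment> \<open>Only the identity and the integrability are wanted here, so any \<alpha> whose
    square exceeds the second moment \<open>t\<close> will do.\<close>
  have a: "1 + \<bar>t\<bar> > 0 \<and> t \<le> (1 + \<bar>t\<bar>)\<^sup>2" for t :: real
  proof -
    have "0 \<le> t\<^sup>2" "t \<le> \<bar>t\<bar>" "0 \<le> \<bar>t\<bar>" by simp_all
    moreover have "(1 + \<bar>t\<bar>)\<^sup>2 = 1 + t\<^sup>2 + 2 * \<bar>t\<bar>" by (simp add: power2_sum)
    ultimately show ?thesis by linarith
  qed
  note q = weighted_divergence_bound[OF linear_Pair0(1) smooth_V smooth_snd assms V_integral moment_v2(1)
      dd_V_sq_integrable(1) _ _ _ q_Hessian conjunct1[OF a] conjunct2[OF a], where \<beta>="\<lambda>_. 0" and K=0]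
  note v = weighted_divergence_bound[OF linear_Pair0(2) smooth_V sg assms V_integral g2_integrable
      dd_V_sq_integrable(2) _ _ _ v_Hessian conjunct1[OF a] conjunct2[OF a], where \<beta>="\<lambda>_. 0" and K=0]
  show "integrable lborel (\<lambda>z. dd \<phi> (snd z, 0) z * exp (- V z))"
    by (rule q(3)) (auto simp: d1)
  show "integrable lborel (\<lambda>z. dd \<phi> (0, g (fst z)) z * exp (- V z))"
    by (rule v(3)) (auto simp: d2)
  have "(\<integral>z. dd \<phi> (snd z, 0) z * exp (- V z) \<partial>lborel)
      = (\<integral>z. \<phi> z * (\<Sum>b\<in>Basis. dd V (b, 0) z * (snd z \<bullet> b) - dd snd (b, 0) z \<bullet> b) * exp (- V z) \<partial>lborel)"
    by (rule q(2)) (auto simp: d1)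
  moreover have "(\<integral>z. dd \<phi> (0, g (fst z)) z * exp (- V z) \<partial>lborel)
      = (\<integral>z. \<phi> z * (\<Sum>b\<in>Basis. dd V (0, b) z * (g (fst z) \<bullet> b) - dd (\<lambda>z. g (fst z)) (0, b) z \<bullet> b) * exp (- V z) \<partial>lborel)"
    by (rule v(2)) (auto simp: d2)
  ultimately show "(\<integral>z. dd \<phi> (snd z, 0) z * exp (- V z) \<partial>lborel) = (\<integral>z. dd \<phi> (0, g (fst z)) z * exp (- V z) \<partial>lborel)"
    by (simp add: d1 d2 dd_V mult.commute)
qed

end

section \<open>Discretisation error\<close>

lemma two_square_bound: "(a + b)\<^sup>2 \<le> 2 * a\<^sup>2 + 2 * b\<^sup>2" for a b :: real
  using sum_squares_bound[of a b] by (simp add: power2_sum)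

context potential begin

lemma uu_sq: "(norm (uu s z))\<^sup>2 \<le> 2 * (norm (snd z))\<^sup>2 + s\<^sup>2/2 * L\<^sup>2 * (norm (fst z))\<^sup>2"
proof -
  have "(norm (uu s z))\<^sup>2 \<le> (norm (snd z) + \<bar>s\<bar>/2 * (L * norm (fst z)))\<^sup>2"
    by (intro power_mono uu_bound) auto
  also have "\<dots> \<le> 2 * (norm (snd z))\<^sup>2 + 2 * (\<bar>s\<bar>/2 * (L * norm (fst z)))\<^sup>2" by (rule two_square_bound)
  finally show ?thesis by (simp add: power_mult_distrib power_divide algebra_simps)
qed

lemma uu_4: "(norm (uu s z)) ^ 4 \<le> 8 * (norm (snd z)) ^ 4 + s ^ 4/2 * L ^ 4 * (norm (fst z)) ^ 4"
proof -
  have p4: "x ^ 4 = (x\<^sup>2)\<^sup>2" for x :: real by simp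
  have "(norm (uu s z)) ^ 4 \<le> (2 * (norm (snd z))\<^sup>2 + s\<^sup>2/2 * L\<^sup>2 * (norm (fst z))\<^sup>2)\<^sup>2"
    unfolding p4 by (intro power_mono uu_sq) auto
  also have "\<dots> \<le> 2 * (2 * (norm (snd z))\<^sup>2)\<^sup>2 + 2 * (s\<^sup>2/2 * L\<^sup>2 * (norm (fst z))\<^sup>2)\<^sup>2" by (rule two_square_bound)
  finally show ?thesis by (simp add: power_mult_distrib power_divide mult_ac flip: power_mult)
qed

lemma gy_sq: "(norm (g (yy s z)))\<^sup>2 \<le> 2 * L\<^sup>2 * (norm (fst z))\<^sup>2 + 2 * L\<^sup>2 * s\<^sup>2 * (norm (uu s z))\<^sup>2"
proof -
  have "norm (yy s z) \<le> norm (fst z) + \<bar>s\<bar> * norm (uu s z)"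
    unfolding yy_def using norm_triangle_ineq[of "fst z" "s *\<^sub>R uu s z"] by simp
  hence "norm (g (yy s z)) \<le> L * (norm (fst z) + \<bar>s\<bar> * norm (uu s z))"
    using L0 by (intro order_trans[OF g_bound] mult_left_mono) auto
  hence "(norm (g (yy s z)))\<^sup>2 \<le> (L * (norm (fst z) + \<bar>s\<bar> * norm (uu s z)))\<^sup>2" by (intro power_mono) auto
  also have "\<dots> = L\<^sup>2 * (norm (fst z) + \<bar>s\<bar> * norm (uu s z))\<^sup>2" by (simp add: power_mult_distrib)
  also have "\<dots> \<le> L\<^sup>2 * (2 * (norm (fst z))\<^sup>2 + 2 * (\<bar>s\<bar> * norm (uu s z))\<^sup>2)"
    by (intro mult_left_mono two_square_bound) auto
  finally show ?thesis by (simp add: power_mult_distrib algebra_simps)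
qed

lemma \<beta>_nonneg: "0 \<le> \<beta> s z"
  unfolding \<beta>_def using L0 LH0 by (intro mult_nonneg_nonneg add_nonneg_nonneg) auto

lemma \<beta>_bounded: "\<beta> s z \<le> \<bar>s\<bar>/2 * (2 * L + s\<^sup>2/2 * L\<^sup>2)"
  unfolding \<beta>_def by (intro mult_left_mono add_right_mono) auto

lemma \<beta>_sq: "(\<beta> s z)\<^sup>2 \<le> s ^ 4 * (LH\<^sup>2 * (norm (uu s z))\<^sup>2 / 2 + s\<^sup>2 * L ^ 4 / 8)"
proof -
  have "\<beta> s z \<le> \<bar>s\<bar>/2 * (LH * (\<bar>s\<bar> * norm (uu s z)) + s\<^sup>2/2 * L\<^sup>2)"
    unfolding \<beta>_def by (intro mult_left_mono add_right_mono) auto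
  hence "(\<beta> s z)\<^sup>2 \<le> (\<bar>s\<bar>/2 * (LH * (\<bar>s\<bar> * norm (uu s z)) + s\<^sup>2/2 * L\<^sup>2))\<^sup>2"
    by (intro power_mono \<beta>_nonneg)
  also have "\<dots> = s\<^sup>2/4 * (LH * (\<bar>s\<bar> * norm (uu s z)) + s\<^sup>2/2 * L\<^sup>2)\<^sup>2" by (simp add: power_mult_distrib power_divide)
  also have "\<dots> \<le> s\<^sup>2/4 * (2 * (LH * (\<bar>s\<bar> * norm (uu s z)))\<^sup>2 + 2 * (s\<^sup>2/2 * L\<^sup>2)\<^sup>2)"
    by (intro mult_left_mono two_square_bound) auto
  also have "\<dots> = s ^ 4 * (LH\<^sup>2 * (norm (uu s z))\<^sup>2 / 2 + s\<^sup>2 * L ^ 4 / 8)"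
    by (simp add: power_mult_distrib power_divide) (simp add: eval_nat_numeral algebra_simps)
  finally show ?thesis .
qed

lemma Wq_sq: "(norm (Wq s z))\<^sup>2 \<le> s ^ 4 * (L\<^sup>2 * (norm (uu s z))\<^sup>2 / 4)"
  using power_mono[OF Wq_bound[of s z], of 2]
  by (simp add: power_mult_distrib power_divide flip: power_mult)

lemma Wv_sq: "(norm (Wv s z))\<^sup>2 \<le> s ^ 4 * (LH\<^sup>2 * (norm (uu s z)) ^ 4 / 2 + L\<^sup>2 * (norm (g (yy s z)))\<^sup>2 / 8)"
proof -
  have "(norm (Wv s z))\<^sup>2 \<le> (s\<^sup>2/2 * (LH * (norm (uu s z))\<^sup>2) + s\<^sup>2/4 * (L * norm (g (yy s z))))\<^sup>2"
    by (intro power_mono Wv_bound) auto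
  also have "\<dots> \<le> 2 * (s\<^sup>2/2 * (LH * (norm (uu s z))\<^sup>2))\<^sup>2 + 2 * (s\<^sup>2/4 * (L * norm (g (yy s z))))\<^sup>2"
    by (rule two_square_bound)
  finally show ?thesis by (simp add: power_mult_distrib power_divide algebra_simps flip: power_mult)
qed

end

context gibbs_potential begin

text \<open>\<open>s ^ 4 * Pq s z\<close> bounds the integrand that the abstract divergence estimate
  asks for, after inserting the bounds of \<open>\<beta>\<close>, \<open>Wq\<close> and
  \<open>uu\<close>; \<open>Pv\<close> does the same for the velocity field. The zero summands bring
  it into the form of \<open>polynomial_moment\<close>.\<close>

definition Pq :: "real \<Rightarrow> 'a \<times> 'a \<Rightarrow> real" where
  "Pq s z = (real DIM('a) * LH\<^sup>2 + L ^ 3 / 2) * (norm (snd z))\<^sup>2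
     + (real DIM('a) * LH\<^sup>2 * s\<^sup>2 * L\<^sup>2 / 4 + L ^ 5 * s\<^sup>2 / 8) * (norm (fst z))\<^sup>2 + 0 * (norm (snd z)) ^ 4
     + 0 * (LH\<^sup>2 * (norm (fst z)) ^ 4) + real DIM('a) * s\<^sup>2 * L ^ 4 / 8"

definition Pv :: "real \<Rightarrow> 'a \<times> 'a \<Rightarrow> real" where
  "Pv s z = (real DIM('a) * LH\<^sup>2 + L ^ 4 * s\<^sup>2 / 2) * (norm (snd z))\<^sup>2
     + (real DIM('a) * LH\<^sup>2 * s\<^sup>2 * L\<^sup>2 / 4 + L ^ 4 / 4 + L ^ 6 * s ^ 4 / 8) * (norm (fst z))\<^sup>2 + 4 * LH\<^sup>2 * (norm (snd z)) ^ 4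
     + s ^ 4 * L ^ 4 / 4 * (LH\<^sup>2 * (norm (fst z)) ^ 4) + real DIM('a) * s\<^sup>2 * L ^ 4 / 8"

lemma Pq_bound: "real DIM('a) * (\<beta> s z)\<^sup>2 + L * (norm (Wq s z))\<^sup>2 \<le> s ^ 4 * Pq s z"
proof -
  let ?u = "(norm (uu s z))\<^sup>2"
  have "real DIM('a) * (\<beta> s z)\<^sup>2 + L * (norm (Wq s z))\<^sup>2
     \<le> real DIM('a) * (s ^ 4 * (LH\<^sup>2 * ?u / 2 + s\<^sup>2 * L ^ 4 / 8)) + L * (s ^ 4 * (L\<^sup>2 * ?u / 4))"
    using L0 by (intro add_mono mult_left_mono \<beta>_sq Wq_sq) auto
  also have "\<dots> = s ^ 4 * ((real DIM('a) * LH\<^sup>2 / 2 + L ^ 3 / 4) * ?u + real DIM('a) * s\<^sup>2 * L ^ 4 / 8)"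
    by (simp add: algebra_simps power2_eq_square power3_eq_cube)
  also have "\<dots> \<le> s ^ 4 * ((real DIM('a) * LH\<^sup>2 / 2 + L ^ 3 / 4) * (2 * (norm (snd z))\<^sup>2 + s\<^sup>2/2 * L\<^sup>2 * (norm (fst z))\<^sup>2) + real DIM('a) * s\<^sup>2 * L ^ 4 / 8)"
    using L0 by (intro mult_left_mono add_mono uu_sq) auto
  also have "\<dots> = s ^ 4 * Pq s z"
    unfolding Pq_def by (simp add: algebra_simps flip: power_add)
  finally show ?thesis .
qed

lemma Pv_bound: "real DIM('a) * (\<beta> s z)\<^sup>2 + 1 * (norm (Wv s z))\<^sup>2 \<le> s ^ 4 * Pv s z"
proof -
  let ?u = "(norm (uu s z))\<^sup>2"
  have "real DIM('a) * (\<beta> s z)\<^sup>2 + 1 * (norm (Wv s z))\<^sup>2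
     \<le> real DIM('a) * (s ^ 4 * (LH\<^sup>2 * ?u / 2 + s\<^sup>2 * L ^ 4 / 8))
      + 1 * (s ^ 4 * (LH\<^sup>2 * (norm (uu s z)) ^ 4 / 2 + L\<^sup>2 * (norm (g (yy s z)))\<^sup>2 / 8))"
    by (intro add_mono mult_left_mono \<beta>_sq Wv_sq) auto
  also have "\<dots> \<le> real DIM('a) * (s ^ 4 * (LH\<^sup>2 * ?u / 2 + s\<^sup>2 * L ^ 4 / 8))
      + 1 * (s ^ 4 * (LH\<^sup>2 * (8 * (norm (snd z)) ^ 4 + s ^ 4/2 * L ^ 4 * (norm (fst z)) ^ 4) / 2
         + L\<^sup>2 * (2 * L\<^sup>2 * (norm (fst z))\<^sup>2 + 2 * L\<^sup>2 * s\<^sup>2 * ?u) / 8))"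
    by (intro add_mono mult_left_mono divide_right_mono order_refl uu_4 gy_sq) auto
  also have "\<dots> = s ^ 4 * ((real DIM('a) * LH\<^sup>2 / 2 + L ^ 4 * s\<^sup>2 / 4) * ?u + real DIM('a) * s\<^sup>2 * L ^ 4 / 8
      + L ^ 4 / 4 * (norm (fst z))\<^sup>2 + 4 * LH\<^sup>2 * (norm (snd z)) ^ 4 + s ^ 4 * L ^ 4 / 4 * (LH\<^sup>2 * (norm (fst z)) ^ 4))"
    by (simp add: field_simps flip: power_add)
  also have "\<dots> \<le> s ^ 4 * ((real DIM('a) * LH\<^sup>2 / 2 + L ^ 4 * s\<^sup>2 / 4) * (2 * (norm (snd z))\<^sup>2 + s\<^sup>2/2 * L\<^sup>2 * (norm (fst z))\<^sup>2) + real DIM('a) * s\<^sup>2 * L ^ 4 / 8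
      + L ^ 4 / 4 * (norm (fst z))\<^sup>2 + 4 * LH\<^sup>2 * (norm (snd z)) ^ 4 + s ^ 4 * L ^ 4 / 4 * (LH\<^sup>2 * (norm (fst z)) ^ 4))"
    using L0 by (intro mult_left_mono add_mono order_refl uu_sq) auto
  also have "\<dots> = s ^ 4 * Pv s z"
    unfolding Pv_def by (simp add: field_simps flip: power_add)
  finally show ?thesis .
qed

lemma Pq_integral: "integrable lborel (\<lambda>z. Pq s z * exp (- V z))"
    "(\<integral>z. Pq s z * exp (- V z) \<partial>lborel) \<le> (real DIM('a) * LH\<^sup>2 + L ^ 3 / 2) * real DIM('a)
     + (real DIM('a) * LH\<^sup>2 * s\<^sup>2 * L\<^sup>2 / 4 + L ^ 5 * s\<^sup>2 / 8) * m2 + 0 * (3 * (real DIM('a))\<^sup>2) + 0 * m4 + real DIM('a) * s\<^sup>2 * L ^ 4 / 8"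
  unfolding Pq_def by (rule polynomial_moment; simp)+

lemma Pv_integral: "integrable lborel (\<lambda>z. Pv s z * exp (- V z))"
    "(\<integral>z. Pv s z * exp (- V z) \<partial>lborel) \<le> (real DIM('a) * LH\<^sup>2 + L ^ 4 * s\<^sup>2 / 2) * real DIM('a)
     + (real DIM('a) * LH\<^sup>2 * s\<^sup>2 * L\<^sup>2 / 4 + L ^ 4 / 4 + L ^ 6 * s ^ 4 / 8) * m2 + 4 * LH\<^sup>2 * (3 * (real DIM('a))\<^sup>2)
     + s ^ 4 * L ^ 4 / 4 * m4 + real DIM('a) * s\<^sup>2 * L ^ 4 / 8"
  unfolding Pv_def by (rule polynomial_moment; simp)+

end

text \<open>\<open>R\<close> will be the radicand of the constant in the theorem, in the case that
  it is finite; the hypothesis collects the summands against which the error fields are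
  measured.\<close>

locale verlet_error = gibbs_potential +
  fixes T R :: real
  assumes T: "T > 0" and LT: "L * T\<^sup>2 \<le> 1 / 6"
    and R: "35 * (real DIM('a))\<^sup>2 * LH\<^sup>2 * T\<^sup>2 + 16 * real DIM('a) * L\<^sup>2
      + (2 * real DIM('a) * LH\<^sup>2 + L\<^sup>2 / T\<^sup>2) * m2 + m4 / T\<^sup>2 \<le> R"
begin

lemma R_pos: "R > 0"
proof -
  have "0 < 16 * real DIM('a) * L\<^sup>2" using L0 by simp
  moreover have "0 \<le> 35 * (real DIM('a))\<^sup>2 * LH\<^sup>2 * T\<^sup>2" "0 \<le> (2 * real DIM('a) * LH\<^sup>2 + L\<^sup>2 / T\<^sup>2) * m2" "0 \<le> m4 / T\<^sup>2"
    using m2_nonneg m4_nonneg by auto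
  ultimately show ?thesis using R by linarith
qed

text \<open>After multiplication by \<open>T\<^sup>2\<close> each term is one of the quantities
  \<open>A\<close> to \<open>E\<close> times a monomial in the scale-free numbers
  \<open>L * T\<^sup>2\<close> and \<open>L * s\<^sup>2\<close>, both at most 1, so comparing
  coefficients suffices. The largest one, 12 in front of \<open>A\<close>, is 4 times the factor 3
  of the fourth Gaussian moment.\<close>

lemma Ps_le_R:
  assumes s: "0 \<le> s" "s \<le> T"
  shows "(\<integral>z. Pq s z * exp (- V z) \<partial>lborel) \<le> R / T\<^sup>2" (is ?q)
    and "(\<integral>z. Pv s z * exp (- V z) \<partial>lborel) \<le> R / T\<^sup>2" (is ?v)
proof -
  define a where "a = L * T\<^sup>2"
  define b where "b = L * s\<^sup>2"
  have "s\<^sup>2 \<le> T\<^sup>2" using s by (intro power_mono) auto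
  hence "b \<le> a" unfolding a_def b_def using L0 by (intro mult_left_mono) auto
  have a: "0 \<le> a" "a \<le> 1" and b: "0 \<le> b" "b \<le> 1" 
  proof -
    show "0 \<le> a" "0 \<le> b" using L0 by (auto simp: a_def b_def)
    show "a \<le> 1" using LT by (simp add: a_def)
    thus "b \<le> 1" using \<open>b \<le> a\<close> by simp
  qed
  have p: "0 \<le> a * b" "a * b \<le> 1" "a\<^sup>2 \<le> 1" "a\<^sup>2 * b\<^sup>2 \<le> 1" "0 \<le> a\<^sup>2 * b" "a\<^sup>2 * b \<le> 1"
    using a b by (auto intro!: mult_le_one power_le_one)
  define A where "A = (real DIM('a))\<^sup>2 * LH\<^sup>2 * T\<^sup>2"
  define B where "B = real DIM('a) * L\<^sup>2"
  define C where "C = real DIM('a) * LH\<^sup>2 * m2"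
  define D where "D = L\<^sup>2 / T\<^sup>2 * m2"
  define E where "E = m4 / T\<^sup>2"
  have nn: "0 \<le> A" "0 \<le> B" "0 \<le> C" "0 \<le> D" "0 \<le> E"
    unfolding A_def B_def C_def D_def E_def using m2_nonneg m4_nonneg by auto
  have R': "35 * A + 16 * B + 2 * C + D + E \<le> R"
    using R unfolding A_def B_def C_def D_def E_def by (simp add: algebra_simps)
  have m: "t * X \<le> X" if "t \<le> 1" "0 \<le> X" for t X :: real
    using mult_right_mono[OF that] by simp
  have "T\<^sup>2 * ((real DIM('a) * LH\<^sup>2 + L ^ 3 / 2) * real DIM('a)
     + (real DIM('a) * LH\<^sup>2 * s\<^sup>2 * L\<^sup>2 / 4 + L ^ 5 * s\<^sup>2 / 8) * m2 + 0 * (3 * (real DIM('a))\<^sup>2) + 0 * m4 + real DIM('a) * s\<^sup>2 * L ^ 4 / 8)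
     = A + (a * B) / 2 + (a * b * C) / 4 + (a\<^sup>2 * b * D) / 8 + (a * b * B) / 8"
    using T unfolding A_def B_def C_def D_def a_def b_def
    by (simp add: field_simps power2_eq_square power3_eq_cube) (simp add: eval_nat_numeral algebra_simps)
  also have "\<dots> \<le> R"
    using R' nn m[OF a(2) nn(2)] m[OF p(2) nn(3)] m[OF p(6) nn(4)] m[OF p(2) nn(2)] by linarith
  finally have "T\<^sup>2 * (\<integral>z. Pq s z * exp (- V z) \<partial>lborel) \<le> R"
    using mult_left_mono[OF Pq_integral(2)[of s], of "T\<^sup>2"] by simp
  thus ?q using T by (simp add: field_simps)
  have "T\<^sup>2 * ((real DIM('a) * LH\<^sup>2 + L ^ 4 * s\<^sup>2 / 2) * real DIM('a)
     + (real DIM('a) * LH\<^sup>2 * s\<^sup>2 * L\<^sup>2 / 4 + L ^ 4 / 4 + L ^ 6 * s ^ 4 / 8) * m2 + 4 * LH\<^sup>2 * (3 * (real DIM('a))\<^sup>2)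
     + s ^ 4 * L ^ 4 / 4 * m4 + real DIM('a) * s\<^sup>2 * L ^ 4 / 8)
     = A + (a * b * B) / 2 + (a * b * C) / 4 + (a\<^sup>2 * D) / 4 + (a\<^sup>2 * b\<^sup>2 * D) / 8 + 12 * A + (a\<^sup>2 * b\<^sup>2 * E) / 4 + (a * b * B) / 8"
    using T unfolding A_def B_def C_def D_def E_def a_def b_def
    by (simp add: field_simps power2_eq_square power3_eq_cube) (simp add: eval_nat_numeral algebra_simps)
  also have "\<dots> \<le> R"
    using R' nn m[OF p(2) nn(2)] m[OF p(2) nn(3)] m[OF p(3) nn(4)] m[OF p(4) nn(4)] m[OF p(4) nn(5)] by linarith
  finally have "T\<^sup>2 * (\<integral>z. Pv s z * exp (- V z) \<partial>lborel) \<le> R"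
    using mult_left_mono[OF Pv_integral(2)[of s], of "T\<^sup>2"] by simp
  thus ?v using T by (simp add: field_simps)
qed

end

context verlet_error begin

lemma measurable_\<beta> [measurable]: "\<beta> s \<in> borel_measurable borel"
proof -
  have [measurable]: "uu s \<in> borel_measurable borel"
    by (rule smooth_measurable[OF smooth_uu[of 0]]) simp
  show ?thesis unfolding \<beta>_def by measurable
qed

lemma W_sq_integrable:
  shows "integrable lborel (\<lambda>z. (norm (Wq s z))\<^sup>2 * exp (- V z))"
    and "integrable lborel (\<lambda>z. (norm (Wv s z))\<^sup>2 * exp (- V z))"
proof -
  have [measurable]: "Wq s \<in> borel_measurable borel" "Wv s \<in> borel_measurable borel"
    by (rule smooth_measurable[OF smooth_Wq] smooth_measurable[OF smooth_Wv])+
  have nn: "0 \<le> real DIM('a) * (\<beta> s z)\<^sup>2" for z by simp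
  have "L * (norm (Wq s z))\<^sup>2 \<le> s ^ 4 * Pq s z" for z
    using Pq_bound[of s z] nn[of z] by linarith
  hence q: "(norm (Wq s z))\<^sup>2 \<le> s ^ 4 / L * Pq s z" for z
    using L0 by (simp add: field_simps)
  have q': "norm ((norm (Wq s z))\<^sup>2 * exp (- V z)) \<le> norm (s ^ 4 / L * (Pq s z * exp (- V z)))" for z
  proof -
    have "(norm (Wq s z))\<^sup>2 * exp (- V z) \<le> s ^ 4 / L * (Pq s z * exp (- V z))"
      using mult_right_mono[OF q[of z], of "exp (- V z)"] by (simp only: mult.assoc exp_ge_zero)
    also have "\<dots> \<le> norm \<dots>" unfolding real_norm_def by (rule abs_ge_self)
    finally show ?thesis by (subst (1) real_norm_def, subst abs_of_nonneg) auto
  qed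
  show "integrable lborel (\<lambda>z. (norm (Wq s z))\<^sup>2 * exp (- V z))"
    by (rule Bochner_Integration.integrable_bound[OF integrable_mult_right[OF Pq_integral(1)[of s], of "s ^ 4 / L"]])
      (use q' in auto)
  have v: "(norm (Wv s z))\<^sup>2 \<le> s ^ 4 * Pv s z" for z
    using Pv_bound[of s z] nn[of z] by linarith
  have v': "norm ((norm (Wv s z))\<^sup>2 * exp (- V z)) \<le> norm (s ^ 4 * (Pv s z * exp (- V z)))" for z
  proof -
    have "(norm (Wv s z))\<^sup>2 * exp (- V z) \<le> s ^ 4 * (Pv s z * exp (- V z))"
      using mult_right_mono[OF v[of z], of "exp (- V z)"] by (simp only: mult.assoc exp_ge_zero)
    also have "\<dots> \<le> norm \<dots>" unfolding real_norm_def by (rule abs_ge_self)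
    finally show ?thesis by (subst (1) real_norm_def, subst abs_of_nonneg) auto
  qed
  show "integrable lborel (\<lambda>z. (norm (Wv s z))\<^sup>2 * exp (- V z))"
    by (rule Bochner_Integration.integrable_bound[OF integrable_mult_right[OF Pv_integral(1)[of s], of "s ^ 4"]])
      (use v' in auto)
qed

text \<open>Each field is treated with its own block of the Hessian of \<open>V\<close>, bounded by
  \<open>L\<close> for positions and by 1 for velocities. Centring gives half of
  \<open>s\<^sup>2 * (sqrt R / T)\<close> to each, so that their sum costs it exactly once.\<close>

lemma error_field_bound:
  assumes \<phi>: "test_fun \<phi>" and s: "0 < s" "s \<le> T"
  shows "\<bar>\<integral>z. dd \<phi> (Wq s z, 0) z * exp (- V z) \<partial>lborel\<bar> \<le> s\<^sup>2 * (sqrt R / T) / 2" (is ?q)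
    and "\<bar>\<integral>z. dd \<phi> (0, Wv s z) z * exp (- V z) \<partial>lborel\<bar> \<le> s\<^sup>2 * (sqrt R / T) / 2" (is ?v)
    and "integrable lborel (\<lambda>z. dd \<phi> (Wq s z, 0) z * exp (- V z))" (is ?iq)
    and "integrable lborel (\<lambda>z. dd \<phi> (0, Wv s z) z * exp (- V z))" (is ?iv)
proof -
  have pos: "s\<^sup>2 * (sqrt R / T) > 0" using s T R_pos by simp
  have sq: "(s\<^sup>2 * (sqrt R / T))\<^sup>2 = s ^ 4 * (R / T\<^sup>2)"
    using R_pos by (simp add: power_mult_distrib power_divide flip: power_mult)
  have bq: "(\<integral>z. (real DIM('a) * (\<beta> s z)\<^sup>2 + L * (norm (Wq s z))\<^sup>2) * exp (- V z) \<partial>lborel) \<le> (s\<^sup>2 * (sqrt R / T))\<^sup>2"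
  proof -
    have "(\<integral>z. (real DIM('a) * (\<beta> s z)\<^sup>2 + L * (norm (Wq s z))\<^sup>2) * exp (- V z) \<partial>lborel)
       \<le> (\<integral>z. s ^ 4 * (Pq s z * exp (- V z)) \<partial>lborel)"
    proof (rule integral_mono_AE'[OF integrable_mult_right[OF Pq_integral(1)]])
      show "AE z in lborel. (real DIM('a) * (\<beta> s z)\<^sup>2 + L * (norm (Wq s z))\<^sup>2) * exp (- V z) \<le> s ^ 4 * (Pq s z * exp (- V z))"
        using mult_right_mono[OF Pq_bound, of "exp (- V _)" s] by (auto simp: mult.assoc intro!: AE_I2)
      have "0 \<le> s ^ 4 * Pq s z" for z
        using Pq_bound[of s z] L0 by (smt (verit) mult_nonneg_nonneg of_nat_0_le_iff zero_le_power2)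
      thus "AE z in lborel. 0 \<le> s ^ 4 * (Pq s z * exp (- V z))"
        by (auto simp: mult.assoc[symmetric] intro!: AE_I2 simp del: mult.assoc)
    qed
    also have "\<dots> \<le> s ^ 4 * (R / T\<^sup>2)"
      unfolding integral_mult_right_zero using s by (intro mult_left_mono Ps_le_R) auto
    finally show ?thesis unfolding sq .
  qed
  have bv: "(\<integral>z. (real DIM('a) * (\<beta> s z)\<^sup>2 + 1 * (norm (Wv s z))\<^sup>2) * exp (- V z) \<partial>lborel) \<le> (s\<^sup>2 * (sqrt R / T))\<^sup>2"
  proof -
    have "(\<integral>z. (real DIM('a) * (\<beta> s z)\<^sup>2 + 1 * (norm (Wv s z))\<^sup>2) * exp (- V z) \<partial>lborel)
       \<le> (\<integral>z. s ^ 4 * (Pv s z * exp (- V z)) \<partial>lborel)"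
    proof (rule integral_mono_AE'[OF integrable_mult_right[OF Pv_integral(1)]])
      show "AE z in lborel. (real DIM('a) * (\<beta> s z)\<^sup>2 + 1 * (norm (Wv s z))\<^sup>2) * exp (- V z) \<le> s ^ 4 * (Pv s z * exp (- V z))"
        using mult_right_mono[OF Pv_bound, of "exp (- V _)" s] by (auto simp: mult.assoc intro!: AE_I2)
      have "0 \<le> s ^ 4 * Pv s z" for z
        using Pv_bound[of s z] by (smt (verit) mult_nonneg_nonneg of_nat_0_le_iff zero_le_power2)
      thus "AE z in lborel. 0 \<le> s ^ 4 * (Pv s z * exp (- V z))"
        by (auto simp: mult.assoc[symmetric] intro!: AE_I2 simp del: mult.assoc)
    qed
    also have "\<dots> \<le> s ^ 4 * (R / T\<^sup>2)"
      unfolding integral_mult_right_zero using s by (intro mult_left_mono Ps_le_R) auto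
    finally show ?thesis unfolding sq .
  qed
  note q = weighted_divergence_bound[OF linear_Pair0(1) smooth_V smooth_Wq \<phi> V_integral W_sq_integrable(1)
      dd_V_sq_integrable(1) _ \<beta>_bounded measurable_\<beta> q_Hessian pos bq]
  note v = weighted_divergence_bound[OF linear_Pair0(2) smooth_V smooth_Wv \<phi> V_integral W_sq_integrable(2)
      dd_V_sq_integrable(2) _ \<beta>_bounded measurable_\<beta> v_Hessian pos bv]
  show ?q by (rule q(1)) (auto intro: dd_Wq_bound)
  show ?iq by (rule q(3)) (auto intro: dd_Wq_bound)
  show ?v by (rule v(1)) (auto intro: dd_Wv_bound)
  show ?iv by (rule v(3)) (auto intro: dd_Wv_bound)
qed

section \<open>Differentiating expectations along the Verlet step\<close>

lemma smooth_psidot: "smooth 0 (psidot s)"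
  unfolding psidot_def
  by (intro smooth_Pair smooth_diff smooth_minus smooth_add smooth_scaleR smooth_const smooth_uu smooth_yy
      smooth_g_compose smooth_fst smooth_dd_g; simp)

text \<open>Crude linear growth, uniform for step sizes up to \<open>h\<close>; it only supplies the
  dominating function for differentiation under the integral.\<close>

lemma psidot_bound:
  assumes s: "0 \<le> s" "s \<le> h"
  shows "norm (psidot s z) \<le> ((1 + 2*h*L) + (L/2 + L/2 * (1 + h * (1 + h*L)) + h*L * (1 + 2*h*L))) * (norm (fst z) + norm (snd z))"
proof -
  define n where "n = norm (fst z) + norm (snd z)"
  have n: "0 \<le> n" "norm (fst z) \<le> n" "norm (snd z) \<le> n" by (auto simp: n_def)
  have hL: "0 \<le> h * L" "0 \<le> h" using s L0 by auto
  have sL: "s/2 * (L * norm (fst z)) \<le> h * L * n"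
  proof -
    have "s/2 * (L * norm (fst z)) \<le> h * (L * n)" using s L0 n by (intro mult_mono) auto
    thus ?thesis by simp
  qed
  have u: "norm (uu s z) \<le> (1 + h * L) * n"
    using uu_bound[of s z] sL n s by (simp add: algebra_simps)
  let ?p = "uu s z - (s/2) *\<^sub>R g (fst z)"
  have g0: "norm ((s/2) *\<^sub>R g (fst z)) \<le> h * L * n"
    using mult_left_mono[OF g_bound[of "fst z"], of "s/2"] s sL by simp
  have p: "norm ?p \<le> (1 + 2*h*L) * n"
    using norm_triangle_ineq4[of "uu s z" "(s/2) *\<^sub>R g (fst z)"] u g0 by (simp add: algebra_simps)
  have "norm (yy s z) \<le> norm (fst z) + s * norm (uu s z)"
    unfolding yy_def using norm_triangle_ineq[of "fst z" "s *\<^sub>R uu s z"] s by simp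
  also have "\<dots> \<le> n + h * ((1 + h * L) * n)"
    using s u n hL by (intro add_mono mult_mono) auto
  finally have y: "norm (yy s z) \<le> (1 + h * (1 + h*L)) * n" by (simp add: algebra_simps)
  have gx: "norm (g (fst z)) \<le> L * n"
    by (rule order_trans[OF g_bound]) (use n L0 in \<open>intro mult_left_mono, auto\<close>)
  have gy: "norm (g (yy s z)) \<le> L * ((1 + h * (1 + h*L)) * n)"
    by (rule order_trans[OF g_bound]) (use y L0 in \<open>intro mult_left_mono, auto\<close>)
  have dg: "norm ((s/2) *\<^sub>R dd g ?p (yy s z)) \<le> h * (L * ((1 + 2*h*L) * n))"
  proof -
    have "norm ((s/2) *\<^sub>R dd g ?p (yy s z)) \<le> s/2 * (L * norm ?p)"
      using mult_left_mono[OF H[of ?p "yy s z"], of "s/2"] s by simp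
    also have "\<dots> \<le> h * (L * ((1 + 2*h*L) * n))"
      using s p L0 hL by (intro mult_mono) auto
    finally show ?thesis .
  qed
  have "norm (psidot s z) \<le> norm ?p + norm (- ((1/2) *\<^sub>R (g (fst z) + g (yy s z))) - (s/2) *\<^sub>R dd g ?p (yy s z))"
    unfolding psidot_def by (rule norm_Pair_le)
  also have "norm (- ((1/2) *\<^sub>R (g (fst z) + g (yy s z))) - (s/2) *\<^sub>R dd g ?p (yy s z))
      \<le> (1/2) * norm (g (fst z) + g (yy s z)) + norm ((s/2) *\<^sub>R dd g ?p (yy s z))"
    using norm_triangle_ineq4[of "- ((1/2) *\<^sub>R (g (fst z) + g (yy s z)))" "(s/2) *\<^sub>R dd g ?p (yy s z)"] by simp
  also have "norm (g (fst z) + g (yy s z)) \<le> L * n + L * ((1 + h * (1 + h*L)) * n)"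
    using norm_triangle_ineq[of "g (fst z)" "g (yy s z)"] gx gy by linarith
  finally have "norm (psidot s z) \<le> norm ?p + ((1/2) * (L * n + L * ((1 + h * (1 + h*L)) * n)) + norm ((s/2) *\<^sub>R dd g ?p (yy s z)))"
    by simp
  also have "\<dots> \<le> (1 + 2*h*L) * n + ((1/2) * (L * n + L * ((1 + h * (1 + h*L)) * n)) + h * (L * ((1 + 2*h*L) * n)))"
    using p dg by linarith
  finally show ?thesis unfolding n_def[symmetric] by (simp add: algebra_simps)
qed

text \<open>With \<open>\<phi> = f \<circ> psi s\<close>, the chain rule rewrites the time
  derivative as a derivative of \<open>\<phi>\<close> in the pulled back direction. The Hamiltonian
  part integrates to zero and the two error fields remain.\<close>

lemma verlet_drift_bound:
  assumes f: "test_fun f" and s: "0 \<le> s" "s \<le> T"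
  shows "\<bar>\<integral>z. dd f (psidot s z) (psi s z) * exp (- V z) \<partial>lborel\<bar> \<le> s\<^sup>2 * (sqrt R / T)"
proof -
  define \<phi> where "\<phi> = (\<lambda>z. f (psi s z))"
  have \<phi>: "test_fun \<phi>" unfolding \<phi>_def by (rule test_fun_psi[OF f])
  have s\<phi>: "smooth 1 \<phi>" and sf: "smooth 1 f" using \<phi> f by (auto simp: test_fun_def)
  have lin: "linear (\<lambda>e. dd \<phi> e z)" for z by (rule smooth_linear_dd[OF s\<phi>]) simp
  have eq: "dd f (psidot s z) (psi s z) * exp (- V z) = dd \<phi> (Wq s z, 0) z * exp (- V z) + dd \<phi> (0, Wv s z) z * exp (- V z)
      + (dd \<phi> (snd z, 0) z * exp (- V z) - dd \<phi> (0, g (fst z)) z * exp (- V z))" for z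
  proof -
    have "dd f (psidot s z) (psi s z) = dd \<phi> ((Wq s z, 0) + (0, Wv s z) + ((snd z, 0) - (0, g (fst z)))) z"
      unfolding psidot_decomp \<phi>_def using dd_compose[of 0 f "psi s"] sf smooth_psi[of 1 s] by simp
    thus ?thesis by (simp only: linear_add[OF lin] linear_diff[OF lin] ring_distribs)
  qed
  note ham = Hamiltonian_divergence[OF \<phi>]
  show ?thesis
  \<comment> \<open>The abstract estimate asks for a positive bound, so \<open>s = 0\<close>, where
    both error fields vanish, is treated apart.\<close>
  proof (cases "s = 0")
    case True
    have "Wq s z = 0" "Wv s z = 0" for z by (simp_all add: True Wq_def Wv_def yy_def)
    hence "dd f (psidot s z) (psi s z) * exp (- V z)
        = dd \<phi> (snd z, 0) z * exp (- V z) - dd \<phi> (0, g (fst z)) z * exp (- V z)" for z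
      using eq[of z] linear_0[OF lin, of z] by (simp add: zero_prod_def)
    thus ?thesis using ham True by simp
  next
    case False
    hence s': "0 < s" using s by simp
    define \<alpha> where "\<alpha> = s\<^sup>2 * (sqrt R / T)"
    note e = error_field_bound[OF \<phi> s' s(2), folded \<alpha>_def]
    have "(\<integral>z. dd f (psidot s z) (psi s z) * exp (- V z) \<partial>lborel)
       = (\<integral>z. dd \<phi> (Wq s z, 0) z * exp (- V z) \<partial>lborel) + (\<integral>z. dd \<phi> (0, Wv s z) z * exp (- V z) \<partial>lborel)
       + ((\<integral>z. dd \<phi> (snd z, 0) z * exp (- V z) \<partial>lborel) - (\<integral>z. dd \<phi> (0, g (fst z)) z * exp (- V z) \<partial>lborel))"
      unfolding eq using e(3,4) ham(1,2) by simp
    thus ?thesis unfolding \<alpha>_def[symmetric] using e(1,2) ham(3) by linarith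
  qed
qed

lemma test_fun_V_integrable:
  assumes f: "test_fun f" shows "integrable lborel (\<lambda>z. f z * exp (- V z))"
proof (rule Bochner_Integration.integrable_bound[OF V_integral(1)])
  have r: "0 \<le> f z" "f z \<le> 1" for z using f unfolding test_fun_def by blast+
  have [measurable]: "f \<in> borel_measurable borel" using f smooth_measurable[of 1 f] by (simp add: test_fun_def)
  show "(\<lambda>z. f z * exp (- V z)) \<in> borel_measurable lborel" by measurable
  show "AE z in lborel. norm (f z * exp (- V z)) \<le> norm (exp (- V z))"
    using r by (auto intro!: AE_I2 simp: abs_mult mult_left_le_one_le)
qed

lemma verlet_step_error:
  assumes f: "test_fun f" and h: "0 \<le> h" "h \<le> T"
  shows "\<bar>(\<integral>z. f (psi h z) * exp (- V z) \<partial>lborel) - (\<integral>z. f z * exp (- V z) \<partial>lborel)\<bar> \<le> sqrt R / T * (h ^ 3 / 3)"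
proof -
  have sf: "smooth 1 f" using f by (auto simp: test_fun_def)
  obtain B where B: "\<And>z e. \<bar>dd f e z\<bar> \<le> B * norm e" using f by (auto simp: test_fun_def)
  define A where "A = (1 + 2*h*L) + (L/2 + L/2 * (1 + h * (1 + h*L)) + h*L * (1 + 2*h*L))"
  have A0: "0 \<le> A" unfolding A_def using h L0 by (intro add_nonneg_nonneg mult_nonneg_nonneg) auto
  \<comment> \<open>By \<open>t \<le> 1 + t\<^sup>2\<close>, linear growth is dominated by second
    moments; the two ones add up to the constant 2.\<close>
  define D where "D z = \<bar>B\<bar> * A * ((1 * (norm (snd z))\<^sup>2 + 1 * (norm (fst z))\<^sup>2 + 0 * (norm (snd z)) ^ 4
       + 0 * (LH\<^sup>2 * (norm (fst z)) ^ 4) + 2) * exp (- V z))" for z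
  have psi0: "psi 0 z = z" for z by (simp add: psi_def yy_def uu_def)
  have "\<bar>(\<integral>z. f (psi h z) * exp (- V z) \<partial>lborel) - (\<integral>z. f (psi 0 z) * exp (- V z) \<partial>lborel)\<bar> \<le> sqrt R / T * (h ^ 3 / 3)"
  proof (rule increment_bound[where f="\<lambda>s. \<integral>z. f (psi s z) * exp (- V z) \<partial>lborel"
        and f'="\<lambda>s. \<integral>z. dd f (psidot s z) (psi s z) * exp (- V z) \<partial>lborel"
        and g="\<lambda>s. s\<^sup>2 * (sqrt R / T)"])
    show "0 \<le> h" by fact
    show "\<bar>\<integral>z. dd f (psidot s z) (psi s z) * exp (- V z) \<partial>lborel\<bar> \<le> s\<^sup>2 * (sqrt R / T)" if "s \<in> {0..h}" for s
      using verlet_drift_bound[OF f, of s] that h by simp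
    have "((\<lambda>s. s\<^sup>2 * c) has_integral (h ^ 3 / 3 * c - 0 ^ 3 / 3 * c)) {0..h}" for c
      by (rule fundamental_theorem_of_calculus[OF h(1)])
        (auto intro!: derivative_eq_intros simp: has_real_derivative_iff_has_vector_derivative[symmetric] eval_nat_numeral)
    from this[of "sqrt R / T"]
    show "((\<lambda>s. s\<^sup>2 * (sqrt R / T)) has_integral sqrt R / T * (h ^ 3 / 3)) {0..h}"
      by (simp add: mult.commute)
    show "((\<lambda>s. \<integral>z. f (psi s z) * exp (- V z) \<partial>lborel) has_real_derivative
        (\<integral>z. dd f (psidot s z) (psi s z) * exp (- V z) \<partial>lborel)) (at s within {0..h})" if "s \<in> {0..h}" for s
    proof (rule has_derivative_under_integral[where B=D, OF _ _ _ _ _ that])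
      show "((\<lambda>s. f (psi s z) * exp (- V z)) has_real_derivative dd f (psidot s z) (psi s z) * exp (- V z)) (at s within {0..h})" for s z
      proof -
        have "((\<lambda>s. psi s z) has_derivative (\<lambda>t. t *\<^sub>R psidot s z)) (at s)"
          using psi_time_deriv by (simp add: has_vector_derivative_def)
        from has_derivative_compose[OF this has_derivative_dd[OF sf zero_less_one]]
        have "((\<lambda>s. f (psi s z)) has_derivative (\<lambda>t. dd f (t *\<^sub>R psidot s z) (psi s z))) (at s)" .
        hence "((\<lambda>s. f (psi s z)) has_real_derivative dd f (psidot s z) (psi s z)) (at s)"
          using linear_scale[OF smooth_linear_dd[OF sf zero_less_one, of "psi s z"]]
          by (simp add: has_real_derivative_iff_has_vector_derivative has_vector_derivative_def)
        thus ?thesis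
          by (intro DERIV_cmult_right[OF DERIV_subset[where s=UNIV]]) auto
      qed
      show "integrable lborel D"
        unfolding D_def by (intro integrable_mult_right polynomial_moment) simp
      show "integrable lborel (\<lambda>z. f (psi s z) * exp (- V z))" for s
        by (rule test_fun_V_integrable[OF test_fun_psi[OF f]])
      show "(\<lambda>z. dd f (psidot s z) (psi s z) * exp (- V z)) \<in> borel_measurable lborel" for s
      proof -
        have "smooth 0 (\<lambda>z. dd f (psidot s z) (psi s z))"
          by (rule smooth_linear_apply[where A="\<lambda>z e. dd f e (psi s z)"])
            (auto intro!: smooth_linear_dd[OF sf zero_less_one] smooth_compose[OF smooth_dd[OF sf zero_less_one]] smooth_psi smooth_psidot)
        hence [measurable]: "(\<lambda>z. dd f (psidot s z) (psi s z)) \<in> borel_measurable borel" by (rule smooth_measurable)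
        show ?thesis by measurable
      qed
      fix s z assume s: "s \<in> {0..h}"
      have "\<bar>dd f (psidot s z) (psi s z)\<bar> \<le> \<bar>B\<bar> * norm (psidot s z)"
        using B[of "psidot s z" "psi s z"] mult_right_mono[OF abs_ge_self[of B], of "norm (psidot s z)"] by simp
      also have "\<dots> \<le> \<bar>B\<bar> * (A * (norm (fst z) + norm (snd z)))"
        unfolding A_def using s by (intro mult_left_mono psidot_bound) auto
      also have "\<dots> \<le> \<bar>B\<bar> * (A * ((1 + (norm (fst z))\<^sup>2) + (1 + (norm (snd z))\<^sup>2)))"
      proof -
        have "t \<le> 1 + t\<^sup>2" if "0 \<le> t" for t :: real using sum_squares_bound[of 1 t] that by simp
        thus ?thesis using A0 by (intro mult_left_mono add_mono) auto
      qed
      finally have "\<bar>dd f (psidot s z) (psi s z)\<bar> * exp (- V z) \<le> \<bar>B\<bar> * (A * ((1 + (norm (fst z))\<^sup>2) + (1 + (norm (snd z))\<^sup>2))) * exp (- V z)"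
        by (rule mult_right_mono) simp
      thus "\<bar>dd f (psidot s z) (psi s z) * exp (- V z)\<bar> \<le> D z"
        by (simp add: D_def abs_mult algebra_simps)
    qed
  qed
  thus ?thesis by (simp add: psi0)
qed

lemma verlet_iterate_error:
  assumes f: "test_fun f" and h: "0 \<le> h" "h \<le> T"
  shows "\<bar>(\<integral>z. f ((psi h ^^ k) z) * exp (- V z) \<partial>lborel) - (\<integral>z. f z * exp (- V z) \<partial>lborel)\<bar> \<le> real k * (sqrt R / T * (h ^ 3 / 3))"
  using f
proof (induction k arbitrary: f)
  case (Suc k)
  have "\<bar>(\<integral>z. f (psi h ((psi h ^^ k) z)) * exp (- V z) \<partial>lborel) - (\<integral>z. f (psi h z) * exp (- V z) \<partial>lborel)\<bar> \<le> real k * (sqrt R / T * (h ^ 3 / 3))"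
    \<comment> \<open>The induction hypothesis is used for the test function
      \<open>f \<circ> psi h\<close>, which is why \<open>f\<close> is arbitrary in the
      induction.\<close>
    by (rule Suc.IH[OF test_fun_psi[OF Suc.prems]])
  moreover note verlet_step_error[OF Suc.prems h]
  moreover have "real (Suc k) * c = real k * c + c" for c :: real by (simp add: ring_distribs)
  ultimately show ?case unfolding funpow.simps o_apply by (smt (verit))
qed simp

end

section \<open>Derivatives of the Verlet flow\<close>

text \<open>Compares a forced second order recursion with the free motion
  \<open>\<xi> 0 + t *\<^sub>R p\<close>. The accumulated force is at most
  \<open>S * (L * M + F)\<close> with \<open>M\<close> the maximum of the norms and
  \<open>L * S \<le> 1/12\<close>, so \<open>M\<close> can be absorbed. It serves for first
  derivatives of the trajectory with \<open>F = 0\<close> and for second derivatives with zero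
  initial data.\<close>

lemma discrete_gronwall:
  fixes \<xi> \<eta> :: "nat \<Rightarrow> 'b::real_normed_vector"
  assumes h: "h > 0" and n: "n \<ge> 1" and T: "T = real n * h" and L: "0 \<le> L" and F: "0 \<le> F"
    and LT: "L * (T\<^sup>2 + T * h) \<le> 1 / 6"
    and \<xi>: "\<And>j. \<xi> (Suc j) = \<xi> j + h *\<^sub>R \<eta> j"
    and \<eta>0: "norm (\<eta> 0 - p) \<le> h * (L * norm (\<xi> 0) + F)"
    and \<eta>: "\<And>j. Suc j \<le> n \<Longrightarrow> norm (\<eta> (Suc j) - \<eta> j) \<le> h * (L * norm (\<xi> (Suc j)) + F)"
  shows "j \<le> n \<Longrightarrow> norm (\<xi> j) \<le> 12/11 * (norm (\<xi> 0) + T * norm p + T\<^sup>2 * F)"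
    and "norm (\<xi> n - \<xi> 0 - T *\<^sub>R p) \<le> 1/11 * (norm (\<xi> 0) + T * norm p + T\<^sup>2 * F) + T\<^sup>2 * F"
proof -
  define M where "M = Max ((\<lambda>j. norm (\<xi> j)) ` {..n})"
  have M: "norm (\<xi> j) \<le> M" if "j \<le> n" for j unfolding M_def using that by (intro Max_ge) auto
  have M0: "0 \<le> M" by (rule order_trans[OF norm_ge_zero M[of 0]]) simp
  define c where "c = L * M + F"
  have c0: "0 \<le> c" using L F M0 by (simp add: c_def)
  have c: "h * (L * norm (\<xi> j) + F) \<le> h * c" if "j \<le> n" for j
    unfolding c_def using M[OF that] L h by (intro mult_left_mono add_right_mono) auto
  have e: "norm (\<eta> j - p) \<le> real (Suc j) * (h * c)" if "j \<le> n" for j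
    using that
  proof (induction j)
    case 0
    thus ?case using \<eta>0 c[of 0] by simp
  next
    case (Suc j)
    have "norm (\<eta> (Suc j) - p) \<le> norm (\<eta> (Suc j) - \<eta> j) + norm (\<eta> j - p)"
      using norm_triangle_ineq[of "\<eta> (Suc j) - \<eta> j" "\<eta> j - p"] by simp
    also have "\<dots> \<le> h * c + real (Suc j) * (h * c)"
      using Suc \<eta>[OF Suc.prems] c[OF Suc.prems] by (intro add_mono) auto
    finally show ?case by (simp add: algebra_simps)
  qed
  have x: "norm (\<xi> j - \<xi> 0 - (real j * h) *\<^sub>R p) \<le> h\<^sup>2 * c * (real j * (real j + 1) / 2)" if "j \<le> n" for j
    using that
  proof (induction j)
    case (Suc j)
    have eq: "\<xi> (Suc j) - \<xi> 0 - (real (Suc j) * h) *\<^sub>R p = (\<xi> j - \<xi> 0 - (real j * h) *\<^sub>R p) + h *\<^sub>R (\<eta> j - p)"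
      by (simp add: \<xi> algebra_simps)
    have "norm (\<xi> (Suc j) - \<xi> 0 - (real (Suc j) * h) *\<^sub>R p) \<le> norm (\<xi> j - \<xi> 0 - (real j * h) *\<^sub>R p) + h * norm (\<eta> j - p)"
      unfolding eq using norm_triangle_ineq[of "\<xi> j - \<xi> 0 - (real j * h) *\<^sub>R p" "h *\<^sub>R (\<eta> j - p)"] h by simp
    also have "\<dots> \<le> h\<^sup>2 * c * (real j * (real j + 1) / 2) + h * (real (Suc j) * (h * c))"
      using Suc e[of j] h by (intro add_mono mult_left_mono) auto
    also have "\<dots> = h\<^sup>2 * c * (real (Suc j) * (real (Suc j) + 1) / 2)"
      by (simp add: field_simps power2_eq_square)
    finally show ?case .
  qed simp
  \<comment> \<open>The double sum \<open>h\<^sup>2 * (n * (n + 1) / 2)\<close> written in terms of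
    \<open>T\<close>: the source of the combination \<open>T\<^sup>2 + T * h\<close> in the step
    size condition.\<close>
  define S where "S = (T\<^sup>2 + T * h) / 2"
  have LS: "L * S \<le> 1 / 12" using LT by (simp add: S_def)
  have hT: "h \<le> T" using n h by (simp add: T)
  have ST: "S \<le> T\<^sup>2" using mult_left_mono[OF hT, of T] h hT by (simp add: S_def power2_eq_square)
  have x': "norm (\<xi> j - \<xi> 0 - (real j * h) *\<^sub>R p) \<le> M / 12 + T\<^sup>2 * F" if "j \<le> n" for j
  proof -
    have "h\<^sup>2 * c * (real j * (real j + 1) / 2) \<le> h\<^sup>2 * c * (real n * (real n + 1) / 2)"
      using that c0 by (intro mult_left_mono divide_right_mono mult_mono) auto
    also have "\<dots> = c * S" by (simp add: S_def T power2_eq_square algebra_simps)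
    also have "\<dots> = (L * S) * M + S * F" by (simp add: c_def algebra_simps)
    also have "\<dots> \<le> (1/12) * M + T\<^sup>2 * F" using LS ST M0 F by (intro add_mono mult_right_mono) auto
    finally show ?thesis using x[OF that] by simp
  qed
  have "norm (\<xi> j) \<le> norm (\<xi> 0) + T * norm p + (M / 12 + T\<^sup>2 * F)" if "j \<le> n" for j
  proof -
    have "norm (\<xi> j) \<le> norm (\<xi> j - \<xi> 0 - (real j * h) *\<^sub>R p) + (norm (\<xi> 0) + norm ((real j * h) *\<^sub>R p))"
      using norm_triangle_ineq[of "\<xi> j - \<xi> 0 - (real j * h) *\<^sub>R p" "\<xi> 0 + (real j * h) *\<^sub>R p"]
        norm_triangle_ineq[of "\<xi> 0" "(real j * h) *\<^sub>R p"] by simp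
    moreover have "norm ((real j * h) *\<^sub>R p) \<le> T * norm p"
      using that h by (auto simp: T intro!: mult_right_mono)
    ultimately show ?thesis using x'[OF that] by linarith
  qed
  hence "M \<le> norm (\<xi> 0) + T * norm p + (M / 12 + T\<^sup>2 * F)"
    unfolding M_def by (subst Max_le_iff) auto
  \<comment> \<open>Absorbing \<open>M / 12\<close> on the left yields the factor 12/11.\<close>
  hence Mb: "M \<le> 12/11 * (norm (\<xi> 0) + T * norm p + T\<^sup>2 * F)" by simp
  show "norm (\<xi> j) \<le> 12/11 * (norm (\<xi> 0) + T * norm p + T\<^sup>2 * F)" if "j \<le> n"
    using M[OF that] Mb by linarith
  show "norm (\<xi> n - \<xi> 0 - T *\<^sub>R p) \<le> 1/11 * (norm (\<xi> 0) + T * norm p + T\<^sup>2 * F) + T\<^sup>2 * F"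
    using x'[OF order_refl] Mb unfolding T[symmetric] by linarith
qed

text \<open>The solution of a linear equation with smooth coefficients, under a uniform lower bound
  that makes the operators invertible. Differentiating the equation shows that the derivative solves
  an equation with the same operators and a new right side, so the order is raised by induction over
  all right sides.\<close>

lemma smooth_linear_solve:
  fixes A :: "'a::euclidean_space \<Rightarrow> 'b::euclidean_space \<Rightarrow> 'b" and c :: "'a \<Rightarrow> 'b"
  assumes lin: "\<And>v. linear (A v)" and m: "m > 0" "\<And>v f. m * norm f \<le> norm (A v f)"
    and A: "\<And>b. smooth n (\<lambda>v. A v b)" and c: "smooth n c" and w: "\<And>v. A v (w v) = c v"
  shows "smooth n w"
    and "0 < n \<Longrightarrow> A v (dd w e v) = dd c e v - dd (\<lambda>u. A u (w v)) e v"
proof -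
  have inj: "inj (A v)" for v
  proof (rule linear_injective_0[OF lin, THEN iffD2], intro allI impI)
    fix f assume "A v f = 0"
    thus "f = 0" using m(2)[of f v] m(1) by (simp add: mult_le_0_iff)
  qed
  have bij: "bij (A v)" for v
    using linear_injective_imp_surjective[OF lin inj] inj by (simp add: bij_def)
  define I where "I v = inv (A v)" for v
  have AI: "A v (I v y) = y" for v y
    unfolding I_def by (rule surj_f_inv_f[OF bij_is_surj[OF bij]])
  have IA: "I v (A v y) = y" for v y
    unfolding I_def using inj by simp
  have linI: "linear (I v)" for v
  proof (rule linearI)
    show "I v (x + y) = I v x + I v y" for x y
    proof -
      have "A v (I v x + I v y) = x + y" by (simp only: linear_add[OF lin] AI)
      thus ?thesis using IA[of v "I v x + I v y"] by simp
    qed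
    show "I v (r *\<^sub>R x) = r *\<^sub>R I v x" for r x
    proof -
      have "A v (r *\<^sub>R I v x) = r *\<^sub>R x" by (simp only: linear_scale[OF lin] AI)
      thus ?thesis using IA[of v "r *\<^sub>R I v x"] by simp
    qed
  qed
  have nI: "norm (I v y) \<le> norm y / m" for v y
    using m(2)[of "I v y" v] m(1) by (simp add: AI field_simps)
  have cont0: "continuous_on UNIV (\<lambda>v. I v (c v))" if A0: "\<And>b. continuous_on UNIV (\<lambda>v. A v b)" and c0: "continuous_on UNIV c" for c :: "'a \<Rightarrow> 'b"
    unfolding continuous_on_def
  proof
    fix v :: 'a
    let ?w = "I v (c v)"
    have "((\<lambda>u. norm (c u - A u ?w) / m) \<longlongrightarrow> norm (c v - A v ?w) / m) (at v within UNIV)"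
      using A0[of ?w] c0 m(1) by (intro tendsto_intros) (auto simp: continuous_on_def)
    hence lim: "((\<lambda>u. norm (c u - A u ?w) / m) \<longlongrightarrow> 0) (at v)" by (simp add: AI)
    have "((\<lambda>u. I u (c u) - ?w) \<longlongrightarrow> 0) (at v)"
    proof (rule Lim_null_comparison[OF always_eventually lim], rule allI)
      fix u
      have "I u (c u) - ?w = I u (c u - A u ?w)" by (simp add: linear_diff[OF linI] IA)
      thus "norm (I u (c u) - ?w) \<le> norm (c u - A u ?w) / m" using nI by simp
    qed
    thus "((\<lambda>u. I u (c u)) \<longlongrightarrow> ?w) (at v within UNIV)" by (simp add: LIM_zero_cancel)
  qed
  have deriv: "((\<lambda>v. I v (c v)) has_derivative (\<lambda>e. I v (dd c e v - dd (\<lambda>u. A u (I v (c v))) e v))) (at v)"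
    if A1: "\<And>b. smooth 1 (\<lambda>v. A v b)" and c1: "smooth 1 c" for c :: "'a \<Rightarrow> 'b" and v
  proof -
    define w0 where "w0 = I v (c v)"
    \<comment> \<open>With the solution frozen at \<open>v\<close>, the difference
      \<open>I u (c u) - w0\<close> equals \<open>I u (r u)\<close>. The derivative of
      \<open>r\<close> at \<open>v\<close> is \<rho>, and passing from \<open>A u\<close> to
      \<open>A v\<close> costs the factor \<open>N u\<close>, which tends to zero.\<close>
    define r where "r u = c u - A u w0" for u
    define \<rho> where "\<rho> e = dd c e v - dd (\<lambda>u. A u w0) e v" for e
    have r: "(r has_derivative \<rho>) (at v)"
      unfolding r_def \<rho>_def by (intro has_derivative_diff has_derivative_dd[OF c1] has_derivative_dd[OF A1]) auto
    have \<rho>lin: "bounded_linear \<rho>" using r has_derivative_bounded_linear by blast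
    then obtain C where C: "\<And>e. norm (\<rho> e) \<le> C * norm e"
      using bounded_linear.bounded[OF \<rho>lin] by (auto simp: mult.commute)
    have Aw0: "A v w0 = c v" by (simp add: w0_def AI)
    have r0: "r v = 0" by (simp add: r_def Aw0)
    have blin: "bounded_linear (\<lambda>e. I v (\<rho> e))"
      using bounded_linear_compose[OF linear_conv_bounded_linear[THEN iffD1, OF linI] \<rho>lin] .
    define N where "N u = (\<Sum>b\<in>Basis. norm (A u b - A v b))" for u
    have N: "norm (A u p - A v p) \<le> N u * norm p" for u p
    proof -
      have "linear (\<lambda>p. A u p - A v p)" by (intro linear_compose_sub lin)
      from linear_bound_Basis[OF this, of p] show ?thesis by (simp add: N_def)
    qed
    have limN: "(N \<longlongrightarrow> 0) (at v)"
    proof -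
      have "((\<lambda>u. A u b) \<longlongrightarrow> A v b) (at v)" for b
        using smooth_continuous[OF A1[of b], of UNIV] by (simp add: continuous_on_def)
      hence "(N \<longlongrightarrow> (\<Sum>b\<in>Basis. norm (A v b - A v b))) (at v)"
        unfolding N_def by (intro tendsto_intros)
      thus ?thesis by simp
    qed
    have limr: "((\<lambda>u. norm (r u - r v - \<rho> (u - v)) / norm (u - v)) \<longlongrightarrow> 0) (at v)"
      using r by (simp add: has_derivative_iff_norm)
    have "((\<lambda>u. norm (I u (c u) - w0 - I v (\<rho> (u - v))) / norm (u - v)) \<longlongrightarrow> 0) (at v)"
    proof (rule Lim_null_comparison[OF always_eventually, OF allI])
      have "((\<lambda>u. (norm (r u - r v - \<rho> (u - v)) / norm (u - v) + N u * (C / m)) / m) \<longlongrightarrow> (0 + 0 * (C / m)) / m) (at v)"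
        using m(1) by (intro tendsto_intros limr limN) auto
      thus "((\<lambda>u. (norm (r u - r v - \<rho> (u - v)) / norm (u - v) + N u * (C / m)) / m) \<longlongrightarrow> 0) (at v)" by simp
      fix u
      let ?p = "I v (\<rho> (u - v))"
      have "I u (c u) - w0 - ?p = I u ((r u - r v - \<rho> (u - v)) - (A u ?p - A v ?p))"
        by (simp add: linear_diff[OF linI] IA AI r_def Aw0)
      hence "norm (I u (c u) - w0 - ?p) \<le> norm ((r u - r v - \<rho> (u - v)) - (A u ?p - A v ?p)) / m"
        using nI by simp
      also have "\<dots> \<le> (norm (r u - r v - \<rho> (u - v)) + N u * (C * norm (u - v) / m)) / m"
      proof (rule divide_right_mono)
        have "norm ?p \<le> C * norm (u - v) / m"
          using order_trans[OF nI divide_right_mono[OF C]] m(1) by simp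
        moreover have "0 \<le> N u" unfolding N_def by (intro sum_nonneg) auto
        ultimately have "norm (A u ?p - A v ?p) \<le> N u * (C * norm (u - v) / m)"
          by (intro order_trans[OF N[of u ?p]] mult_left_mono)
        thus "norm ((r u - r v - \<rho> (u - v)) - (A u ?p - A v ?p)) \<le> norm (r u - r v - \<rho> (u - v)) + N u * (C * norm (u - v) / m)"
          using norm_triangle_ineq4[of "r u - r v - \<rho> (u - v)" "A u ?p - A v ?p"] by linarith
      qed (use m in simp)
      finally have le: "norm (I u (c u) - w0 - ?p) \<le> (norm (r u - r v - \<rho> (u - v)) + N u * (C * norm (u - v) / m)) / m" .
      show "norm (norm (I u (c u) - w0 - ?p) / norm (u - v)) \<le> (norm (r u - r v - \<rho> (u - v)) / norm (u - v) + N u * (C / m)) / m"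
      proof (cases "u = v")
        case False
        hence "norm (u - v) > 0" by simp
        from divide_right_mono[OF le, of "norm (u - v)"] this show ?thesis
          by (simp add: add_divide_distrib mult.commute)
      next
        case True
        have "N v = 0" by (simp add: N_def)
        thus ?thesis using True by simp
      qed
    qed
    thus ?thesis
      unfolding has_derivative_iff_norm using blin by (simp add: \<rho>_def w0_def)
  qed
  have main: "smooth n (\<lambda>v. I v (c v))" if "\<And>b. smooth n (\<lambda>v. A v b)" "smooth n c" for n and c :: "'a \<Rightarrow> 'b"
    using that
  proof (induction n arbitrary: c)
    case 0
    thus ?case using cont0 by (simp add: smooth.simps)
  next
    case (Suc n)
    have A1: "smooth 1 (\<lambda>v. A v b)" for b by (rule smooth_mono[OF Suc.prems(1)]) simp
    have c1: "smooth 1 c" by (rule smooth_mono[OF Suc.prems(2)]) simp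
    have An: "smooth n (\<lambda>v. A v b)" for b by (rule smooth_mono[OF Suc.prems(1)]) simp
    have wn: "smooth n (\<lambda>v. I v (c v))" by (rule Suc.IH[OF An]) (rule smooth_mono[OF Suc.prems(2)], simp)
    show ?case
    proof (rule smooth_SucI[OF deriv[OF A1 c1]])
      fix e
      have "smooth n (\<lambda>v. dd (\<lambda>u. A u (I v (c v))) e v)"
      proof (rule smooth_linear_apply[where A="\<lambda>v p. dd (\<lambda>u. A u p) e v", OF _ _ wn])
        show "smooth n (\<lambda>x. dd (\<lambda>u. A u b) e x)" for b
          using smooth_dd[OF Suc.prems(1), of n b e] by simp
        show "linear (\<lambda>p. dd (\<lambda>u. A u p) e v)" for v
        proof (rule linearI)
          show "dd (\<lambda>u. A u (x + y)) e v = dd (\<lambda>u. A u x) e v + dd (\<lambda>u. A u y) e v" for x y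
            unfolding linear_add[OF lin]
            by (rule dd_eqI) (intro has_derivative_add has_derivative_dd[OF A1] zero_less_one)
          show "dd (\<lambda>u. A u (r *\<^sub>R x)) e v = r *\<^sub>R dd (\<lambda>u. A u x) e v" for r x
            unfolding linear_scale[OF lin]
            by (rule dd_eqI) (intro has_derivative_scaleR_right has_derivative_dd[OF A1] zero_less_one)
        qed
      qed
      thus "smooth n (\<lambda>v. I v (dd c e v - dd (\<lambda>u. A u (I v (c v))) e v))"
        using Suc.prems(2) by (intro Suc.IH An smooth_diff) (auto simp: smooth.simps(2))
    qed
  qed
  have wI: "w = (\<lambda>v. I v (c v))"
    unfolding w[symmetric] IA by simp
  show "smooth n w" unfolding wI by (rule main[OF A c])
  assume n: "0 < n"
  have "dd w e v = I v (dd c e v - dd (\<lambda>u. A u (w v)) e v)"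
    using dd_eqI[OF deriv[of c v], of e] smooth_mono[OF A, of 1] smooth_mono[OF c, of 1] n by (simp add: wI)
  thus "A v (dd w e v) = dd c e v - dd (\<lambda>u. A u (w v)) e v" by (simp add: AI)
qed

lemma smooth_section: "smooth n G \<Longrightarrow> smooth n (\<lambda>v. G (x, v))"
  by (rule smooth_compose[OF _ smooth_Pair[OF smooth_const smooth_ident]])

lemma dd_section:
  assumes "smooth n G" "0 < n"
  shows "dd (\<lambda>v. G (x, v)) f v = dd G (0, f) (x, v)"
proof -
  have "((\<lambda>v. (x, v)) has_derivative (\<lambda>f. (0, f))) (at v)"
    by (auto intro!: derivative_eq_intros)
  from dd_eqI[OF has_derivative_compose[OF this has_derivative_dd[OF assms]], of f] show ?thesis by simp
qed

lemma gaussV_dd: "dd gaussV c = (\<lambda>v. v \<bullet> c)" "dd (dd gaussV c) e v = e \<bullet> c"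
proof -
  show 1: "dd gaussV c = (\<lambda>v. v \<bullet> c)" using dd_eqI[OF gaussV_deriv] by blast
  show "dd (dd gaussV c) e v = e \<bullet> c"
    unfolding 1 by (rule dd_eqI) (auto intro!: derivative_eq_intros)
qed

locale verlet_flow = potential +
  fixes h T :: real and n :: nat
  assumes h: "h > 0" and n: "n \<ge> 1" and T: "T = real n * h" and LT: "L * (T\<^sup>2 + T * h) \<le> 1 / 6"
begin

text \<open>Positions and half-kicked velocities along the discrete trajectory.\<close>

definition X :: "nat \<Rightarrow> 'a \<times> 'a \<Rightarrow> 'a" where "X j z = fst ((psi h ^^ j) z)"
definition Y :: "nat \<Rightarrow> 'a \<times> 'a \<Rightarrow> 'a" where "Y j z = uu h ((psi h ^^ j) z)"

lemma T_pos: "T > 0" using h n T by simp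

lemma smooth_psi_pow: "smooth 3 (psi h ^^ j)"
proof (induction j)
  case (Suc j)
  have "smooth 3 (\<lambda>z. psi h ((psi h ^^ j) z))" by (rule smooth_compose[OF smooth_psi Suc]) simp
  thus ?case by (simp add: o_def)
qed (simp add: id_def)

lemma smooth_X: "k \<le> 3 \<Longrightarrow> smooth k (X j)" and smooth_Y: "k \<le> 3 \<Longrightarrow> smooth k (Y j)"
  unfolding X_def Y_def
  by (rule smooth_mono[of 3], rule smooth_compose[OF smooth_fst smooth_psi_pow], simp)
    (rule smooth_mono[of 3], rule smooth_compose[OF smooth_uu smooth_psi_pow], simp_all)

lemma X_Suc: "X (Suc j) = (\<lambda>z. X j z + h *\<^sub>R Y j z)"
  by (simp add: fun_eq_iff X_def Y_def psi_def yy_def)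

text \<open>The half kick that ends a step and the one that opens the next act at the same position
  and merge into a full kick. This brings the trajectory into the form treated by
  \<open>discrete_gronwall\<close>.\<close>

lemma Y_Suc: "Y (Suc j) = (\<lambda>z. Y j z - h *\<^sub>R g (X (Suc j) z))"
  by (simp add: fun_eq_iff X_def Y_def psi_def uu_def[of h "(_, _)"] algebra_simps) (simp flip: scaleR_add_left)

lemma X_deriv: "(X j has_derivative (\<lambda>c. dd (X j) c z)) (at z)"
  and Y_deriv: "(Y j has_derivative (\<lambda>c. dd (Y j) c z)) (at z)"
  by (rule has_derivative_dd[OF smooth_X[of 3]] has_derivative_dd[OF smooth_Y[of 3]]; simp)+

lemma dX_deriv: "(dd (X j) c has_derivative (\<lambda>e. dd (dd (X j) c) e z)) (at z)"
  and dY_deriv: "(dd (Y j) c has_derivative (\<lambda>e. dd (dd (Y j) c) e z)) (at z)"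
  by (rule has_derivative_dd[OF smooth_dd[OF smooth_X[of 3], of 2]] has_derivative_dd[OF smooth_dd[OF smooth_Y[of 3], of 2]]; simp)+

lemma dd_X_0: "dd (X 0) c = (\<lambda>z. fst c)"
  unfolding X_def by (rule ext, rule dd_eqI) (auto intro!: derivative_eq_intros)

lemma dd_Y_0: "dd (Y 0) c = (\<lambda>z. snd c - (h/2) *\<^sub>R dd g (fst c) (fst z))"
  unfolding Y_def using dd_eqI[OF uu_deriv, of h c] by (simp add: fun_eq_iff uu'_def)

lemma dd_X_Suc: "dd (X (Suc j)) c = (\<lambda>z. dd (X j) c z + h *\<^sub>R dd (Y j) c z)"
  unfolding X_Suc by (rule ext, rule dd_eqI) (intro has_derivative_add has_derivative_scaleR_right X_deriv Y_deriv)

lemma gX_deriv: "((\<lambda>z. g (X j z)) has_derivative (\<lambda>c. dd g (dd (X j) c z) (X j z))) (at z)"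
  by (rule has_derivative_compose[OF X_deriv gd])

lemma dd_Y_Suc: "dd (Y (Suc j)) c = (\<lambda>z. dd (Y j) c z - h *\<^sub>R dd g (dd (X (Suc j)) c z) (X (Suc j) z))"
  unfolding Y_Suc
  by (rule ext, rule dd_eqI) (intro has_derivative_diff has_derivative_scaleR_right Y_deriv gX_deriv)

lemma dd_g_sum: "dd g a y = (\<Sum>b\<in>Basis. (a \<bullet> b) *\<^sub>R dd g b y)"
  by (rule linear_Basis_sum[OF glin])

lemma dd_dd_g_sum: "dd (dd g a) p y = (\<Sum>b\<in>Basis. (a \<bullet> b) *\<^sub>R dd (dd g b) p y)"
proof -
  have "dd g a = (\<lambda>y. \<Sum>b\<in>Basis. (a \<bullet> b) *\<^sub>R dd g b y)"
    by (rule ext, rule dd_g_sum)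
  thus ?thesis
    by (simp only:) (rule dd_eqI, intro has_derivative_sum has_derivative_scaleR_right has_derivative_dd[OF smooth_dd[OF g, of 2]]; simp)
qed

text \<open>Direction and base point both vary; the basis expansion separates them, so that the
  product rule applies.\<close>

lemma dd_g_deriv:
  assumes a: "(a has_derivative a') (at z)" and k: "(k has_derivative k') (at z)"
  shows "((\<lambda>z. dd g (a z) (k z)) has_derivative (\<lambda>c. dd g (a' c) (k z) + dd (dd g (a z)) (k' c) (k z))) (at z)"
proof -
  have eq: "(\<lambda>z. dd g (a z) (k z)) = (\<lambda>z. \<Sum>b\<in>Basis. (a z \<bullet> b) *\<^sub>R dd g b (k z))"
    by (rule ext, rule dd_g_sum)
  have gk: "((\<lambda>z. dd g b (k z)) has_derivative (\<lambda>c. dd (dd g b) (k' c) (k z))) (at z)" for b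
    by (rule has_derivative_compose[OF k has_derivative_dd[OF smooth_dd[OF g, of 2]]]) auto
  have "((\<lambda>z. dd g (a z) (k z)) has_derivative
     (\<lambda>c. \<Sum>b\<in>Basis. (a z \<bullet> b) *\<^sub>R dd (dd g b) (k' c) (k z) + (a' c \<bullet> b) *\<^sub>R dd g b (k z))) (at z)"
    unfolding eq by (intro has_derivative_sum has_derivative_scaleR has_derivative_inner_left a gk)
  thus ?thesis
    by (rule has_derivative_eq_rhs)
      (simp add: fun_eq_iff sum.distrib dd_dd_g_sum[of "a z"] flip: dd_g_sum)
qed

lemma dd_dd_X_Suc: "dd (dd (X (Suc j)) c) e z = dd (dd (X j) c) e z + h *\<^sub>R dd (dd (Y j) c) e z"
  unfolding dd_X_Suc by (rule dd_eqI) (intro has_derivative_add has_derivative_scaleR_right dX_deriv dY_deriv)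

lemma dd_dd_Y_Suc: "dd (dd (Y (Suc j)) c) e z = dd (dd (Y j) c) e z
    - h *\<^sub>R (dd g (dd (dd (X (Suc j)) c) e z) (X (Suc j) z)
      + dd (dd g (dd (X (Suc j)) c z)) (dd (X (Suc j)) e z) (X (Suc j) z))"
  unfolding dd_Y_Suc
  by (rule dd_eqI) (intro has_derivative_diff has_derivative_scaleR_right dY_deriv dd_g_deriv dX_deriv X_deriv)

text \<open>Differentiating the recursion in direction \<open>c\<close> gives a linear recursion
  without source, started at \<open>fst c\<close> with velocity \<open>snd c\<close> up to a half
  kick. The second bound measures the distance from free motion.\<close>

lemma dd_X_bounds:
  shows "j \<le> n \<Longrightarrow> norm (dd (X j) c z) \<le> 12/11 * (norm (fst c) + T * norm (snd c))"
    and "norm (dd (X n) c z - fst c - T *\<^sub>R snd c) \<le> 1/11 * (norm (fst c) + T * norm (snd c))"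
proof -
  have 0: "norm (dd (Y 0) c z - snd c) \<le> h * (L * norm (dd (X 0) c z) + 0)"
  proof -
    have "norm (dd (Y 0) c z - snd c) = h/2 * norm (dd g (fst c) (fst z))"
      using h by (simp add: dd_Y_0)
    also have "\<dots> \<le> h * (L * norm (fst c))" using h by (intro mult_mono H) auto
    finally show ?thesis by (simp add: dd_X_0)
  qed
  have s: "norm (dd (Y (Suc j)) c z - dd (Y j) c z) \<le> h * (L * norm (dd (X (Suc j)) c z) + 0)" for j
  proof -
    have "norm (dd (Y (Suc j)) c z - dd (Y j) c z) = h * norm (dd g (dd (X (Suc j)) c z) (X (Suc j) z))"
      using h by (simp add: dd_Y_Suc)
    thus ?thesis using H[of "dd (X (Suc j)) c z" "X (Suc j) z"] h by simp
  qed
  note gr = discrete_gronwall[where \<xi>="\<lambda>j. dd (X j) c z" and \<eta>="\<lambda>j. dd (Y j) c z" and p="snd c" and F=0,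
      OF h n T less_imp_le[OF L0] order_refl LT _ 0 s]
  show "j \<le> n \<Longrightarrow> norm (dd (X j) c z) \<le> 12/11 * (norm (fst c) + T * norm (snd c))"
    using gr(1)[of j] by (simp add: dd_X_Suc dd_X_0)
  show "norm (dd (X n) c z - fst c - T *\<^sub>R snd c) \<le> 1/11 * (norm (fst c) + T * norm (snd c))"
    using gr(2) by (simp add: dd_X_Suc dd_X_0)
qed

text \<open>Second derivatives start from zero and are driven only by the second derivative of
  \<open>g\<close> evaluated at two first derivatives of the trajectory; \<open>F\<close> bounds
  this source by the estimates for the latter.\<close>

lemma dd_dd_X_bound:
  "norm (dd (dd (X n) c) (0, f) z) \<le> 12/11 * (T\<^sup>2 * (LH * (12/11 * (norm (fst c) + T * norm (snd c))) * (12/11 * (T * norm f))))"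
proof -
  define F where "F = LH * (12/11 * (norm (fst c) + T * norm (snd c))) * (12/11 * (T * norm f))"
  have F0: "0 \<le> F" unfolding F_def using LH0 T_pos by (intro mult_nonneg_nonneg add_nonneg_nonneg) auto
  have x0: "dd (dd (X 0) c) (0, f) z = 0" unfolding dd_X_0 by (rule dd_eqI) (rule has_derivative_const)
  have "((\<lambda>z. snd c - (h/2) *\<^sub>R dd g (fst c) (fst z)) has_derivative
     (\<lambda>e. 0 - (h/2) *\<^sub>R (dd g 0 (fst z) + dd (dd g (fst c)) (fst e) (fst z)))) (at z)"
    by (intro has_derivative_diff has_derivative_const has_derivative_scaleR_right dd_g_deriv has_derivative_fst has_derivative_ident)
  from dd_eqI[OF this, of "(0, f)"]
  \<comment> \<open>The first half-kicked velocity depends on the initial velocity only through an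
    added copy of it, so this mixed second derivative vanishes.\<close>
  have y0: "dd (dd (Y 0) c) (0, f) z = 0"
    unfolding dd_Y_0 using linear_0[OF smooth_linear_dd[OF smooth_dd[OF g, of 2]]] by (simp add: dd_g_0)
  have s: "norm (dd (dd (Y (Suc j)) c) (0, f) z - dd (dd (Y j) c) (0, f) z) \<le> h * (L * norm (dd (dd (X (Suc j)) c) (0, f) z) + F)"
    if j: "Suc j \<le> n" for j
  proof -
    let ?a = "dd g (dd (dd (X (Suc j)) c) (0, f) z) (X (Suc j) z)"
    let ?b = "dd (dd g (dd (X (Suc j)) c z)) (dd (X (Suc j)) (0, f) z) (X (Suc j) z)"
    have "norm ?b \<le> LH * norm (dd (X (Suc j)) (0, f) z) * norm (dd (X (Suc j)) c z)" by (rule K)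
    also have "\<dots> = LH * norm (dd (X (Suc j)) c z) * norm (dd (X (Suc j)) (0, f) z)" by simp
    also have "\<dots> \<le> F"
      unfolding F_def using dd_X_bounds(1)[OF j, of c z] dd_X_bounds(1)[OF j, of "(0, f)" z] LH0 T_pos
      by (intro mult_mono mult_nonneg_nonneg) auto
    finally have b: "norm ?b \<le> F" .
    have "norm (dd (dd (Y (Suc j)) c) (0, f) z - dd (dd (Y j) c) (0, f) z) = h * norm (?a + ?b)"
      using h unfolding dd_dd_Y_Suc by simp
    also have "\<dots> \<le> h * (L * norm (dd (dd (X (Suc j)) c) (0, f) z) + F)"
      using h b H by (intro mult_left_mono norm_triangle_le add_mono) auto
    finally show ?thesis .
  qed
  have "norm (dd (dd (X n) c) (0, f) z) \<le> 12/11 * (norm (dd (dd (X 0) c) (0, f) z) + T * norm (0::'a) + T\<^sup>2 * F)"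
  proof (rule discrete_gronwall(1)[where \<xi>="\<lambda>j. dd (dd (X j) c) (0, f) z" and \<eta>="\<lambda>j. dd (dd (Y j) c) (0, f) z",
        OF h n T less_imp_le[OF L0] F0 LT dd_dd_X_Suc _ s order_refl])
    show "norm (dd (dd (Y 0) c) (0, f) z - 0) \<le> h * (L * norm (dd (dd (X 0) c) (0, f) z) + F)"
      using h F0 by (simp add: y0 x0)
  qed
  thus ?thesis by (simp add: x0 F_def)
qed

lemma one_shot_field:
  obtains w where "smooth 2 w" "\<And>v. dd (X n) (0, w v) (x, v) = dd (X n) (e, 0) (x, v)"
    "\<And>v. norm (w v) \<le> 6/5 * norm e / T" "\<And>v f. norm (dd w f v) \<le> 4 * LH * T\<^sup>2 * norm e * norm f"
proof -
  define A where "A v f = dd (X n) (0, f) (x, v)" for v f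
  define c where "c v = dd (X n) (e, 0) (x, v)" for v
  have sX: "smooth 3 (X n)" by (rule smooth_X) simp
  have lin: "linear (A v)" for v
  proof -
    have "linear (\<lambda>f. (0::'a, f::'a))" by (auto intro!: linearI)
    from linear_compose[OF this smooth_linear_dd[OF sX, of "(x, v)"]] show ?thesis
      by (simp add: A_def[abs_def] o_def)
  qed
  \<comment> \<open>The velocity block differs from \<open>T\<close> times the identity by at most
    \<open>T/11\<close>, which leaves the lower bound \<open>10/11 * T\<close>.\<close>
  have m: "10/11 * T * norm f \<le> norm (A v f)" for v f
  proof -
    have "norm (A v f - T *\<^sub>R f) \<le> 1/11 * (T * norm f)"
      using dd_X_bounds(2)[of "(0, f)" "(x, v)"] by (simp add: A_def)
    moreover have "norm (T *\<^sub>R f) \<le> norm (A v f) + norm (A v f - T *\<^sub>R f)"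
      by (metis norm_minus_commute norm_triangle_sub)
    ultimately show ?thesis using T_pos by simp
  qed
  have mpos: "10/11 * T > 0" using T_pos by simp
  have sA: "smooth 2 (\<lambda>v. A v b)" for b
    unfolding A_def by (rule smooth_section[OF smooth_dd[OF sX]]) simp
  have sc: "smooth 2 c"
    unfolding c_def by (rule smooth_section[OF smooth_dd[OF sX]]) simp
  have "\<exists>p. A v p = c v" for v
  proof -
    have "inj (A v)"
    proof (rule linear_injective_0[OF lin, THEN iffD2], intro allI impI)
      fix f assume "A v f = 0"
      thus "f = 0" using m[of f v] T_pos by (simp add: mult_le_0_iff)
    qed
    thus ?thesis using linear_injective_imp_surjective[OF lin] by (metis surjD)
  qed
  then obtain w where w: "\<And>v. A v (w v) = c v" by metis
  note solve = smooth_linear_solve[OF lin mpos m sA sc w]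
  have nc: "norm (c v) \<le> 12/11 * norm e" for v
    unfolding c_def using dd_X_bounds(1)[of n "(e, 0)" "(x, v)"] by simp
  \<comment> \<open>The factor 6/5 is the quotient of 12/11 and 10/11.\<close>
  have nw: "norm (w v) \<le> 6/5 * norm e / T" for v
    using m[of "w v" v] nc[of v] T_pos by (simp add: w field_simps)
  have nd: "norm (dd w f v) \<le> 4 * LH * T\<^sup>2 * norm e * norm f" for v f
  proof -
    have d1: "dd c f v = dd (dd (X n) (e, 0)) (0, f) (x, v)"
      unfolding c_def by (rule dd_section[OF smooth_dd[OF sX, of 2]]) auto
    have d2: "dd (\<lambda>u. A u (w v)) f v = dd (dd (X n) (0, w v)) (0, f) (x, v)"
      unfolding A_def by (rule dd_section[OF smooth_dd[OF sX, of 2]]) auto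
    define k where "k = 12/11 * (T\<^sup>2 * (LH * (12/11) * (12/11 * (T * norm f))))"
    have k0: "0 \<le> k" unfolding k_def using LH0 T_pos by (intro mult_nonneg_nonneg) auto
    have b1: "norm (dd c f v) \<le> k * norm e"
      unfolding d1 using dd_dd_X_bound[of "(e, 0)" f "(x, v)"] by (simp add: k_def mult_ac)
    have "norm (dd (\<lambda>u. A u (w v)) f v) \<le> k * (T * norm (w v))"
      unfolding d2 using dd_dd_X_bound[of "(0, w v)" f "(x, v)"] by (simp add: k_def mult_ac)
    also have "\<dots> \<le> k * (6/5 * norm e)"
      using nw[of v] T_pos k0 by (intro mult_left_mono) (auto simp: field_simps)
    finally have b2: "norm (dd (\<lambda>u. A u (w v)) f v) \<le> k * (6/5 * norm e)" .
    \<comment> \<open>The differentiated equation bounds \<open>dd w f v\<close> by two second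
      derivatives of the position, one from the right side and one from the operator applied to
      \<open>w v\<close>.\<close>
    have "10/11 * T * norm (dd w f v) \<le> norm (A v (dd w f v))" by (rule m)
    also have "A v (dd w f v) = dd c f v - dd (\<lambda>u. A u (w v)) f v" by (rule solve(2)) simp
    also have "norm (dd c f v - dd (\<lambda>u. A u (w v)) f v) \<le> k * norm e + k * (6/5 * norm e)"
      using b1 b2 norm_triangle_ineq4 by (smt (verit))
    also have "\<dots> = 11/5 * (12/11)^3 * T * (LH * T\<^sup>2 * norm e * norm f)"
      by (simp add: k_def eval_nat_numeral field_simps)
    finally have "norm (dd w f v) \<le> 11/10 * (11/5 * (12/11)^3) * (LH * T\<^sup>2 * norm e * norm f)"
      using T_pos by (simp add: field_simps)
    \<comment> \<open>The exact product is about 3.14.\<close>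
    also have "\<dots> \<le> 4 * (LH * T\<^sup>2 * norm e * norm f)"
      using LH0 by (intro mult_right_mono mult_nonneg_nonneg) (auto simp: eval_nat_numeral)
    finally show ?thesis by simp
  qed
  show thesis
    by (rule that[OF solve(1) _ nw nd]) (use w in \<open>simp add: A_def c_def\<close>)
qed

end

context verlet_flow begin

text \<open>A variation of the initial position becomes a variation of the Gaussian velocity along
  \<open>w\<close>. Under the Gaussian the Hessian is the identity, so the abstract estimate applies
  with \<Lambda> = 1 and a constant bound for the derivative of \<open>w\<close>.\<close>

lemma one_shot_rate:
  assumes f: "test_fun f" and e: "e \<noteq> 0"
  shows "\<bar>\<integral>v. dd f (dd (X n) (e, 0) (x, v)) (X n (x, v)) * exp (- gaussV v) \<partial>lborel\<bar>
    \<le> 3/2 * sqrt (1 / T\<^sup>2 + 27 * real DIM('a) * LH\<^sup>2 * T ^ 4) * norm e"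
proof -
  obtain w where w: "smooth 2 w" "\<And>v. dd (X n) (0, w v) (x, v) = dd (X n) (e, 0) (x, v)"
    "\<And>v. norm (w v) \<le> 6/5 * norm e / T" "\<And>v f. norm (dd w f v) \<le> 4 * LH * T\<^sup>2 * norm e * norm f"
    using one_shot_field by blast
  define \<phi> where "\<phi> = (\<lambda>v. f (X n (x, v)))"
  have sf: "smooth 1 f" using f by (auto simp: test_fun_def)
  have sX: "smooth 1 (X n)" by (rule smooth_X) simp
  have sF: "smooth 1 (\<lambda>v. X n (x, v))" by (rule smooth_section[OF sX])
  obtain B where B: "\<And>z e. \<bar>dd f e z\<bar> \<le> B * norm e" using f by (auto simp: test_fun_def)
  have d\<phi>: "dd \<phi> p v = dd f (dd (X n) (0, p) (x, v)) (X n (x, v))" for p v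
    unfolding \<phi>_def using dd_compose[of 0 f "\<lambda>v. X n (x, v)"] sf sF dd_section[OF sX zero_less_one] by simp
  have "\<bar>dd \<phi> p v\<bar> \<le> (\<bar>B\<bar> * (12/11 * T)) * norm p" for v p
  proof -
    have "\<bar>dd \<phi> p v\<bar> \<le> \<bar>B\<bar> * norm (dd (X n) (0, p) (x, v))"
      unfolding d\<phi> using B[of "dd (X n) (0, p) (x, v)" "X n (x, v)"]
        mult_right_mono[OF abs_ge_self[of B], of "norm (dd (X n) (0, p) (x, v))"] by simp
    also have "\<dots> \<le> \<bar>B\<bar> * (12/11 * (T * norm p))"
      using dd_X_bounds(1)[of n "(0, p)" "(x, v)"] by (intro mult_left_mono) auto
    finally show ?thesis by simp
  qed
  moreover have "0 \<le> f x" "f x \<le> 1" for x using f unfolding test_fun_def by blast+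
  ultimately have \<phi>: "test_fun \<phi>"
    using smooth_compose[OF sf sF] unfolding test_fun_def \<phi>_def by blast
  have [measurable]: "w \<in> borel_measurable borel" by (rule smooth_measurable[OF w(1)])
  define K where "K = 1 / T\<^sup>2 + 27 * real DIM('a) * LH\<^sup>2 * T ^ 4"
  have K: "K > 0" unfolding K_def using T_pos by (intro add_pos_nonneg) auto
  \<comment> \<open>Chosen so that half of it is the asserted rate; the comparison below leaves
    ample room, with 16 against 243 and 36/25 against 9.\<close>
  define \<alpha> where "\<alpha> = 3 * sqrt K * norm e"
  have w2: "(norm (w v))\<^sup>2 \<le> 36/25 * (norm e)\<^sup>2 / T\<^sup>2" for v
    using power_mono[OF w(3)[of v], of 2] by (simp add: power_mult_distrib power_divide)
  have iw: "integrable lborel (\<lambda>v. (norm (w v))\<^sup>2 * exp (- gaussV v))"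
  proof -
    define q where "q = 36/25 * (norm e)\<^sup>2 / T\<^sup>2"
    have "(norm (w v))\<^sup>2 \<le> \<bar>q\<bar>" for v using w2[of v] unfolding q_def[symmetric] by simp
    thus ?thesis
      by (intro Bochner_Integration.integrable_bound[OF integrable_mult_right[OF gaussV_integral(1), of q]])
        (auto intro!: AE_I2 mult_right_mono simp: abs_mult)
  qed
  have "\<bar>\<integral>v. dd \<phi> (w v) v * exp (- gaussV v) \<partial>lborel\<bar> \<le> \<alpha> / 2"
  proof (rule weighted_divergence_bound(1)[where \<iota>="\<lambda>x. x" and \<beta>="\<lambda>_. 4 * LH * T\<^sup>2 * norm e" and \<Lambda>=1,
        OF linear_ident smooth_gaussV w(1) \<phi> gaussV_integral iw])
    show "integrable lborel (\<lambda>z. (dd gaussV b z)\<^sup>2 * exp (- gaussV z))" if "b \<in> Basis" for b :: 'a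
    proof (rule Bochner_Integration.integrable_bound[OF gaussV_moment2(1)])
      show "AE v in lborel. norm ((dd gaussV b v)\<^sup>2 * exp (- gaussV v)) \<le> norm ((norm v)\<^sup>2 * exp (- gaussV v))"
        using power_mono[OF Basis_le_norm[OF that], of _ 2] by (auto simp: gaussV_dd intro!: AE_I2 mult_right_mono)
    qed (simp add: gaussV_dd)
    show "norm (dd w b z) \<le> 4 * LH * T\<^sup>2 * norm e" if "b \<in> Basis" for z b
      using w(4)[of b z] that by simp
    show "4 * LH * T\<^sup>2 * norm e \<le> 4 * LH * T\<^sup>2 * norm e" by simp
    show "\<bar>dd (dd gaussV j) i z\<bar> \<le> 1" if "i \<in> Basis" "j \<in> Basis" for i j z :: 'a
      using that by (simp add: gaussV_dd(2) inner_Basis)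
    show "(\<Sum>i\<in>Basis. \<Sum>j\<in>Basis. dd (dd gaussV j) i z * (a \<bullet> i) * (a \<bullet> j)) \<le> 1 * (norm a)\<^sup>2" for z a :: 'a
      using quadratic_form_sum[OF linear_id, of a] by (simp add: gaussV_dd(2) power2_norm_eq_inner)
    show "\<alpha> > 0" using K e by (simp add: \<alpha>_def)
    have "(\<integral>z. (real DIM('a) * (4 * LH * T\<^sup>2 * norm e)\<^sup>2 + 1 * (norm (w z))\<^sup>2) * exp (- gaussV z) \<partial>lborel)
       \<le> (\<integral>z. (real DIM('a) * (4 * LH * T\<^sup>2 * norm e)\<^sup>2 + 36/25 * (norm e)\<^sup>2 / T\<^sup>2) * exp (- gaussV (z::'a)) \<partial>lborel)"
      using w2 by (intro integral_mono_AE' integrable_mult_right gaussV_integral AE_I2 mult_right_mono add_mono) auto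
    also have "\<dots> = real DIM('a) * (4 * LH * T\<^sup>2 * norm e)\<^sup>2 + 36/25 * (norm e)\<^sup>2 / T\<^sup>2"
      unfolding integral_mult_right_zero gaussV_integral(2) by simp
    also have "\<dots> = (norm e)\<^sup>2 * (16 * (real DIM('a) * LH\<^sup>2 * T ^ 4) + 36/25 * (1 / T\<^sup>2))"
      by (simp add: power_mult_distrib algebra_simps flip: power_mult)
    also have "\<dots> \<le> (norm e)\<^sup>2 * (9 * K)"
    proof (rule mult_left_mono)
      have "0 \<le> real DIM('a) * LH\<^sup>2 * T ^ 4" "0 \<le> 1 / T\<^sup>2" by auto
      moreover have "9 * K = 9 * (1 / T\<^sup>2) + 243 * (real DIM('a) * LH\<^sup>2 * T ^ 4)" by (simp add: K_def)
      ultimately show "16 * (real DIM('a) * LH\<^sup>2 * T ^ 4) + 36/25 * (1 / T\<^sup>2) \<le> 9 * K" by linarith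
    qed simp
    also have "\<dots> = \<alpha>\<^sup>2" using K by (simp add: \<alpha>_def power_mult_distrib)
    finally show "(\<integral>z. (real DIM('a) * (4 * LH * T\<^sup>2 * norm e)\<^sup>2 + 1 * (norm (w z))\<^sup>2) * exp (- gaussV z) \<partial>lborel) \<le> \<alpha>\<^sup>2" .
  qed simp_all
  thus ?thesis by (simp add: d\<phi> w(2) \<alpha>_def K_def)
qed

text \<open>The rate is uniform in the base point, so it can be integrated along the segment from
  \<open>x\<close> to \<open>y\<close> with the fixed direction \<open>e\<close>; the compensating
  field may differ from point to point.\<close>

lemma one_shot_bound:
  assumes f: "test_fun f"
  shows "\<bar>(\<integral>v. f (X n (y, v)) * exp (- gaussV v) \<partial>lborel) - (\<integral>v. f (X n (x, v)) * exp (- gaussV v) \<partial>lborel)\<bar>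
    \<le> 3/2 * sqrt (1 / T\<^sup>2 + 27 * real DIM('a) * LH\<^sup>2 * T ^ 4) * norm (y - x)"
proof (cases "y = x")
  case False
  define e where "e = y - x"
  have e: "e \<noteq> 0" using False by (simp add: e_def)
  define C where "C = 3/2 * sqrt (1 / T\<^sup>2 + 27 * real DIM('a) * LH\<^sup>2 * T ^ 4) * norm e"
  have sf: "smooth 1 f" using f by (auto simp: test_fun_def)
  have sX: "smooth 3 (X n)" by (rule smooth_X) simp
  obtain B where B: "\<And>z e. \<bar>dd f e z\<bar> \<le> B * norm e" using f by (auto simp: test_fun_def)
  have r: "0 \<le> f x" "f x \<le> 1" for x using f unfolding test_fun_def by blast+
  define \<Phi> where "\<Phi> t v = f (X n (x + t *\<^sub>R e, v)) * exp (- gaussV v)" for t v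
  define \<Phi>' where "\<Phi>' t v = dd f (dd (X n) (e, 0) (x + t *\<^sub>R e, v)) (X n (x + t *\<^sub>R e, v)) * exp (- gaussV v)" for t v
  have "\<bar>(\<integral>v. \<Phi> 1 v \<partial>lborel) - (\<integral>v. \<Phi> 0 v \<partial>lborel)\<bar> \<le> C"
  proof (rule increment_bound[where f="\<lambda>t. \<integral>v. \<Phi> t v \<partial>lborel" and f'="\<lambda>t. \<integral>v. \<Phi>' t v \<partial>lborel" and g="\<lambda>_. C"])
    show "((\<lambda>_. C) has_integral C) {0..1::real}" using has_integral_const_real[of C 0 1] by simp
    show "\<bar>\<integral>v. \<Phi>' t v \<partial>lborel\<bar> \<le> C" for t
      unfolding \<Phi>'_def C_def by (rule one_shot_rate[OF f e])
    show "((\<lambda>t. \<integral>v. \<Phi> t v \<partial>lborel) has_real_derivative (\<integral>v. \<Phi>' t v \<partial>lborel)) (at t within {0..1})" if "t \<in> {0..1}" for t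
    proof (rule has_derivative_under_integral[where B="\<lambda>v. \<bar>B\<bar> * (12/11 * norm e) * exp (- gaussV v)", OF _ _ _ _ _ that])
      show "((\<lambda>t. \<Phi> t v) has_real_derivative \<Phi>' t v) (at t within {0..1})" for t v
      proof -
        have "((\<lambda>t. (x + t *\<^sub>R e, v)) has_derivative (\<lambda>t. t *\<^sub>R (e, 0))) (at t)"
          by (auto intro!: derivative_eq_intros)
        from has_derivative_compose[OF has_derivative_compose[OF this X_deriv] has_derivative_dd[OF sf zero_less_one]]
        have "((\<lambda>t. f (X n (x + t *\<^sub>R e, v))) has_derivative
          (\<lambda>s. dd f (dd (X n) (s *\<^sub>R (e, 0)) (x + t *\<^sub>R e, v)) (X n (x + t *\<^sub>R e, v)))) (at t)" .
        hence "((\<lambda>t. f (X n (x + t *\<^sub>R e, v))) has_real_derivative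
            dd f (dd (X n) (e, 0) (x + t *\<^sub>R e, v)) (X n (x + t *\<^sub>R e, v))) (at t)"
          by (simp only: linear_scale[OF smooth_linear_dd[OF sX]] linear_scale[OF smooth_linear_dd[OF sf zero_less_one]] zero_less_numeral
              has_real_derivative_iff_has_vector_derivative has_vector_derivative_def)
        thus ?thesis unfolding \<Phi>_def \<Phi>'_def
          by (intro DERIV_cmult_right[OF DERIV_subset[where s=UNIV]]) auto
      qed
      show "integrable lborel (\<lambda>v::'a. \<bar>B\<bar> * (12/11 * norm e) * exp (- gaussV v))"
        by (intro integrable_mult_right gaussV_integral)
      have mX: "(\<lambda>v. X n (x', v)) \<in> borel_measurable borel" for x'
        by (rule smooth_measurable[OF smooth_section[OF sX]])
      have [measurable]: "f \<in> borel_measurable borel" by (rule smooth_measurable[OF sf])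
      show "integrable lborel (\<Phi> t)" for t
        unfolding \<Phi>_def
        by (rule Bochner_Integration.integrable_bound[OF gaussV_integral(1)])
          (use r mX in \<open>auto intro!: AE_I2 simp: abs_mult mult_left_le_one_le\<close>)
      show "\<Phi>' t \<in> borel_measurable lborel" for t
      proof -
        have "smooth 0 (\<lambda>v. dd f (dd (X n) (e, 0) (x + t *\<^sub>R e, v)) (X n (x + t *\<^sub>R e, v)))"
          by (rule smooth_linear_apply[where A="\<lambda>v p. dd f p (X n (x + t *\<^sub>R e, v))"])
            (auto intro!: smooth_linear_dd[OF sf zero_less_one] smooth_compose[OF smooth_dd[OF sf zero_less_one]]
              smooth_section smooth_dd[OF sX] smooth_X)
        hence [measurable]: "(\<lambda>v. dd f (dd (X n) (e, 0) (x + t *\<^sub>R e, v)) (X n (x + t *\<^sub>R e, v))) \<in> borel_measurable borel"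
          by (rule smooth_measurable)
        show ?thesis unfolding \<Phi>'_def by measurable
      qed
      show "\<bar>\<Phi>' t v\<bar> \<le> \<bar>B\<bar> * (12/11 * norm e) * exp (- gaussV v)" for t v
      proof -
        let ?p = "dd (X n) (e, 0) (x + t *\<^sub>R e, v)"
        have "\<bar>dd f ?p (X n (x + t *\<^sub>R e, v))\<bar> \<le> \<bar>B\<bar> * norm ?p"
          using B[of ?p "X n (x + t *\<^sub>R e, v)"] mult_right_mono[OF abs_ge_self[of B], of "norm ?p"] by simp
        also have "\<dots> \<le> \<bar>B\<bar> * (12/11 * norm e)"
          using dd_X_bounds(1)[of n "(e, 0)" "(x + t *\<^sub>R e, v)"] by (intro mult_left_mono) auto
        finally show ?thesis by (simp add: \<Phi>'_def abs_mult mult_right_mono)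
      qed
    qed
  qed simp
  thus ?thesis by (simp add: \<Phi>_def C_def e_def)
qed simp

end

section \<open>The transition kernel\<close>

text \<open>Explicit coordinates make the Riesz representative visibly bounded linear in the
  functional, so it commutes with differentiation.\<close>

definition riesz :: "('a::euclidean_space \<Rightarrow>\<^sub>L real) \<Rightarrow> 'a" where
  "riesz A = (\<Sum>b\<in>Basis. blinfun_apply A b *\<^sub>R b)"

lemma bounded_linear_riesz: "bounded_linear riesz"
  unfolding riesz_def
  by (intro bounded_linear_sum bounded_linear_compose[OF bounded_linear_scaleR_left blinfun.bounded_linear_left])

lemma inner_riesz: "riesz A \<bullet> f = blinfun_apply A f"
proof -
  have "linear (blinfun_apply A)" by (simp add: blinfun.bounded_linear_right bounded_linear.linear)
  from linear_Basis_sum[OF this, of f] show ?thesis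
    unfolding riesz_def inner_sum_left by (simp add: inner_commute mult.commute)
qed

lemma norm_riesz: "norm (riesz A) \<le> norm A"
proof (cases "riesz A = 0")
  case False
  have "(norm (riesz A))\<^sup>2 = blinfun_apply A (riesz A)"
    by (simp add: power2_norm_eq_inner inner_riesz)
  also have "\<dots> \<le> norm A * norm (riesz A)" using norm_blinfun[of A "riesz A"] by simp
  finally show ?thesis using False by (simp add: power2_eq_square)
qed simp

lemma grad_eq_riesz:
  fixes U :: "'a::euclidean_space \<Rightarrow> real"
  assumes "U differentiable at x"
  shows "grad U x = riesz (fderiv U x)" and "(U has_derivative (\<lambda>e. grad U x \<bullet> e)) (at x)"
proof -
  have d: "(U has_derivative (\<lambda>e. e \<bullet> riesz (fderiv U x))) (at x)"
    using fderiv_works[OF assms] by (simp add: inner_commute[of _ "riesz _"] inner_riesz)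
  show eq: "grad U x = riesz (fderiv U x)"
    unfolding grad_def gderiv_def
  proof (rule the_equality)
    show "(U has_derivative (\<lambda>e. e \<bullet> riesz (fderiv U x))) (at x)" by (rule d)
    fix k assume "(U has_derivative (\<lambda>e. e \<bullet> k)) (at x)"
    hence "(\<lambda>e. e \<bullet> k) = (\<lambda>e. e \<bullet> riesz (fderiv U x))" using d has_derivative_unique by blast
    thus "k = riesz (fderiv U x)" by (metis inner_commute vector_eq_ldot)
  qed
  show "(U has_derivative (\<lambda>e. grad U x \<bullet> e)) (at x)" using d by (simp add: eq inner_commute)
qed

lemma C4_grad:
  fixes U :: "'a::euclidean_space \<Rightarrow> real"
  assumes "C4 U"
  shows "(U has_derivative (\<lambda>e. grad U x \<bullet> e)) (at x)"
    and "smooth 3 (grad U)"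
    and "dd (grad U) e x = riesz (blinfun_apply (D2 U x) e)"
    and "dd (dd (grad U) f) e x = riesz (blinfun_apply (blinfun_apply (D3 U x) e) f)"
proof -
  have C: "C1 U" "C1 (fderiv U)" "C1 (D2 U)" "C1 (D3 U)" using assms by (auto simp: C4_def)
  have diff: "U differentiable at x" "fderiv U differentiable at x" "D2 U differentiable at x" for x
    using C by (auto simp: C1_def)
  show "(U has_derivative (\<lambda>e. grad U x \<bullet> e)) (at x)" by (rule grad_eq_riesz[OF diff(1)])
  have g: "grad U = (\<lambda>x. riesz (fderiv U x))" using grad_eq_riesz(1)[OF diff(1)] by blast
  \<comment> \<open>Starting from continuity of the fourth derivative, each descent by one
    derivative gains one order of smoothness.\<close>
  have "smooth 0 (fderiv (D3 U))" using C(4) by (simp add: C1_def smooth.simps(1))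
  from smooth_fderiv[OF C(4) this] have "smooth (Suc 0) (fderiv (D2 U))" by (simp add: D3_def)
  from smooth_fderiv[OF C(3) this] have "smooth (Suc (Suc 0)) (fderiv (fderiv U))" by (simp add: D2_def)
  from smooth_fderiv[OF C(2) this] have "smooth 3 (fderiv U)" by (simp add: numeral_3_eq_3)
  thus "smooth 3 (grad U)" unfolding g by (rule smooth_bounded_linear[OF bounded_linear_riesz])
  show d1: "dd (grad U) e x = riesz (blinfun_apply (D2 U x) e)" for e x
    unfolding g D2_def
    by (rule dd_eqI) (rule bounded_linear.has_derivative[OF bounded_linear_riesz fderiv_works[OF diff(2)]])
  have eq: "dd (grad U) f = (\<lambda>x. riesz (blinfun_apply (D2 U x) f))" using d1 by blast
  show "dd (dd (grad U) f) e x = riesz (blinfun_apply (blinfun_apply (D3 U x) e) f)"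
    unfolding eq D3_def
    by (rule dd_eqI)
      (rule bounded_linear.has_derivative[OF bounded_linear_compose[OF bounded_linear_riesz blinfun.bounded_linear_left]
          fderiv_works[OF diff(3)], unfolded o_def])
qed

text \<open>Serves to exclude \<open>L = 0\<close>: for a potential that vanishes everywhere,
  Lebesgue measure would have to be finite.\<close>

lemma integrable_exp_not_flat:
  fixes U :: "'a::euclidean_space \<Rightarrow> real"
  assumes "integrable lborel (\<lambda>x. exp (- U x))"
  shows "\<exists>x. U x \<noteq> 0"
proof (rule ccontr)
  assume "\<not> (\<exists>x. U x \<noteq> 0)"
  hence "integrable lborel (indicator UNIV :: 'a \<Rightarrow> real)" using assms by (simp add: indicator_def)
  hence "emeasure lborel (UNIV :: 'a set) < \<infinity>" by (subst (asm) integrable_indicator_iff) simp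
  thus False by simp
qed

text \<open>The constant \<open>c\<close> leaves room for the logarithm of the normalising integral,
  which turns the exponential into a probability density.\<close>

lemma potential_of_C4:
  fixes U :: "'a::euclidean_space \<Rightarrow> real"
  assumes C: "C4 U" and min: "\<forall>x. U 0 \<le> U x" and U0: "U 0 = 0" and int: "integrable lborel (\<lambda>x. exp (- U x))"
    and b2: "bdd_above (range (\<lambda>x. norm (D2 U x)))" and L: "L = (SUP x. norm (D2 U x))"
    and b3: "bdd_above (range (\<lambda>x. norm (D3 U x)))" and LH: "LH = (SUP x. norm (D3 U x))"
  shows "potential (\<lambda>x. U x + c) (grad U) L LH"
proof
  have n2: "norm (D2 U x) \<le> L" for x unfolding L using b2 by (intro cSUP_upper) auto
  have n3: "norm (D3 U x) \<le> LH" for x unfolding LH using b3 by (intro cSUP_upper) auto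
  show "((\<lambda>x. U x + c) has_derivative (\<lambda>e. grad U x \<bullet> e)) (at x)" for x
    using has_derivative_add_const[OF C4_grad(1)[OF C]] .
  show "smooth 3 (grad U)" by (rule C4_grad[OF C])
  show H: "norm (dd (grad U) e x) \<le> L * norm e" for x e
  proof -
    have "norm (dd (grad U) e x) \<le> norm (blinfun_apply (D2 U x) e)"
      unfolding C4_grad(3)[OF C] by (rule norm_riesz)
    also have "\<dots> \<le> norm (D2 U x) * norm e" by (rule norm_blinfun)
    also have "\<dots> \<le> L * norm e" by (intro mult_right_mono n2) auto
    finally show ?thesis .
  qed
  show "norm (dd (dd (grad U) f) e x) \<le> LH * norm e * norm f" for x e f
  proof -
    have "norm (dd (dd (grad U) f) e x) \<le> norm (blinfun_apply (blinfun_apply (D3 U x) e) f)"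
      unfolding C4_grad(4)[OF C] by (rule norm_riesz)
    also have "\<dots> \<le> norm (blinfun_apply (D3 U x) e) * norm f" by (rule norm_blinfun)
    also have "\<dots> \<le> norm (D3 U x) * norm e * norm f" by (intro mult_right_mono norm_blinfun) auto
    also have "\<dots> \<le> LH * norm e * norm f" by (intro mult_right_mono n3) auto
    finally show ?thesis .
  qed
  have "(\<lambda>e. grad U 0 \<bullet> e) = (\<lambda>e. 0)"
    by (rule differential_zero_maxmin[OF _ open_UNIV C4_grad(1)[OF C]]) (use min in auto)
  thus g0: "grad U 0 = 0" by (metis inner_eq_zero_iff)
  show "0 \<le> LH" using order_trans[OF norm_ge_zero n3] .
  have "0 \<le> L" using order_trans[OF norm_ge_zero n2] .
  moreover have "L \<noteq> 0"
  \<comment> \<open>With \<open>L = 0\<close> the gradient is constant, hence zero by its value at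
    the minimum, and then \<open>U\<close> vanishes identically.\<close>
  proof
    assume L0: "L = 0"
    have "(grad U has_derivative (\<lambda>e. 0)) (at x within UNIV)" for x
      using has_derivative_dd[OF C4_grad(2)[OF C], of x] H[of _ x] L0 by simp
    from has_derivative_zero_unique[OF convex_UNIV this] g0 have "grad U x = 0" for x by (metis UNIV_I)
    hence "(U has_derivative (\<lambda>e. 0)) (at x within UNIV)" for x
      using C4_grad(1)[OF C, of x] by simp
    from has_derivative_zero_unique[OF convex_UNIV this] U0 have "U x = 0" for x by (metis UNIV_I)
    thus False using integrable_exp_not_flat[OF int] by simp
  qed
  ultimately show "0 < L" by simp
qed

lemma (in potential) verlet_step_eq_psi: "g = grad U' \<Longrightarrow> verlet_step U' h = psi h"
  by (auto simp: fun_eq_iff verlet_step_def Let_def psi_def yy_def uu_def power2_eq_square algebra_simps)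

lemma std_gaussian_eq: "std_gaussian = density lborel (\<lambda>v. ennreal (exp (- gaussV v)))"
  by (simp add: std_gaussian_def exp_gaussV)

lemma prob_space_std_gaussian: "prob_space (std_gaussian :: 'a::euclidean_space measure)"
proof (rule prob_spaceI)
  have "emeasure (std_gaussian :: 'a measure) (space std_gaussian) = (\<integral>\<^sup>+v. ennreal (exp (- gaussV (v::'a))) \<partial>lborel)"
    by (simp add: std_gaussian_eq emeasure_density cong: nn_integral_cong)
  also have "\<dots> = 1"
    using gaussV_integral by (subst nn_integral_eq_integral) auto
  finally show "emeasure (std_gaussian :: 'a measure) (space std_gaussian) = 1" .
qed

lemma (in verlet_flow) uhmc_kernel_eq:
  assumes "g = grad U'"
  shows "uhmc_kernel U' T h x = distr std_gaussian borel (\<lambda>v. X n (x, v))"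
  unfolding uhmc_kernel_def T verlet_q_grid[OF h] verlet_step_eq_psi[OF assms] X_def ..

lemma (in verlet_flow) uhmc_kernel_measurable:
  assumes "g = grad U'"
  shows "uhmc_kernel U' T h \<in> measurable borel (subprob_algebra borel)"
proof -
  have X: "X n \<in> measurable borel borel" by (rule smooth_measurable[OF smooth_X[of 0]]) simp
  hence "case_prod (\<lambda>x v. X n (x, v)) \<in> measurable (borel \<Otimes>\<^sub>M borel) borel"
    unfolding borel_prod by (simp add: case_prod_unfold)
  hence "case_prod (\<lambda>x v. X n (x, v)) \<in> measurable (borel \<Otimes>\<^sub>M (std_gaussian :: 'a measure)) borel"
    by (subst measurable_cong_sets[of _ "borel \<Otimes>\<^sub>M borel" _ borel]) (auto simp: std_gaussian_eq intro!: sets_pair_measure_cong)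
  moreover have "(\<lambda>x. std_gaussian) \<in> measurable borel (subprob_algebra (std_gaussian :: 'a measure))"
    by (intro measurable_const) (simp add: space_subprob_algebra prob_space_imp_subprob_space prob_space_std_gaussian)
  ultimately have "(\<lambda>x. distr std_gaussian borel (\<lambda>v. X n (x, v))) \<in> measurable borel (subprob_algebra borel)"
    by (rule measurable_distr2)
  moreover have "uhmc_kernel U' T h = (\<lambda>x. distr std_gaussian borel (\<lambda>v. X n (x, v)))"
    by (rule ext, rule uhmc_kernel_eq[OF assms])
  ultimately show ?thesis by (simp only:)
qed

text \<open>The transition operator applied to \<open>f\<close>, written against Lebesgue measure so
  that the estimates for the velocity integral apply as they stand.\<close>

definition (in verlet_flow) transition :: "('a \<Rightarrow> real) \<Rightarrow> 'a \<Rightarrow> real" where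
  "transition f x = (\<integral>v. f (X n (x, v)) * exp (- gaussV v) \<partial>lborel)"

lemma (in verlet_flow) transition_props:
  assumes f: "test_fun f"
  shows "0 \<le> transition f x" "transition f x \<le> 1" "transition f \<in> borel_measurable borel"
    and "g = grad U' \<Longrightarrow> (\<integral>\<^sup>+y. ennreal (f y) \<partial>uhmc_kernel U' T h x) = ennreal (transition f x)"
proof -
  have r: "0 \<le> f x" "f x \<le> 1" for x using f unfolding test_fun_def by blast+
  have sf: "smooth 1 f" using f by (auto simp: test_fun_def)
  have [measurable]: "f \<in> borel_measurable borel" by (rule smooth_measurable[OF sf])
  have [measurable]: "(\<lambda>v. X n (x, v)) \<in> measurable borel borel" for x
    by (rule smooth_measurable[OF smooth_section[OF smooth_X[of 0]]]) simp
  have i: "integrable lborel (\<lambda>v. f (X n (x, v)) * exp (- gaussV v))" for x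
    by (rule Bochner_Integration.integrable_bound[OF gaussV_integral(1)])
      (use r in \<open>auto intro!: AE_I2 simp: abs_mult mult_left_le_one_le\<close>)
  show "0 \<le> transition f x" unfolding transition_def using r by (intro integral_nonneg_AE AE_I2) auto
  have "transition f x \<le> (\<integral>v. exp (- gaussV (v::'a)) \<partial>lborel)"
    unfolding transition_def using r by (intro integral_mono i gaussV_integral) (auto simp: mult_left_le_one_le)
  thus "transition f x \<le> 1" by (simp add: gaussV_integral)
  define C where "C = 3/2 * sqrt (1 / T\<^sup>2 + 27 * real DIM('a) * LH\<^sup>2 * T ^ 4)"
  \<comment> \<open>Measurability is read off from the regularising effect: the transition operator
    turns test functions into Lipschitz functions.\<close>
  have "C-lipschitz_on UNIV (transition f)"
  proof (rule lipschitz_onI)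
    show "dist (transition f y) (transition f x) \<le> C * dist y x" for x y
      unfolding transition_def dist_norm C_def real_norm_def by (rule one_shot_bound[OF f])
    show "0 \<le> C" by (simp add: C_def)
  qed
  thus "transition f \<in> borel_measurable borel"
    by (intro borel_measurable_continuous_onI lipschitz_on_continuous_on)
  assume g: "g = grad U'"
  have "(\<integral>\<^sup>+y. ennreal (f y) \<partial>uhmc_kernel U' T h x) = (\<integral>\<^sup>+v. ennreal (f (X n (x, v))) \<partial>std_gaussian)"
    unfolding uhmc_kernel_eq[OF g] by (subst nn_integral_distr) (auto simp: std_gaussian_eq)
  also have "\<dots> = (\<integral>\<^sup>+v. ennreal (f (X n (x, v)) * exp (- gaussV v)) \<partial>lborel)"
    unfolding std_gaussian_eq using r by (subst nn_integral_density) (auto simp: ennreal_mult mult.commute)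
  also have "\<dots> = ennreal (transition f x)"
    unfolding transition_def using r i by (intro nn_integral_eq_integral) auto
  finally show "(\<integral>\<^sup>+y. ennreal (f y) \<partial>uhmc_kernel U' T h x) = ennreal (transition f x)" .
qed

lemma (in verlet_flow) invariant_integral:
  assumes f: "test_fun f" and g: "g = grad U'" and \<nu>: "prob_space \<nu>" "sets \<nu> = sets borel"
    and inv: "\<nu> \<bind> uhmc_kernel U' T h = \<nu>"
  shows "(\<integral>x. f x \<partial>\<nu>) = (\<integral>x. transition f x \<partial>\<nu>)"
proof -
  interpret prob_space \<nu> by fact
  have r: "0 \<le> f x" "f x \<le> 1" for x using f unfolding test_fun_def by blast+
  have mf: "f \<in> borel_measurable borel" using f smooth_measurable[of 1 f] by (auto simp: test_fun_def)
  note t = transition_props[OF f]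
  have mt: "transition f \<in> borel_measurable \<nu>" using t(3) \<nu>(2) by (simp cong: measurable_cong_sets)
  have it: "integrable \<nu> (transition f)"
    by (rule integrable_const_bound[of _ 1]) (use t mt in auto)
  have K: "uhmc_kernel U' T h \<in> measurable \<nu> (subprob_algebra borel)"
    using uhmc_kernel_measurable[OF g] \<nu>(2) by (simp cong: measurable_cong_sets)
  have "ennreal (\<integral>x. f x \<partial>\<nu>) = (\<integral>\<^sup>+x. ennreal (f x) \<partial>\<nu>)"
    using r test_fun_integrable[OF finite_measure_axioms \<nu>(2) f] by (intro nn_integral_eq_integral[symmetric]) auto
  also have "\<dots> = (\<integral>\<^sup>+x. ennreal (f x) \<partial>(\<nu> \<bind> uhmc_kernel U' T h))" by (simp only: inv)
  also have "\<dots> = (\<integral>\<^sup>+x. \<integral>\<^sup>+y. ennreal (f y) \<partial>uhmc_kernel U' T h x \<partial>\<nu>)"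
    by (rule nn_integral_bind[OF _ K]) (use mf in auto)
  also have "\<dots> = (\<integral>\<^sup>+x. ennreal (transition f x) \<partial>\<nu>)" by (simp only: t(4)[OF g])
  also have "\<dots> = ennreal (\<integral>x. transition f x \<partial>\<nu>)"
    using t(1) it by (intro nn_integral_eq_integral) auto
  finally show ?thesis
    using r t(1) by (subst (asm) ennreal_inj) (auto intro!: integral_nonneg_AE)
qed

text \<open>The easy half of Kantorovich duality: a Lipschitz function integrates differently by at
  most its Lipschitz constant times the cost of any coupling, and the infimum over couplings follows
  without an optimal one.\<close>

lemma (in verlet_flow) transition_W1:
  assumes f: "test_fun f" and \<nu>: "prob_space \<nu>" and M: "0 \<le> M" "W1 \<nu> \<eta> \<le> ennreal M"
  shows "\<bar>(\<integral>x. transition f x \<partial>\<nu>) - (\<integral>x. transition f x \<partial>\<eta>)\<bar>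
    \<le> 3/2 * sqrt (1 / T\<^sup>2 + 27 * real DIM('a) * LH\<^sup>2 * T ^ 4) * M"
proof -
  define C where "C = 3/2 * sqrt (1 / T\<^sup>2 + 27 * real DIM('a) * LH\<^sup>2 * T ^ 4)"
  have "0 < 1 / T\<^sup>2 + 27 * real DIM('a) * LH\<^sup>2 * T ^ 4" using T_pos by (intro add_pos_nonneg) auto
  hence C: "C > 0" by (simp add: C_def)
  note t = transition_props[OF f]
  have lip: "\<bar>transition f y - transition f x\<bar> \<le> C * norm (y - x)" for x y
    unfolding transition_def C_def by (rule one_shot_bound[OF f])
  define a where "a = \<bar>(\<integral>x. transition f x \<partial>\<nu>) - (\<integral>x. transition f x \<partial>\<eta>)\<bar>"
  have "ennreal (a / C) \<le> (\<integral>\<^sup>+z. ennreal (norm (fst z - snd z)) \<partial>\<gamma>)" if "\<gamma> \<in> couplings \<nu> \<eta>" for \<gamma>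
  proof -
    have c: "sets \<gamma> = sets (borel \<Otimes>\<^sub>M borel) \<and> distr \<gamma> borel fst = \<nu> \<and> distr \<gamma> borel snd = \<eta>"
      using that unfolding couplings_def by (rule CollectD)
    note s = conjunct1[OF c, unfolded borel_prod] and d1 = conjunct1[OF conjunct2[OF c]] and d2 = conjunct2[OF conjunct2[OF c]]
    have ms: "fst \<in> measurable \<gamma> borel" "snd \<in> measurable \<gamma> borel"
      by (simp_all add: measurable_cong_sets[OF s refl])
    have "prob_space (distr \<gamma> borel fst)" using \<nu> d1 by simp
    hence "prob_space \<gamma>" using prob_space_distrD[OF ms(1)] by blast
    then interpret G: prob_space \<gamma> .
    have i: "integrable \<gamma> (\<lambda>z. transition f (fst z))" "integrable \<gamma> (\<lambda>z. transition f (snd z))"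
      using t measurable_compose[OF ms(1) t(3)] measurable_compose[OF ms(2) t(3)]
      by (auto intro!: G.integrable_const_bound[of _ 1])
    have "a = \<bar>\<integral>z. transition f (fst z) - transition f (snd z) \<partial>\<gamma>\<bar>"
      unfolding a_def d1[symmetric] d2[symmetric]
      using i by (simp add: integral_distr[OF ms(1) t(3)] integral_distr[OF ms(2) t(3)])
    hence "ennreal a \<le> (\<integral>\<^sup>+z. ennreal (norm (transition f (fst z) - transition f (snd z))) \<partial>\<gamma>)"
      using integral_norm_bound_ennreal[OF Bochner_Integration.integrable_diff[OF i]] by simp
    also have "\<dots> \<le> (\<integral>\<^sup>+z. ennreal C * ennreal (norm (fst z - snd z)) \<partial>\<gamma>)"
      using lip C by (intro nn_integral_mono) (auto simp: ennreal_mult[symmetric] intro!: ennreal_leI)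
    also have "\<dots> = ennreal C * (\<integral>\<^sup>+z. ennreal (norm (fst z - snd z)) \<partial>\<gamma>)"
    proof (rule nn_integral_cmult)
      show "(\<lambda>z. ennreal (norm (fst z - snd z))) \<in> borel_measurable \<gamma>"
        by (rule measurable_compose[OF borel_measurable_diff[OF ms], of "\<lambda>w. ennreal (norm w)"]) measurable
    qed
    finally have "ennreal a \<le> ennreal C * (\<integral>\<^sup>+z. ennreal (norm (fst z - snd z)) \<partial>\<gamma>)" .
    hence "ennreal (1 / C) * ennreal a \<le> ennreal (1 / C) * (ennreal C * (\<integral>\<^sup>+z. ennreal (norm (fst z - snd z)) \<partial>\<gamma>))"
      by (intro mult_left_mono) auto
    thus ?thesis using C by (simp add: mult.assoc[symmetric] ennreal_mult[symmetric] a_def)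
  qed
  hence "ennreal (a / C) \<le> W1 \<nu> \<eta>" unfolding W1_def by (intro INF_greatest)
  hence "ennreal (a / C) \<le> ennreal M" using M(2) by simp
  hence "a / C \<le> M" using M(1) by simp
  thus ?thesis using C unfolding a_def C_def[symmetric] by (simp add: field_simps)
qed

lemma test_fun_fst:
  fixes f :: "'a::euclidean_space \<Rightarrow> real"
  assumes f: "test_fun f" shows "test_fun (\<lambda>z::'a \<times> 'b::euclidean_space. f (fst z))"
proof -
  have sf: "smooth 1 f" using f by (auto simp: test_fun_def)
  obtain B where B: "\<And>z e. \<bar>dd f e z\<bar> \<le> B * norm e" using f by (auto simp: test_fun_def)
  have "\<bar>dd (\<lambda>z::'a \<times> 'b. f (fst z)) e z\<bar> \<le> \<bar>B\<bar> * norm e" for z e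
  proof -
    have "dd (\<lambda>z::'a \<times> 'b. f (fst z)) e z = dd f (fst e) (fst z)"
      by (rule dd_eqI) (rule has_derivative_compose[OF has_derivative_fst[OF has_derivative_ident] has_derivative_dd[OF sf zero_less_one]])
    hence "\<bar>dd (\<lambda>z::'a \<times> 'b. f (fst z)) e z\<bar> \<le> \<bar>B\<bar> * norm (fst e)"
      using B[of "fst e" "fst z"] mult_right_mono[OF abs_ge_self[of B], of "norm (fst e)"] by simp
    also have "\<dots> \<le> \<bar>B\<bar> * norm e" by (intro mult_left_mono) (metis norm_fst_le prod.collapse, simp)
    finally show ?thesis .
  qed
  moreover have "0 \<le> f x" "f x \<le> 1" for x using f unfolding test_fun_def by blast+
  ultimately show ?thesis
    using smooth_compose[OF sf smooth_fst] unfolding test_fun_def by blast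
qed

lemma (in gibbs_potential) integral_V_Fubini:
  assumes "integrable lborel (\<lambda>z. F z * exp (- V z))"
  shows "(\<integral>z. F z * exp (- V z) \<partial>lborel) = (\<integral>x. exp (- U x) * (\<integral>v. F (x, v) * exp (- gaussV v) \<partial>lborel) \<partial>lborel)"
proof -
  have "(\<integral>z. F z * exp (- V z) \<partial>lborel) = (\<integral>x. \<integral>v. F (x, v) * exp (- V (x, v)) \<partial>lborel \<partial>lborel)"
    using lborel_pair.integral_fst'[of "\<lambda>z. F z * exp (- V z)"] assms by (simp add: lborel_prod)
  also have "\<dots> = (\<integral>x. \<integral>v. exp (- U x) * (F (x, v) * exp (- gaussV v)) \<partial>lborel \<partial>lborel)"
    by (simp add: exp_V mult_ac)
  finally show ?thesis by simp
qed

theorem theorem7: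
  fixes U :: "real ^ 'n \<Rightarrow> real"
    and \<mu> \<mu>' :: "(real ^ 'n) measure"
    and \<pi>' :: "real ^ 'n \<Rightarrow> (real ^ 'n) measure"
    and d L L\<^sub>H L\<^sub>I T h M\<^sub>1 M\<^sub>2 c :: real
    and C :: ennreal
  assumes d: "d = real CARD('n)"
    and U_C4: "C4 U"
    and U_int: "integrable lborel (\<lambda>x. exp (- U x))"
    and U_min: "\<forall>x. U 0 \<le> U x"
    and U_0: "U 0 = 0"
    and bdd2: "bdd_above (range (\<lambda>x. norm (D2 U x)))" and L: "L = (SUP x. norm (D2 U x))"
    and bdd3: "bdd_above (range (\<lambda>x. norm (D3 U x)))" and L\<^sub>H: "L\<^sub>H = (SUP x. norm (D3 U x))"
    and bdd4: "bdd_above (range (\<lambda>x. norm (D4 U x)))" and L\<^sub>I: "L\<^sub>I = (SUP x. norm (D4 U x))"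
    and \<mu>: "\<mu> = gibbs U"
    and T: "T > 0" and h: "h > 0" and T_h: "T / h \<in> \<nat>"
    and LT: "L * (T\<^sup>2 + T * h) \<le> 1 / 6"
    and \<pi>': "\<pi>' = uhmc_kernel U T h"
    and \<mu>'_prob: "prob_space \<mu>'" and \<mu>'_sets: "sets \<mu>' = sets borel"
    and \<mu>'_inv: "\<mu>' \<bind> \<pi>' = \<mu>'"
    and A5_const: "M\<^sub>1 > 0" "c > 0"
    and A5: "\<And>m \<nu>. m \<ge> 1 \<Longrightarrow> prob_space \<nu> \<Longrightarrow> sets \<nu> = sets borel \<Longrightarrow>
               W1 (\<nu> \<bind> kernel_power \<pi>' m) \<mu>' \<le> ennreal (M\<^sub>1 * exp (- c * real m)) * W1 \<nu> \<mu>'"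
    and A6_const: "M\<^sub>2 > 0"
    and A6: "W1 \<mu> \<mu>' \<le> ennreal (M\<^sub>2 * h\<^sup>2)"
    and C: "C = ennreal_sqrt (
        ennreal (
          d ^ 3 * (4 * L\<^sub>I\<^sup>2 * T ^ 4 + 14 * L\<^sub>H\<^sup>2 * L\<^sub>I * T ^ 6 + 14 * L\<^sub>H ^ 4 * T ^ 8)
          + d\<^sup>2 * (35 * L\<^sub>H\<^sup>2 * T\<^sup>2 + 8 * L\<^sub>I\<^sup>2 * T ^ 4 + 28 * L\<^sub>H\<^sup>2 * L\<^sub>I * T ^ 6 + 28 * L\<^sub>H ^ 4 * T ^ 8)
          + d * (16 * L\<^sup>2 + 4 * L\<^sub>H\<^sup>2 * T\<^sup>2))
        + ennreal (2 * d * L\<^sub>H\<^sup>2 + L\<^sup>2 / T\<^sup>2) * (\<integral>\<^sup>+ x. ennreal (norm x ^ 2) \<partial>\<mu>)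
        + ennreal (d * L\<^sub>I\<^sup>2 + d * L\<^sub>H\<^sup>2 * L\<^sub>I * T\<^sup>2 + d * L\<^sub>H ^ 4 * T ^ 4 + L\<^sub>H\<^sup>2 / T\<^sup>2)
          * (\<integral>\<^sup>+ x. ennreal (norm x ^ 4) \<partial>\<mu>))"
  shows "ennreal (TV \<mu> \<mu>')
    \<le> ennreal (h\<^sup>2) * (ennreal (3 / 2 * sqrt (1 / T\<^sup>2 + 27 * d * L\<^sub>H\<^sup>2 * T ^ 4) * M\<^sub>2) + C)"
proof -
  obtain n where "T / h = real n" using T_h by (auto elim: Nats_cases)
  hence Tn: "T = real n * h" using h by (simp add: field_simps)
  have n: "n \<ge> 1" using T h Tn by (cases n) auto
  have hT: "h \<le> T" using n h by (simp add: Tn)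
  have d': "d = real DIM(real ^ 'n)" by (simp add: d)
  define Z where "Z = (\<integral>x. exp (- U x) \<partial>lborel)"
  have Z: "Z > 0"
  proof -
    have "Z \<noteq> 0"
    proof
      assume "Z = 0"
      hence "AE x in lborel. exp (- U x) = 0"
        using integral_nonneg_eq_0_iff_AE[OF U_int] by (simp add: Z_def)
      hence "AE x in (lborel :: (real ^ 'n) measure). False" by simp
      hence "emeasure lborel (UNIV :: (real ^ 'n) set) = 0" by (simp add: AE_iff_measurable[of UNIV])
      thus False by simp
    qed
    moreover have "0 \<le> Z" unfolding Z_def by (intro integral_nonneg_AE) auto
    ultimately show ?thesis by simp
  qed
  \<comment> \<open>Normalising the density shifts the potential by a constant and leaves its
    gradient unchanged.\<close>
  define V where "V x = U x + ln Z" for x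
  have eV: "exp (- V x) = exp (- U x) / Z" for x
    using Z by (simp add: V_def exp_diff)
  have \<mu>d: "\<mu> = density lborel (\<lambda>x. ennreal (exp (- V x)))"
    unfolding \<mu> gibbs_def eV Z_def ..
  have pot: "potential V (grad U) L L\<^sub>H"
    unfolding V_def by (rule potential_of_C4[OF U_C4 U_min U_0 U_int bdd2 L bdd3 L\<^sub>H])
  then interpret P: potential V "grad U" L L\<^sub>H .
  interpret F: verlet_flow V "grad U" L L\<^sub>H h T n
    by unfold_locales (use h n Tn LT in auto)
  have LI0: "0 \<le> L\<^sub>I"
    unfolding L\<^sub>I using bdd4 by (intro cSUP_upper2[of _ _ 0]) auto
  have d1: "d \<ge> 1" by (simp add: d)
  define c0 where "c0 = d ^ 3 * (4 * L\<^sub>I\<^sup>2 * T ^ 4 + 14 * L\<^sub>H\<^sup>2 * L\<^sub>I * T ^ 6 + 14 * L\<^sub>H ^ 4 * T ^ 8)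
          + d\<^sup>2 * (35 * L\<^sub>H\<^sup>2 * T\<^sup>2 + 8 * L\<^sub>I\<^sup>2 * T ^ 4 + 28 * L\<^sub>H\<^sup>2 * L\<^sub>I * T ^ 6 + 28 * L\<^sub>H ^ 4 * T ^ 8)
          + d * (16 * L\<^sup>2 + 4 * L\<^sub>H\<^sup>2 * T\<^sup>2)"
  define c2 where "c2 = 2 * d * L\<^sub>H\<^sup>2 + L\<^sup>2 / T\<^sup>2"
  define c4 where "c4 = d * L\<^sub>I\<^sup>2 + d * L\<^sub>H\<^sup>2 * L\<^sub>I * T\<^sup>2 + d * L\<^sub>H ^ 4 * T ^ 4 + L\<^sub>H\<^sup>2 / T\<^sup>2"
  define E2 where "E2 = (\<integral>\<^sup>+ x. ennreal (norm x ^ 2) \<partial>\<mu>)"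
  define E4 where "E4 = (\<integral>\<^sup>+ x. ennreal (norm x ^ 4) \<partial>\<mu>)"
  define S where "S = ennreal c0 + ennreal c2 * E2 + ennreal c4 * E4"
  have C': "C = ennreal_sqrt S" unfolding C S_def c0_def c2_def c4_def E2_def E4_def ..
  have c2pos: "c2 > 0" unfolding c2_def using d1 P.L0 T by (intro add_nonneg_pos) auto
  have c4ge: "L\<^sub>H\<^sup>2 / T\<^sup>2 \<le> c4" unfolding c4_def using d1 LI0 by simp
  have c0ge: "35 * d\<^sup>2 * L\<^sub>H\<^sup>2 * T\<^sup>2 + 16 * d * L\<^sup>2 \<le> c0"
  proof -
    have "0 \<le> d ^ 3 * (4 * L\<^sub>I\<^sup>2 * T ^ 4 + 14 * L\<^sub>H\<^sup>2 * L\<^sub>I * T ^ 6 + 14 * L\<^sub>H ^ 4 * T ^ 8)"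
      using d1 LI0 T by (intro mult_nonneg_nonneg add_nonneg_nonneg) auto
    moreover have "d\<^sup>2 * (35 * L\<^sub>H\<^sup>2 * T\<^sup>2) \<le> d\<^sup>2 * (35 * L\<^sub>H\<^sup>2 * T\<^sup>2 + 8 * L\<^sub>I\<^sup>2 * T ^ 4 + 28 * L\<^sub>H\<^sup>2 * L\<^sub>I * T ^ 6 + 28 * L\<^sub>H ^ 4 * T ^ 8)"
      using LI0 T by (intro mult_left_mono) auto
    moreover have "d * (16 * L\<^sup>2) \<le> d * (16 * L\<^sup>2 + 4 * L\<^sub>H\<^sup>2 * T\<^sup>2)" using d1 by (intro mult_left_mono) auto
    ultimately show ?thesis unfolding c0_def by (simp add: mult_ac)
  qed
  have mV [measurable]: "V \<in> borel_measurable borel" by (rule smooth_measurable[OF P.smooth_U])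
  have iV: "integrable lborel (\<lambda>x. exp (- V x))" unfolding eV using U_int by simp
  have V1: "(\<integral>x. exp (- V x) \<partial>lborel) = 1" unfolding eV using Z by (simp flip: Z_def)
  have \<mu>_sets: "sets \<mu> = sets borel" by (simp add: \<mu>d)
  have \<mu>_prob: "prob_space \<mu>"
  proof (rule prob_spaceI)
    have "emeasure \<mu> (space \<mu>) = (\<integral>\<^sup>+x. ennreal (exp (- V x)) \<partial>lborel)"
      by (simp add: \<mu>d emeasure_density cong: nn_integral_cong)
    thus "emeasure \<mu> (space \<mu>) = 1" using iV V1 by (simp add: nn_integral_eq_integral)
  qed
  have int_\<mu>: "(\<integral>x. \<phi> x \<partial>\<mu>) = (\<integral>x. exp (- V x) * \<phi> x \<partial>lborel)" if "\<phi> \<in> borel_measurable borel" for \<phi> :: "real ^ 'n \<Rightarrow> real"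
    unfolding \<mu>d using that by (subst integral_density) auto
  have E: "(\<integral>\<^sup>+ x. ennreal (norm x ^ k) \<partial>\<mu>) = (\<integral>\<^sup>+ x. ennreal (norm x ^ k * exp (- V x)) \<partial>lborel)" for k
    unfolding \<mu>d by (subst nn_integral_density) (auto simp: ennreal_mult mult.commute)
  show ?thesis
  proof (cases "S = \<infinity>")
    \<comment> \<open>An infinite radicand makes the right side infinite because \<open>h\<close> is
      positive; below, all moments that are used are finite.\<close>
    case True
    hence "C = \<infinity>" by (simp add: C' ennreal_sqrt_def)
    thus ?thesis using h by (simp add: ennreal_mult_top)
  next
    case False
    \<comment> \<open>The coefficient of the second moment is positive since \<open>L\<close> is, so
      a finite radicand forces this moment to be finite.\<close>
    have E2: "E2 < \<infinity>"
    proof (rule ccontr)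
      assume "\<not> E2 < \<infinity>"
      hence "ennreal c2 * E2 = \<infinity>" using c2pos by (simp add: ennreal_mult_eq_top_iff not_less top_unique)
      thus False using False by (simp add: S_def)
    qed
    have E4: "E4 < \<infinity>" if "L\<^sub>H \<noteq> 0"
    proof (rule ccontr)
      assume "\<not> E4 < \<infinity>"
      moreover have "c4 > 0" by (rule less_le_trans[OF _ c4ge]) (use that T in simp)
      ultimately have "ennreal c4 * E4 = \<infinity>" by (simp add: ennreal_mult_eq_top_iff not_less top_unique)
      thus False using False by (simp add: S_def)
    qed
    have i2: "integrable lborel (\<lambda>x. (norm x)\<^sup>2 * exp (- V x))"
      by (rule integrableI_nonneg) (use E2 in \<open>auto simp: E2_def E\<close>)
    have i4': "integrable lborel (\<lambda>x. (norm x) ^ 4 * exp (- V x))" if "L\<^sub>H \<noteq> 0"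
      by (rule integrableI_nonneg) (use E4[OF that] in \<open>auto simp: E4_def E\<close>)
    \<comment> \<open>For \<open>L\<^sub>H = 0\<close> the integrand is zero, whatever the fourth
      moment is.\<close>
    have i4: "integrable lborel (\<lambda>x. L\<^sub>H\<^sup>2 * (norm x) ^ 4 * exp (- V x))"
      by (cases "L\<^sub>H = 0") (simp_all add: i4' mult.assoc)
    interpret G: gibbs_potential V "grad U" L L\<^sub>H
      by unfold_locales (use iV V1 i2 i4 in auto)
    define R where "R = enn2real S"
    have R0: "0 \<le> R" by (simp add: R_def)
    have SR: "S = ennreal R" using False by (simp add: R_def less_top)
    have m2: "ennreal G.m2 = E2"
      unfolding G.m2_def E2_def E using i2 by (intro nn_integral_eq_integral[symmetric]) auto
    have m4: "ennreal (G.m4 / T\<^sup>2) \<le> ennreal c4 * E4"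
    proof (cases "L\<^sub>H = 0")
      case True
      have "G.m4 = 0" by (subst G.m4_def) (simp add: True)
      thus ?thesis by simp
    next
      case False
      define q where "q = (\<integral>x. (norm x) ^ 4 * exp (- V x) \<partial>lborel)"
      have q0: "0 \<le> q" unfolding q_def by (intro integral_nonneg_AE) auto
      have q: "E4 = ennreal q"
        unfolding E4_def q_def E using i4'[OF False] by (intro nn_integral_eq_integral) auto
      have "G.m4 = L\<^sub>H\<^sup>2 * q" by (simp add: G.m4_def q_def mult.assoc)
      hence "G.m4 / T\<^sup>2 = L\<^sub>H\<^sup>2 / T\<^sup>2 * q" by simp
      also have "\<dots> \<le> c4 * q" using c4ge q0 by (rule mult_right_mono)
      finally show ?thesis unfolding q using q0 order_trans[OF _ c4ge, of 0]
        by (simp add: ennreal_mult'[symmetric] ennreal_leI)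
    qed
    have "ennreal (35 * d\<^sup>2 * L\<^sub>H\<^sup>2 * T\<^sup>2 + 16 * d * L\<^sup>2 + c2 * G.m2 + G.m4 / T\<^sup>2)
        = ennreal (35 * d\<^sup>2 * L\<^sub>H\<^sup>2 * T\<^sup>2 + 16 * d * L\<^sup>2) + ennreal c2 * ennreal G.m2 + ennreal (G.m4 / T\<^sup>2)"
    proof -
      have nn: "0 \<le> 35 * d\<^sup>2 * L\<^sub>H\<^sup>2 * T\<^sup>2 + 16 * d * L\<^sup>2" "0 \<le> c2 * G.m2" "0 \<le> G.m4 / T\<^sup>2"
        using c2pos G.m2_nonneg G.m4_nonneg d1 by auto
      have "0 \<le> c2" using c2pos by simp
      show ?thesis
        by (simp only: ennreal_plus[OF add_nonneg_nonneg[OF nn(1,2)] nn(3)] ennreal_plus[OF nn(1,2)]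
            ennreal_mult[OF \<open>0 \<le> c2\<close> G.m2_nonneg])
    qed
    also have "\<dots> \<le> S"
      unfolding S_def m2 using c0ge by (intro add_mono m4 order_refl ennreal_leI)
    finally have "35 * d\<^sup>2 * L\<^sub>H\<^sup>2 * T\<^sup>2 + 16 * d * L\<^sup>2 + c2 * G.m2 + G.m4 / T\<^sup>2 \<le> R"
      unfolding SR using R0 by (simp add: ennreal_le_iff)
    hence Rge: "35 * (real DIM(real ^ 'n))\<^sup>2 * L\<^sub>H\<^sup>2 * T\<^sup>2 + 16 * real DIM(real ^ 'n) * L\<^sup>2
      + (2 * real DIM(real ^ 'n) * L\<^sub>H\<^sup>2 + L\<^sup>2 / T\<^sup>2) * G.m2 + G.m4 / T\<^sup>2 \<le> R"
      unfolding c2_def d' .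
    have "0 \<le> L * (T * h)" using P.L0 T h by simp
    hence LT2: "L * T\<^sup>2 \<le> 1 / 6" using LT by (simp add: ring_distribs)
    interpret W: verlet_error V "grad U" L L\<^sub>H T R
      by unfold_locales (use T LT2 Rge in auto)
    define K where "K = 3 / 2 * sqrt (1 / T\<^sup>2 + 27 * d * L\<^sub>H\<^sup>2 * T ^ 4)"
    have K0: "0 \<le> K" using d1 by (simp add: K_def)
    have "TV \<mu> \<mu>' \<le> h\<^sup>2 * (K * M\<^sub>2 + sqrt R)"
    proof (rule TV_le_test_fun[OF \<mu>_prob \<mu>'_prob \<mu>_sets \<mu>'_sets])
      fix f :: "real ^ 'n \<Rightarrow> real" assume f: "test_fun f"
      have mf: "f \<in> borel_measurable borel" using f smooth_measurable[of 1 f] by (auto simp: test_fun_def)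
      note f1 = test_fun_fst[OF f, where 'b="real ^ 'n"]
      have tf: "test_fun (\<lambda>z. f (fst ((P.psi h ^^ k) z)))" for k
      proof (induction k)
        case (Suc k)
        from P.test_fun_psi[OF Suc, of h] show ?case by (simp add: funpow_swap1)
      qed (use f1 in simp)
      have "(\<integral>z. f (fst ((P.psi h ^^ n) z)) * exp (- G.V z) \<partial>lborel) = (\<integral>x. exp (- V x) * F.transition f x \<partial>lborel)"
        unfolding F.transition_def F.X_def
        by (rule G.integral_V_Fubini[OF W.test_fun_V_integrable[OF tf]])
      also have "\<dots> = (\<integral>x. F.transition f x \<partial>\<mu>)" by (rule int_\<mu>[OF F.transition_props(3)[OF f], symmetric])
      finally have e1: "(\<integral>z. f (fst ((P.psi h ^^ n) z)) * exp (- G.V z) \<partial>lborel) = (\<integral>x. F.transition f x \<partial>\<mu>)" .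
      have "(\<integral>z. f (fst z) * exp (- G.V z) \<partial>lborel)
          = (\<integral>x. exp (- V x) * (\<integral>v. f (fst (x, v :: real ^ 'n)) * exp (- gaussV v) \<partial>lborel) \<partial>lborel)"
        by (rule G.integral_V_Fubini[OF W.test_fun_V_integrable[OF f1]])
      also have "\<dots> = (\<integral>x. exp (- V x) * f x \<partial>lborel)" by (simp add: gaussV_integral)
      finally have e2: "(\<integral>z. f (fst z) * exp (- G.V z) \<partial>lborel) = (\<integral>x. f x \<partial>\<mu>)" by (simp add: int_\<mu>[OF mf])
      have "\<bar>(\<integral>x. F.transition f x \<partial>\<mu>) - (\<integral>x. f x \<partial>\<mu>)\<bar> \<le> real n * (sqrt R / T * (h ^ 3 / 3))"
        using W.verlet_iterate_error[OF f1 less_imp_le[OF h] hT, of n] by (simp only: e1 e2)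
      \<comment> \<open>Here \<open>n * h = T\<close> cancels the denominator: the local errors of
        third order add up to a global error of second order.\<close>
      also have "\<dots> = h\<^sup>2 * sqrt R / 3"
        using h n by (simp add: Tn field_simps power2_eq_square power3_eq_cube)
      also have "\<dots> \<le> h\<^sup>2 * sqrt R" using R0 by simp
      finally have 1: "\<bar>(\<integral>x. F.transition f x \<partial>\<mu>) - (\<integral>x. f x \<partial>\<mu>)\<bar> \<le> h\<^sup>2 * sqrt R" .
      have 2: "(\<integral>x. f x \<partial>\<mu>') = (\<integral>x. F.transition f x \<partial>\<mu>')"
        by (rule F.invariant_integral[OF f refl \<mu>'_prob \<mu>'_sets]) (use \<mu>'_inv in \<open>simp add: \<pi>'\<close>)
      have 3: "\<bar>(\<integral>x. F.transition f x \<partial>\<mu>) - (\<integral>x. F.transition f x \<partial>\<mu>')\<bar> \<le> K * (M\<^sub>2 * h\<^sup>2)"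
        using F.transition_W1[OF f \<mu>_prob _ A6] A6_const by (simp add: K_def d)
      have 4: "h\<^sup>2 * (K * M\<^sub>2 + sqrt R) = K * (M\<^sub>2 * h\<^sup>2) + h\<^sup>2 * sqrt R" by (simp add: algebra_simps)
      \<comment> \<open>The transition operator is inserted on both sides: under the invariant
        measure at no cost, under \<mu> at the cost of the discretisation error. The difference of
        the smoothed integrals is controlled by the Wasserstein distance.\<close>
      show "\<bar>(\<integral>x. f x \<partial>\<mu>) - (\<integral>x. f x \<partial>\<mu>')\<bar> \<le> h\<^sup>2 * (K * M\<^sub>2 + sqrt R)"
        using 1 2 3 unfolding 4 by linarith
    qed
    hence "ennreal (TV \<mu> \<mu>') \<le> ennreal (h\<^sup>2 * (K * M\<^sub>2 + sqrt R))" by (rule ennreal_leI)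
    also have "\<dots> = ennreal (h\<^sup>2) * (ennreal (K * M\<^sub>2) + ennreal (sqrt R))"
      using K0 A6_const R0 by (simp add: ennreal_mult ennreal_plus)
    also have "ennreal (sqrt R) = C" using False by (simp add: C' ennreal_sqrt_def R_def)
    finally show ?thesis by (simp only: K_def)
  qed
qed

end
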